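(* Let $\mathcal{B}\subset\mathcal{B}(G)$ be a von Neumann algebra and let $\vartheta$ be a faithful strongly continuous $E_0$-semigroup on $\mathcal{B}$. For $t\ge0$ let $E'_t:=\{x'\in\mathcal{B}(G):\vartheta_t(b)x'=x'b\ \forall b\in\mathcal{B}\}$ (the members of the intertwiner product system of $\vartheta$). Then for every $s\ge0$ and every $x'\in E'_s$ there is a family $(x'_t)_{t\ge0}$ with $x'_t\in E'_t$ for all $t$, $x'_s=x'$, and such that $t\mapsto x'_t\in\mathcal{B}(G)$ is strongly continuous; i.e. the intertwiner product system has enough strongly continuous sections.
   Context: An $E_0$-semigroup on $\mathcal{B}$ is a family $(\vartheta_t)_{t\ge0}$ of normal unital $*$-endomorphisms with $\vartheta_0=\mathrm{id}$, $\vartheta_{s+t}=\vartheta_s\circ\vartheta_t$. It is faithful if each $\vartheta_t$ is injective, and strongly continuous if $t\mapsto\vartheta_t(b)$ is strongly continuous for each $b\in\mathcal{B}$. The intertwiner product system $(E'_t)_{t\ge0}$ is a product system of von Neumann $\mathcal{B}'$-correspondences with bimodule actions by operator multiplication, inner product $\langle x',y'\rangle=x'^*y'$ and product $(x'_t,y'_s)\mapsto x'_ty'_s\in E'_{t+s}$. *)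

theory Defs
  imports "HOL-Analysis.Analysis"
begin

class complex_vector = real_vector +
  fixes scaleC :: "complex \<Rightarrow> 'a \<Rightarrow> 'a"
  assumes scaleC_add_right: "scaleC c (x + y) = scaleC c x + scaleC c y"
      and scaleC_add_left: "scaleC (c + d) x = scaleC c x + scaleC d x"
      and scaleC_scaleC: "scaleC c (scaleC d x) = scaleC (c * d) x"
      and scaleC_one: "scaleC 1 x = x"
      and scaleR_scaleC: "scaleR r x = scaleC (complex_of_real r) x"

class complex_hilbert = complex_vector + real_normed_vector + complete_space +
  fixes cinner :: "'a \<Rightarrow> 'a \<Rightarrow> complex"
  assumes cinner_add_right: "cinner x (y + z) = cinner x y + cinner x z"
      and cinner_scaleC_right: "cinner x (scaleC c y) = c * cinner x y"
      and cinner_commute: "cinner y x = cnj (cinner x y)"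
      and norm_cinner: "norm x = sqrt (Re (cinner x x))"

definition bounded_clinear :: "('a::complex_hilbert \<Rightarrow> 'a) \<Rightarrow> bool" where
  "bounded_clinear A \<longleftrightarrow> bounded_linear A \<and> (\<forall>c x. A (scaleC c x) = scaleC c (A x))"

definition adjoint :: "('a::complex_hilbert \<Rightarrow> 'a) \<Rightarrow> ('a \<Rightarrow> 'a)" where
  "adjoint A = (THE B. \<forall>x y. cinner (A x) y = cinner x (B y))"

definition selfadjoint :: "('a::complex_hilbert \<Rightarrow> 'a) \<Rightarrow> bool" where
  "selfadjoint A \<longleftrightarrow> bounded_clinear A \<and> (\<forall>x y. cinner (A x) y = cinner x (A y))"

definition op_le :: "('a::complex_hilbert \<Rightarrow> 'a) \<Rightarrow> ('a \<Rightarrow> 'a) \<Rightarrow> bool" where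
  "op_le A B \<longleftrightarrow> selfadjoint A \<and> selfadjoint B \<and>
     (\<forall>x. Re (cinner x (A x)) \<le> Re (cinner x (B x)))"

definition positive_op :: "('a::complex_hilbert \<Rightarrow> 'a) \<Rightarrow> bool" where
  "positive_op A \<longleftrightarrow> op_le (\<lambda>x. 0) A"

definition is_op_lub :: "('a::complex_hilbert \<Rightarrow> 'a) set \<Rightarrow> ('a \<Rightarrow> 'a) \<Rightarrow> bool" where
  "is_op_lub D s \<longleftrightarrow> selfadjoint s \<and> (\<forall>a\<in>D. op_le a s) \<and>
     (\<forall>u. selfadjoint u \<and> (\<forall>a\<in>D. op_le a u) \<longrightarrow> op_le s u)"

definition op_lub :: "('a::complex_hilbert \<Rightarrow> 'a) set \<Rightarrow> ('a \<Rightarrow> 'a)" where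
  "op_lub D = (THE s. is_op_lub D s)"

definition commutant :: "('a::complex_hilbert \<Rightarrow> 'a) set \<Rightarrow> ('a \<Rightarrow> 'a) set" where
  "commutant S = {T. bounded_clinear T \<and> (\<forall>A\<in>S. T \<circ> A = A \<circ> T)}"

text \<open>A von Neumann algebra: a self-adjoint set of bounded operators equal to its
  bicommutant (von Neumann's definition; such a set is automatically a unital
  *-algebra).\<close>
definition von_neumann_algebra :: "('a::complex_hilbert \<Rightarrow> 'a) set \<Rightarrow> bool" where
  "von_neumann_algebra M \<longleftrightarrow> (\<forall>A\<in>M. bounded_clinear A \<and> adjoint A \<in> M) \<and>
     M = commutant (commutant M)"

definition unital_star_endo ::
  "('a::complex_hilbert \<Rightarrow> 'a) set \<Rightarrow> (('a \<Rightarrow> 'a) \<Rightarrow> ('a \<Rightarrow> 'a)) \<Rightarrow> bool" where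
  "unital_star_endo M \<phi> \<longleftrightarrow>
     (\<forall>a\<in>M. \<phi> a \<in> M) \<and>
     (\<forall>a\<in>M. \<forall>b\<in>M. \<phi> (\<lambda>x. a x + b x) = (\<lambda>x. \<phi> a x + \<phi> b x)) \<and>
     (\<forall>a\<in>M. \<forall>c. \<phi> (\<lambda>x. scaleC c (a x)) = (\<lambda>x. scaleC c (\<phi> a x))) \<and>
     (\<forall>a\<in>M. \<forall>b\<in>M. \<phi> (a \<circ> b) = \<phi> a \<circ> \<phi> b) \<and>
     (\<forall>a\<in>M. \<phi> (adjoint a) = adjoint (\<phi> a)) \<and>
     \<phi> id = id"

definition normal_map ::
  "('a::complex_hilbert \<Rightarrow> 'a) set \<Rightarrow> (('a \<Rightarrow> 'a) \<Rightarrow> ('a \<Rightarrow> 'a)) \<Rightarrow> bool" where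
  "normal_map M \<phi> \<longleftrightarrow>
     (\<forall>D. D \<subseteq> M \<and> D \<noteq> {} \<and> (\<forall>a\<in>D. positive_op a) \<and>
          (\<forall>a\<in>D. \<forall>b\<in>D. \<exists>c\<in>D. op_le a c \<and> op_le b c) \<and>
          (\<exists>C. \<forall>a\<in>D. \<forall>x. norm (a x) \<le> C * norm x)
        \<longrightarrow> \<phi> (op_lub D) = op_lub (\<phi> ` D))"

definition E0_semigroup ::
  "('a::complex_hilbert \<Rightarrow> 'a) set \<Rightarrow> (real \<Rightarrow> ('a \<Rightarrow> 'a) \<Rightarrow> ('a \<Rightarrow> 'a)) \<Rightarrow> bool" where
  "E0_semigroup M \<theta> \<longleftrightarrow>
     (\<forall>t\<ge>0. unital_star_endo M (\<theta> t) \<and> normal_map M (\<theta> t)) \<and>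
     (\<forall>b\<in>M. \<theta> 0 b = b) \<and>
     (\<forall>s\<ge>0. \<forall>t\<ge>0. \<forall>b\<in>M. \<theta> (s + t) b = \<theta> s (\<theta> t b))"

definition faithful_semigroup ::
  "('a::complex_hilbert \<Rightarrow> 'a) set \<Rightarrow> (real \<Rightarrow> ('a \<Rightarrow> 'a) \<Rightarrow> ('a \<Rightarrow> 'a)) \<Rightarrow> bool" where
  "faithful_semigroup M \<theta> \<longleftrightarrow> (\<forall>t\<ge>0. inj_on (\<theta> t) M)"

definition strongly_continuous_semigroup ::
  "('a::complex_hilbert \<Rightarrow> 'a) set \<Rightarrow> (real \<Rightarrow> ('a \<Rightarrow> 'a) \<Rightarrow> ('a \<Rightarrow> 'a)) \<Rightarrow> bool" where
  "strongly_continuous_semigroup M \<theta> \<longleftrightarrow>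
     (\<forall>b\<in>M. \<forall>x. continuous_on {0..} (\<lambda>t. \<theta> t b x))"

definition intertwiners ::
  "('a::complex_hilbert \<Rightarrow> 'a) set \<Rightarrow> (real \<Rightarrow> ('a \<Rightarrow> 'a) \<Rightarrow> ('a \<Rightarrow> 'a)) \<Rightarrow> real \<Rightarrow> ('a \<Rightarrow> 'a) set" where
  "intertwiners M \<theta> t = {x'. bounded_clinear x' \<and> (\<forall>b\<in>M. \<theta> t b \<circ> x' = x' \<circ> b)}"

end

theory Submission
  imports Defs
begin

text \<open>
  The semigroup acts on normal functionals; being pointwise continuous there, it is norm continuous, by
  the argument that averages along a weakly continuous semigroup have norm-continuous orbits and norm
  approximate the functional after taking convex combinations. For a vector \<open>W\<close> let \<open>K\<^sub>t\<close> be the closed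
  convex set of vectors \<open>k\<close> with \<open>\<parallel>\<theta>\<^sub>t(b) k\<parallel> \<le> \<parallel>b W\<parallel>\<close> for all \<open>b\<close>. Norm continuity makes \<open>K\<^sub>t\<close> vary
  continuously in \<open>t\<close>, so the point \<open>k\<^sub>t\<close> of \<open>K\<^sub>t\<close> nearest to \<open>W\<close> is continuous in \<open>t\<close>, and \<open>k\<^sub>0 = W\<close>.
  Since \<open>b W \<mapsto> \<theta>\<^sub>t(b) k\<^sub>t\<close> is a contraction within the cyclic subspace of \<open>W\<close>, decomposing the space into
  orthogonal cyclic subspaces gives a strongly continuous family of contractions \<open>C\<^sub>t \<in> E'\<^sub>t\<close> with \<open>C\<^sub>0 = 1\<close>.
  A section through \<open>x' \<in> E'\<^sub>s\<close> is \<open>C\<^sub>t\<^sub>-\<^sub>s x'\<close> for \<open>t \<ge> s\<close>; for \<open>t < s\<close> it is interpolated from the elements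
  \<open>C\<^sub>t\<^sub>-\<^sub>u C\<^sub>s\<^sub>-\<^sub>u\<^sup>* x'\<close> of \<open>E'\<^sub>t\<close> with \<open>u < t\<close> close to \<open>s\<close>.
\<close>

section \<open>Complex Hilbert spaces\<close>

text \<open>The difficulty is a selection problem: the sets \<open>intertwiners M \<theta> t\<close>
  at neighbouring times have no evident relation. The sets K of the overview make one available. The
  square of \<open>norm (\<theta> t b k)\<close> is the value at \<open>adjoint b \<circ> b\<close>
  of the functional \<open>b \<mapsto> cinner k (\<theta> t b k)\<close>, so membership of
  \<open>k\<close> compares two functionals. If those of \<open>k\<close> at two times are close in
  norm, a small change of \<open>k\<close> restores membership; closeness at each single
  \<open>b\<close> would not do, because the comparison runs over all \<open>b\<close> at once.
  Neither \<open>'g\<close> nor the predual is assumed separable. Sequences become available because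
  one vector \<open>k\<close> is supported, at all times simultaneously, by countably many vectors.
  Nearest points serve as the selection for two reasons: strict convexity makes them unique, hence
  stable, and a projection in the commutant that fixes \<open>W\<close> must fix them, which keeps
  them cyclic. Left and right of \<open>s\<close> differ because the semigroup only runs forwards:
  after \<open>s\<close> a product suffices, before \<open>s\<close> a factor has to be removed by
  an adjoint.\<close>

abbreviation rinner :: "'a::complex_hilbert \<Rightarrow> 'a \<Rightarrow> real" where
  "rinner x y \<equiv> Re (cinner x y)"

lemma scaleC_zero_left [simp]: "scaleC 0 (x::'a::complex_vector) = 0"
  using scaleR_scaleC[of 0 x] by simp

lemma scaleC_zero_right [simp]: "scaleC c (0::'a::complex_vector) = 0"
  using scaleC_add_right[of c 0 "0::'a"] by simp

lemma scaleC_minus_one: "scaleC (-1) (x::'a::complex_vector) = - x"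
  using scaleR_scaleC[of "-1" x] by simp

lemma scaleC_minus_right: "scaleC c (- x) = - scaleC c (x::'a::complex_vector)"
  using scaleC_add_right[of c x "- x"] by (simp add: eq_neg_iff_add_eq_0 add.commute)

lemma scaleC_diff_right: "scaleC c (x - y) = scaleC c x - scaleC c (y::'a::complex_vector)"
  using scaleC_add_right[of c x "- y"] by (simp add: scaleC_minus_right)

lemma scaleC_sum_right: "scaleC c (\<Sum>i\<in>I. f i) = (\<Sum>i\<in>I. scaleC c (f i :: 'a::complex_vector))"
  by (induction I rule: infinite_finite_induct) (auto simp: scaleC_add_right)

lemma scaleC_scaleR: "scaleC c (scaleR r x) = scaleR r (scaleC c (x::'a::complex_vector))"
  by (simp add: scaleR_scaleC scaleC_scaleC mult.commute)

lemma cinner_add_left: "cinner (x + y) z = cinner x z + cinner y (z::'a::complex_hilbert)"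
  by (metis cinner_add_right cinner_commute complex_cnj_add)

lemma cinner_scaleC_left: "cinner (scaleC c x) y = cnj c * cinner x (y::'a::complex_hilbert)"
  by (metis cinner_commute cinner_scaleC_right complex_cnj_mult)

lemma cinner_scaleR_right [simp]: "cinner x (scaleR r y) = r * cinner x (y::'a::complex_hilbert)"
  by (simp add: scaleR_scaleC cinner_scaleC_right)

lemma cinner_scaleR_left [simp]: "cinner (scaleR r x) y = r * cinner x (y::'a::complex_hilbert)"
  by (simp add: scaleR_scaleC cinner_scaleC_left)

lemma rinner_scaleR_right: "rinner x (scaleR r y) = r * rinner x y"
  by simp

lemma cinner_zero_right [simp]: "cinner x (0::'a::complex_hilbert) = 0"
  using cinner_scaleR_right[of x 0 0] by simp

lemma cinner_zero_left [simp]: "cinner (0::'a::complex_hilbert) x = 0"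
  using cinner_scaleR_left[of 0 0 x] by simp

lemma cinner_minus_right [simp]: "cinner x (- y) = - cinner x (y::'a::complex_hilbert)"
  using cinner_scaleR_right[of x "-1" y] by simp

lemma cinner_minus_left [simp]: "cinner (- x) y = - cinner x (y::'a::complex_hilbert)"
  using cinner_scaleR_left[of "-1" x y] by simp

lemma cinner_diff_right: "cinner x (y - z) = cinner x y - cinner x (z::'a::complex_hilbert)"
  using cinner_add_right[of x y "- z"] by simp

lemma cinner_diff_left: "cinner (x - y) z = cinner x z - cinner y (z::'a::complex_hilbert)"
  using cinner_add_left[of x "- y" z] by simp

lemma cinner_sum_right: "cinner x (\<Sum>i\<in>I. f i) = (\<Sum>i\<in>I. cinner x (f i :: 'a::complex_hilbert))"
  by (induction I rule: infinite_finite_induct) (auto simp: cinner_add_right)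

lemma cinner_sum_left: "cinner (\<Sum>i\<in>I. f i) x = (\<Sum>i\<in>I. cinner (f i :: 'a::complex_hilbert) x)"
  by (induction I rule: infinite_finite_induct) (auto simp: cinner_add_left)

lemmas cinner_simps = cinner_add_right cinner_add_left cinner_diff_right cinner_diff_left
  cinner_scaleC_right cinner_scaleC_left

lemma rinner_commute: "rinner x y = rinner y (x::'a::complex_hilbert)"
  by (metis cinner_commute complex_cnj cnj.simps(1))

lemma rinner_self: "rinner x x = (norm (x::'a::complex_hilbert))\<^sup>2"
proof -
  have "Re (cinner x x) \<ge> 0"
    using norm_cinner[of x] norm_ge_zero[of x] by (metis real_sqrt_ge_0_iff)
  then show ?thesis by (simp add: norm_cinner)
qed

lemma cinner_self: "cinner x x = complex_of_real ((norm (x::'a::complex_hilbert))\<^sup>2)"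
proof -
  have "Im (cinner x x) = 0"
    using cinner_commute[of x x] by (metis cnj.simps(2) equal_neg_zero)
  then show ?thesis by (simp add: complex_eq_iff rinner_self)
qed

lemma norm_add_sq: "(norm (x + y))\<^sup>2 = (norm x)\<^sup>2 + (norm y)\<^sup>2 + 2 * rinner x (y::'a::complex_hilbert)"
  using rinner_self[of "x + y"] rinner_commute[of x y] by (simp add: cinner_simps rinner_self)

lemma norm_diff_sq: "(norm (x - y))\<^sup>2 = (norm x)\<^sup>2 + (norm y)\<^sup>2 - 2 * rinner x (y::'a::complex_hilbert)"
  using norm_add_sq[of x "- y"] by simp

lemma parallelogram:
  "(norm (x + y))\<^sup>2 + (norm (x - y))\<^sup>2 = 2 * (norm x)\<^sup>2 + 2 * (norm (y::'a::complex_hilbert))\<^sup>2"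
  by (simp add: norm_add_sq norm_diff_sq)

lemma rinner_le_norm: "rinner x y \<le> norm x * norm (y::'a::complex_hilbert)"
proof (cases "x = 0 \<or> y = 0")
  case False
  let ?u = "scaleR (1 / norm x) x" and ?v = "scaleR (1 / norm y) y"
  have "0 \<le> (norm (?u - ?v))\<^sup>2" by simp
  also have "\<dots> = 2 - 2 * (rinner x y / (norm x * norm y))"
    unfolding norm_diff_sq using False by simp
  finally have "rinner x y / (norm x * norm y) \<le> 1" by simp
  then show ?thesis using False by (simp add: divide_le_eq)
qed auto

lemma norm_scaleC: "norm (scaleC c x) = cmod c * norm (x::'a::complex_hilbert)"
proof -
  have "(norm (scaleC c x))\<^sup>2 = (cmod c * norm x)\<^sup>2"
    unfolding rinner_self[symmetric] cinner_scaleC_left cinner_scaleC_right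
    by (simp add: cinner_self power_mult_distrib cmod_power2) (simp add: algebra_simps power2_eq_square)
  then show ?thesis by (simp add: power2_eq_iff_nonneg)
qed

text \<open>Rotating one argument turns a modulus into a real part. This is how estimates for
  \<open>rinner\<close>, which is all that convexity arguments produce, become complex ones.\<close>

lemma phase_cinner:
  obtains c where "cmod c = 1" "cinner (scaleC c x) (y::'a::complex_hilbert) = cmod (cinner x y)"
proof (cases "cinner x y = 0")
  case False
  let ?c = "cinner x y / cmod (cinner x y)"
  have "cnj ?c * cinner x y = cmod (cinner x y)"
    using False complex_norm_square[of "cinner x y"]
    by (simp add: nonzero_divide_eq_eq power2_eq_square mult.commute)
  moreover have "cmod ?c = 1" using False by (simp add: norm_divide)
  ultimately show ?thesis using that[of ?c] by (simp only: cinner_scaleC_left)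
qed (use that[of 1] in \<open>simp add: scaleC_one\<close>)

lemma cmod_cinner_le: "cmod (cinner x y) \<le> norm x * norm (y::'a::complex_hilbert)"
proof -
  obtain c where c: "cmod c = 1" "cinner (scaleC c x) y = cmod (cinner x y)"
    using phase_cinner by blast
  then have "cmod (cinner x y) = rinner (scaleC c x) y" by simp
  also have "\<dots> \<le> norm x * norm y" using rinner_le_norm[of "scaleC c x" y] c by (simp add: norm_scaleC)
  finally show ?thesis .
qed

lemma abs_rinner_le: "\<bar>rinner x y\<bar> \<le> norm x * norm (y::'a::complex_hilbert)"
  using cmod_cinner_le[of x y] abs_Re_le_cmod[of "cinner x y"] by linarith

lemma bounded_bilinear_cinner: "bounded_bilinear (cinner :: 'a::complex_hilbert \<Rightarrow> 'a \<Rightarrow> complex)"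
proof
  show "\<exists>K. \<forall>a b::'a. norm (cinner a b) \<le> norm a * norm b * K"
    by (rule exI[of _ 1]) (simp add: cmod_cinner_le)
qed (auto simp: cinner_simps scaleR_conv_of_real)

lemmas tendsto_cinner [tendsto_intros] = bounded_bilinear.tendsto[OF bounded_bilinear_cinner]
lemmas continuous_on_cinner [continuous_intros] =
  bounded_bilinear.continuous_on[OF bounded_bilinear_cinner]

lemma bounded_linear_scaleC: "bounded_linear (scaleC c :: 'a::complex_hilbert \<Rightarrow> 'a)"
  by (rule bounded_linear_intro[of _ "cmod c"])
     (auto simp: scaleC_add_right scaleC_scaleR norm_scaleC mult.commute)

lemmas tendsto_scaleC [tendsto_intros] = bounded_linear.tendsto[OF bounded_linear_scaleC]

lemma cinner_eqI: "(\<And>z. cinner z x = cinner z y) \<Longrightarrow> x = (y::'a::complex_hilbert)"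
proof -
  assume "\<And>z. cinner z x = cinner z y"
  then have "cinner (x - y) (x - y) = 0" by (simp add: cinner_diff_right)
  then show ?thesis by (simp add: cinner_self)
qed

subsection \<open>Nearest points and orthogonal projections\<close>

lemma Cauchy_if_geometric_bound:
  fixes f :: "nat \<Rightarrow> 'a::real_normed_vector"
  assumes "\<And>m n. n \<le> m \<Longrightarrow> norm (f m - f n) \<le> e n" and "e \<longlonglongrightarrow> 0"
  shows "Cauchy f"
proof (rule CauchyI)
  fix d :: real assume "d > 0"
  then have "\<forall>\<^sub>F n in sequentially. e n < d / 2"
    using assms(2) by (intro order_tendstoD) auto
  then obtain N where N: "e N < d / 2" by (auto simp: eventually_sequentially)
  have "norm (f m - f n) < d" if "m \<ge> N" "n \<ge> N" for m n
    using norm_triangle_ineq4[of "f m - f N" "f n - f N"] assms(1)[OF that(1)] assms(1)[OF that(2)] N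
    by simp
  then show "\<exists>M. \<forall>m\<ge>M. \<forall>n\<ge>M. norm (f m - f n) < d" by blast
qed

text \<open>A minimising sequence is Cauchy: the midpoint of two near-minimisers stays in
  \<open>S\<close>, so the parallelogram law leaves little room for their difference.\<close>

lemma nearest_point_exists:
  fixes S :: "'a::complex_hilbert set"
  assumes S: "closed S" "convex S" "S \<noteq> {}"
  obtains k where "k \<in> S" "\<And>z. z \<in> S \<Longrightarrow> norm (x - k) \<le> norm (x - z)"
proof -
  define d where "d = Inf ((\<lambda>z. (norm (x - z))\<^sup>2) ` S)"
  have bdd: "bdd_below ((\<lambda>z. (norm (x - z))\<^sup>2) ` S)" by (rule bdd_belowI2[of _ 0]) simp
  have d_le: "d \<le> (norm (x - z))\<^sup>2" if "z \<in> S" for z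
    unfolding d_def using bdd that by (rule cINF_lower)
  have "\<exists>z\<in>S. (norm (x - z))\<^sup>2 < d + inverse (real (Suc n))" for n
  proof -
    have "d < d + inverse (real (Suc n))" by simp
    then show ?thesis unfolding d_def using S bdd by (subst (asm) cINF_less_iff) auto
  qed
  then obtain f where f: "\<And>n. f n \<in> S" "\<And>n. (norm (x - f n))\<^sup>2 < d + inverse (real (Suc n))"
    by metis
  have est: "norm (f m - f n) \<le> sqrt (4 * inverse (real (Suc n)))" if "n \<le> m" for m n
  proof -
    have "scaleR (1/2) (f m) + scaleR (1/2) (f n) \<in> S"
      using S(2) f(1) by (intro convexD) auto
    then have "d \<le> (norm (x - (scaleR (1/2) (f m) + scaleR (1/2) (f n))))\<^sup>2" by (rule d_le)
    also have "x - (scaleR (1/2) (f m) + scaleR (1/2) (f n)) = scaleR (1/2) ((x - f m) + (x - f n))"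
      by (simp add: algebra_simps flip: scaleR_add_left)
    finally have "4 * d \<le> (norm ((x - f m) + (x - f n)))\<^sup>2" by (simp add: power_divide)
    moreover have "(norm (f m - f n))\<^sup>2 = 2 * (norm (x - f m))\<^sup>2 + 2 * (norm (x - f n))\<^sup>2
        - (norm ((x - f m) + (x - f n)))\<^sup>2"
      using parallelogram[of "x - f m" "x - f n"] by (simp add: norm_minus_commute)
    moreover have "inverse (real (Suc m)) \<le> inverse (real (Suc n))" using that by simp
    ultimately have "(norm (f m - f n))\<^sup>2 \<le> 4 * inverse (real (Suc n))"
      using f(2)[of m] f(2)[of n] by linarith
    then show ?thesis by (rule real_le_rsqrt)
  qed
  have "(\<lambda>n. sqrt (4 * inverse (real (Suc n)))) \<longlonglongrightarrow> sqrt (4 * 0)"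
    by (intro tendsto_intros LIMSEQ_inverse_real_of_nat)
  then have "Cauchy f" by (intro Cauchy_if_geometric_bound[OF est]) auto
  then obtain k where k: "f \<longlonglongrightarrow> k" using Cauchy_convergent convergent_def by blast
  have kS: "k \<in> S" using closed_sequentially[OF S(1) _ k] f(1) by blast
  have "(\<lambda>n. (norm (x - f n))\<^sup>2) \<longlonglongrightarrow> (norm (x - k))\<^sup>2" by (intro tendsto_intros k)
  moreover have "(\<lambda>n. d + inverse (real (Suc n))) \<longlonglongrightarrow> d + 0"
    by (intro tendsto_intros LIMSEQ_inverse_real_of_nat)
  ultimately have "(norm (x - k))\<^sup>2 \<le> d + 0"
    by (rule LIMSEQ_le) (use f(2) less_imp_le in blast)
  then have "norm (x - k) \<le> norm (x - z)" if "z \<in> S" for z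
    using d_le[OF that] by (smt (verit) power2_le_imp_le norm_ge_zero)
  with kS show ?thesis using that by blast
qed

lemma nearest_point_rinner:
  fixes S :: "'a::complex_hilbert set"
  assumes "convex S" "k \<in> S" "\<And>z. z \<in> S \<Longrightarrow> norm (x - k) \<le> norm (x - z)" "z \<in> S"
  shows "rinner (x - k) (z - k) \<le> 0"
proof (rule ccontr)
  assume "\<not> ?thesis"
  then have pos: "rinner (x - k) (z - k) > 0" by simp
  define a where "a = rinner (x - k) (z - k)"
  define B where "B = (norm (z - k))\<^sup>2"
  have "B > 0" using pos unfolding B_def by (cases "z = k") auto
  \<comment> \<open>Step length along the segment from \<open>k\<close> to \<open>z\<close>. The
    squared distance changes by \<open>e * (e * B - 2 * a)\<close>, which is negative as soon as
    \<open>e * B \<le> a\<close>.\<close>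
  define e where "e = min 1 (a / B)"
  have e: "0 < e" "e \<le> 1" "e * B \<le> a"
    using pos \<open>B > 0\<close> by (auto simp: e_def a_def min_def field_simps)
  have "scaleR (1 - e) k + scaleR e z \<in> S" using assms e by (intro convexD) auto
  then have "norm (x - k) \<le> norm (x - (scaleR (1 - e) k + scaleR e z))" by (rule assms(3))
  also have "x - (scaleR (1 - e) k + scaleR e z) = (x - k) - scaleR e (z - k)"
    by (simp add: algebra_simps)
  finally have "(norm (x - k))\<^sup>2 \<le> (norm ((x - k) - scaleR e (z - k)))\<^sup>2"
    by (simp add: power_mono)
  also have "\<dots> = (norm (x - k))\<^sup>2 + e * (e * B - 2 * a)"
    unfolding norm_diff_sq[of "x - k"] cinner_scaleR_right norm_scaleR a_def B_def
    by (simp add: power_mult_distrib power2_eq_square algebra_simps del: scaleR_diff_right)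
  finally have "0 \<le> e * (e * B - 2 * a)" by simp
  then show False using e pos a_def by (smt (verit) mult_pos_neg)
qed

definition csubspace :: "'a::complex_hilbert set \<Rightarrow> bool" where
  "csubspace L \<longleftrightarrow> 0 \<in> L \<and> (\<forall>x\<in>L. \<forall>y\<in>L. x + y \<in> L) \<and> (\<forall>c. \<forall>x\<in>L. scaleC c x \<in> L)"

lemma csubspaceD:
  assumes "csubspace L"
  shows "0 \<in> L" "x \<in> L \<Longrightarrow> y \<in> L \<Longrightarrow> x + y \<in> L" "x \<in> L \<Longrightarrow> scaleC c x \<in> L"
    "x \<in> L \<Longrightarrow> scaleR r x \<in> L" "x \<in> L \<Longrightarrow> - x \<in> L" "x \<in> L \<Longrightarrow> y \<in> L \<Longrightarrow> x - y \<in> L"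
proof -
  show 1: "0 \<in> L" "x \<in> L \<Longrightarrow> y \<in> L \<Longrightarrow> x + y \<in> L" "x \<in> L \<Longrightarrow> scaleC c x \<in> L" for x y c
    using assms by (auto simp: csubspace_def)
  show "x \<in> L \<Longrightarrow> scaleR r x \<in> L" using 1 by (simp add: scaleR_scaleC)
  show 2: "x \<in> L \<Longrightarrow> - x \<in> L" for x using 1(3)[of x "-1"] by (simp add: scaleC_minus_one)
  show "x \<in> L \<Longrightarrow> y \<in> L \<Longrightarrow> x - y \<in> L" using 1(2)[of x "- y"] 2 by simp
qed

lemma csubspace_closure:
  assumes "csubspace L" shows "csubspace (closure L)"
  unfolding csubspace_def
proof (intro conjI ballI allI)
  show "0 \<in> closure L" using csubspaceD(1)[OF assms] closure_subset by blast
next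
  fix x y assume "x \<in> closure L" "y \<in> closure L"
  then obtain f g where "\<And>n. f n \<in> L" "f \<longlonglongrightarrow> x" "\<And>n. g n \<in> L" "g \<longlonglongrightarrow> y"
    by (auto simp: closure_sequential)
  then show "x + y \<in> closure L" unfolding closure_sequential
    by (intro exI[of _ "\<lambda>n. f n + g n"]) (auto intro!: tendsto_intros csubspaceD[OF assms])
next
  fix c x assume "x \<in> closure L"
  then obtain f where "\<And>n. f n \<in> L" "f \<longlonglongrightarrow> x" by (auto simp: closure_sequential)
  then show "scaleC c x \<in> closure L" unfolding closure_sequential
    by (intro exI[of _ "\<lambda>n. scaleC c (f n)"]) (auto intro!: tendsto_intros csubspaceD[OF assms])
qed

text \<open>In a complex subspace the variational inequality may be applied to every phase multiple
  of \<open>z\<close>, which upgrades a one-sided real bound to vanishing of the inner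
  product.\<close>

lemma orthogonal_decomposition:
  assumes "closed L" "csubspace (L::'a::complex_hilbert set)"
  shows "\<exists>u. u \<in> L \<and> (\<forall>z\<in>L. cinner z (x - u) = 0)"
proof -
  have cv: "convex L" unfolding convex_def using csubspaceD[OF assms(2)] by blast
  obtain u where u: "u \<in> L" "\<And>z. z \<in> L \<Longrightarrow> norm (x - u) \<le> norm (x - z)"
    using nearest_point_exists[OF assms(1) cv, of x] csubspaceD(1)[OF assms(2)] by blast
  have "cinner z (x - u) = 0" if z: "z \<in> L" for z
  proof -
    obtain c where c: "cmod c = 1" "cinner (scaleC c z) (x - u) = cmod (cinner z (x - u))"
      using phase_cinner by blast
    have "u + scaleC c z \<in> L" using u(1) z csubspaceD[OF assms(2)] by blast
    from nearest_point_rinner[OF cv u this] have "rinner (x - u) (scaleC c z) \<le> 0" by simp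
    then show ?thesis using c rinner_commute[of "x - u" "scaleC c z"] by simp
  qed
  with u show ?thesis by blast
qed

definition orth_proj :: "'a::complex_hilbert set \<Rightarrow> 'a \<Rightarrow> 'a" where
  "orth_proj L x = (SOME u. u \<in> L \<and> (\<forall>z\<in>L. cinner z (x - u) = 0))"

lemma orth_proj:
  assumes "closed L" "csubspace (L::'a::complex_hilbert set)"
  shows "orth_proj L x \<in> L" "z \<in> L \<Longrightarrow> cinner z (x - orth_proj L x) = 0"
  using someI_ex[OF orthogonal_decomposition[OF assms, of x]] unfolding orth_proj_def by auto

lemma orth_proj_eqI:
  assumes "closed L" "csubspace (L::'a::complex_hilbert set)"
    and "u \<in> L" "\<And>z. z \<in> L \<Longrightarrow> cinner z (x - u) = 0"
  shows "orth_proj L x = u"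
proof -
  let ?d = "u - orth_proj L x"
  have "?d \<in> L" by (intro csubspaceD(6)[OF assms(2)] assms(3) orth_proj(1)[OF assms(1,2)])
  then have "cinner ?d (x - orth_proj L x) - cinner ?d (x - u) = 0"
    using assms(4) orth_proj(2)[OF assms(1,2)] by simp
  then have "cinner ?d ?d = 0" by (simp add: cinner_diff_right)
  then show ?thesis by (simp add: cinner_self)
qed

subsection \<open>Bounded operators and adjoints\<close>

lemma bounded_clinearI:
  assumes "\<And>x y. A (x + y) = A x + A y" "\<And>c x. A (scaleC c x) = scaleC c (A x)"
    "\<And>x. norm (A x) \<le> K * norm x"
  shows "bounded_clinear A"
  unfolding bounded_clinear_def
proof (intro conjI allI assms)
  show "bounded_linear A" using assms
    by (intro bounded_linear_intro[of _ K]) (auto simp: scaleR_scaleC mult.commute)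
qed

lemma bounded_clinearD:
  assumes "bounded_clinear A"
  shows "bounded_linear A" "A (x + y) = A x + A y" "A (scaleC c x) = scaleC c (A x)"
    "A (scaleR r x) = scaleR r (A x)" "A 0 = 0" "A (x - y) = A x - A y" "A (- x) = - A x"
    "A (\<Sum>i\<in>I. f i) = (\<Sum>i\<in>I. A (f i))"
proof -
  show bl: "bounded_linear A" using assms by (simp add: bounded_clinear_def)
  interpret bounded_linear A by (rule bl)
  show "A (x + y) = A x + A y" "A (scaleC c x) = scaleC c (A x)"
    "A (scaleR r x) = scaleR r (A x)" "A 0 = 0" "A (x - y) = A x - A y" "A (- x) = - A x"
    "A (\<Sum>i\<in>I. f i) = (\<Sum>i\<in>I. A (f i))"
    using assms by (auto simp: add scale zero diff neg sum bounded_clinear_def)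
qed

lemma bounded_clinear_bound:
  assumes "bounded_clinear A"
  obtains K where "K \<ge> 0" "\<And>x. norm (A x) \<le> K * norm x"
  using bounded_linear.nonneg_bounded[OF bounded_clinearD(1)[OF assms]] that by (metis mult.commute)

lemmas bounded_clinear_tendsto = bounded_linear.tendsto[OF bounded_clinearD(1)]

lemma bounded_clinear_id: "bounded_clinear id"
  by (rule bounded_clinearI[of _ 1]) auto

lemma bounded_clinear_zero: "bounded_clinear (\<lambda>x. 0)"
  by (rule bounded_clinearI[of _ 0]) auto

lemma bounded_clinear_compose:
  assumes "bounded_clinear A" "bounded_clinear B" shows "bounded_clinear (A \<circ> B)"
proof -
  obtain K where K: "K \<ge> 0" "\<And>x. norm (A x) \<le> K * norm x" using bounded_clinear_bound[OF assms(1)] by blast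
  obtain L where L: "L \<ge> 0" "\<And>x. norm (B x) \<le> L * norm x" using bounded_clinear_bound[OF assms(2)] by blast
  have "norm (A (B x)) \<le> K * L * norm x" for x
    using order_trans[OF K(2)[of "B x"] mult_left_mono[OF L(2) K(1)]] by (simp add: mult.assoc)
  then show ?thesis
    by (intro bounded_clinearI[of _ "K * L"])
       (auto simp: bounded_clinearD(2,3)[OF assms(1)] bounded_clinearD(2,3)[OF assms(2)])
qed

lemma bounded_clinear_add:
  assumes "bounded_clinear A" "bounded_clinear B" shows "bounded_clinear (\<lambda>x. A x + B x)"
  using assms bounded_linear_add unfolding bounded_clinear_def by (auto simp: scaleC_add_right)

lemma bounded_clinear_scaleC:
  assumes "bounded_clinear A" shows "bounded_clinear (\<lambda>x. scaleC c (A x))"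
  using assms bounded_linear_compose[OF bounded_linear_scaleC]
  unfolding bounded_clinear_def by (auto simp: scaleC_scaleC mult.commute)

lemma bounded_clinear_eqI_dense:
  assumes "bounded_clinear A" "bounded_clinear B" "closure D = UNIV" "\<And>x. x \<in> D \<Longrightarrow> A x = B x"
  shows "A x = B x"
proof -
  obtain f where f: "\<And>n. f n \<in> D" "f \<longlonglongrightarrow> x"
    using assms(3) closure_sequential[of x D] by auto
  have "(\<lambda>n. A (f n)) \<longlonglongrightarrow> A x" "(\<lambda>n. B (f n)) \<longlonglongrightarrow> B x"
    using f(2) bounded_clinear_tendsto assms(1,2) by blast+
  moreover have "(\<lambda>n. A (f n)) = (\<lambda>n. B (f n))" using f(1) assms(4) by simp
  ultimately show ?thesis using LIMSEQ_unique by metis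
qed

lemma riesz_representation:
  fixes f :: "'a::complex_hilbert \<Rightarrow> complex"
  assumes "bounded_linear f" "\<And>c x. f (scaleC c x) = c * f x"
  shows "\<exists>y. \<forall>x. f x = cinner y x"
proof (cases "\<forall>x. f x = 0")
  case True then show ?thesis by (intro exI[of _ 0]) simp
next
  case False
  then obtain v where v: "f v \<noteq> 0" by blast
  interpret bounded_linear f by fact
  let ?L = "{x. f x = 0}"
  have L: "closed ?L" "csubspace ?L"
    using assms(2) by (auto simp: csubspace_def add zero intro!: closed_Collect_eq continuous_on continuous_on_id)
  obtain u where u: "u \<in> ?L" "\<And>z. z \<in> ?L \<Longrightarrow> cinner z (v - u) = 0"
    using orthogonal_decomposition[OF L, of v] by blast
  let ?w = "v - u"
  have fw: "f ?w = f v" using u(1) by (simp add: diff)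
  then have w0: "cinner ?w ?w \<noteq> 0" using v zero by (auto simp: cinner_self)
  have "f x = cinner (scaleC (cnj (f v / cinner ?w ?w)) ?w) x" for x
  proof -
    have "x - scaleC (f x / f v) ?w \<in> ?L" using fw v assms(2) by (simp add: diff)
    then have "cinner (x - scaleC (f x / f v) ?w) ?w = 0" by (rule u(2))
    then have "cinner ?w (x - scaleC (f x / f v) ?w) = 0"
      using cinner_commute by (metis complex_cnj_zero)
    then have "cinner ?w x = f x / f v * cinner ?w ?w"
      by (simp only: cinner_diff_right[of ?w x] cinner_scaleC_right right_minus_eq)
    then show ?thesis using w0 v by (simp only: cinner_scaleC_left complex_cnj_cnj) (simp add: field_simps)
  qed
  then show ?thesis by blast
qed

lemma adjoint_eqI:
  assumes "\<And>x y. cinner (A x) y = cinner x (B y)" shows "adjoint A = B"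
  unfolding adjoint_def
proof (rule the_equality)
  show "\<forall>x y. cinner (A x) y = cinner x (B y)" using assms by blast
  fix C assume "\<forall>x y. cinner (A x) y = cinner x (C y)"
  then show "C = B" using assms by (intro ext cinner_eqI) metis
qed

lemma cinner_adjoint:
  assumes A: "bounded_clinear A"
  shows "cinner (A x) y = cinner x (adjoint A y)"
proof -
  interpret bounded_linear A using A by (rule bounded_clinearD)
  have "\<exists>w. \<forall>x. cinner y (A x) = cinner w x" for y
  proof (rule riesz_representation)
    show "bounded_linear (\<lambda>x. cinner y (A x))"
      by (rule bounded_linear_compose[OF bounded_bilinear.bounded_linear_right[OF bounded_bilinear_cinner]
            bounded_clinearD(1)[OF A]])
  qed (simp add: bounded_clinearD(3)[OF A] cinner_scaleC_right)
  then obtain B where B: "\<And>x y. cinner y (A x) = cinner (B y) x" by metis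
  have B': "cinner (A x) y = cinner x (B y)" for x y
    using B[of y x] cinner_commute by metis
  show ?thesis using adjoint_eqI[OF B'] B' by simp
qed

lemma cinner_adjoint_left:
  assumes "bounded_clinear A" shows "cinner (adjoint A x) y = cinner x (A y)"
  using cinner_adjoint[OF assms] cinner_commute by metis

lemma adjoint_norm_le:
  assumes "bounded_clinear A" "\<And>x. norm (A x) \<le> K * norm x" "K \<ge> 0"
  shows "norm (adjoint A y) \<le> K * norm y"
proof -
  have "(norm (adjoint A y))\<^sup>2 = rinner (A (adjoint A y)) y"
    by (simp add: cinner_adjoint[OF assms(1)] rinner_self)
  also have "\<dots> \<le> norm (A (adjoint A y)) * norm y" by (rule rinner_le_norm)
  also have "\<dots> \<le> K * norm (adjoint A y) * norm y" by (intro mult_right_mono assms) simp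
  finally have "norm (adjoint A y) * norm (adjoint A y) \<le> norm (adjoint A y) * (K * norm y)"
    by (simp add: power2_eq_square algebra_simps)
  then show ?thesis using assms(3) by (cases "adjoint A y = 0") auto
qed

lemma bounded_clinear_adjoint:
  assumes A: "bounded_clinear A" shows "bounded_clinear (adjoint A)"
proof -
  obtain K where K: "K \<ge> 0" "\<And>x. norm (A x) \<le> K * norm x" using bounded_clinear_bound[OF A] by blast
  show ?thesis
  proof (rule bounded_clinearI)
    show "norm (adjoint A x) \<le> K * norm x" for x using adjoint_norm_le[OF A K(2,1)] .
  qed (rule cinner_eqI, simp add: cinner_add_right cinner_scaleC_right flip: cinner_adjoint[OF A])+
qed

lemma selfadjointD:
  assumes "selfadjoint A"
  shows "bounded_clinear A" "cinner (A x) y = cinner x (A y)" "adjoint A = A"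
  using assms adjoint_eqI[of A A] by (auto simp: selfadjoint_def)

subsection \<open>Positive operators\<close>

lemma positive_opI:
  assumes "selfadjoint A" "\<And>x. 0 \<le> rinner x (A x)" shows "positive_op A"
  using assms by (simp add: positive_op_def op_le_def selfadjoint_def bounded_clinear_zero)

lemma positive_opD:
  assumes "positive_op A" shows "selfadjoint A" "0 \<le> rinner x (A x)"
  using assms by (auto simp: positive_op_def op_le_def)

lemma op_leD:
  assumes "op_le A B" shows "selfadjoint A" "selfadjoint B" "rinner x (A x) \<le> rinner x (B x)"
  using assms by (auto simp: op_le_def)

lemma selfadjoint_diff:
  assumes "selfadjoint A" "selfadjoint B" shows "selfadjoint (\<lambda>x. A x - B x)"
proof -
  have "bounded_clinear (\<lambda>x. A x - B x)"
    using assms bounded_linear_sub unfolding selfadjoint_def bounded_clinear_def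
    by (auto simp: scaleC_diff_right)
  then show ?thesis using assms by (simp add: selfadjoint_def cinner_diff_left cinner_diff_right)
qed

lemma selfadjoint_id: "selfadjoint id"
  by (simp add: selfadjoint_def bounded_clinear_id)

lemma positive_op_diff: "op_le A B \<Longrightarrow> positive_op (\<lambda>x. B x - A x)"
  using selfadjoint_diff[of B A] by (intro positive_opI) (auto simp: op_le_def cinner_diff_right)

text \<open>The quadratic form inequality behind \<open>A^2 \<le> c A\<close>. The form of
  \<open>A\<close> is evaluated at \<open>x - (1/c) A x\<close>, where the remaining terms collapse
  to \<open>rinner x (A x) - (norm (A x))^2 / c\<close>.\<close>

lemma positive_norm_sq_le:
  assumes A: "positive_op A" and c: "c \<ge> 0" "\<And>x. norm (A x) \<le> c * norm x"
  shows "(norm (A x))\<^sup>2 \<le> c * rinner x (A x)"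
proof (cases "c = 0")
  case True then show ?thesis using c(2)[of x] by simp
next
  case False
  note sa = positive_opD(1)[OF A]
  note lin = bounded_clinearD[OF selfadjointD(1)[OF sa]]
  let ?y = "A x" and ?s = "1 / c"
  have "0 \<le> rinner (x - scaleR ?s ?y) (A (x - scaleR ?s ?y))" by (rule positive_opD[OF A])
  also have "\<dots> = rinner x ?y - 2 * ?s * (norm ?y)\<^sup>2 + ?s\<^sup>2 * rinner ?y (A ?y)"
    using selfadjointD(2)[OF sa, of x ?y] rinner_self[of ?y]
    by (simp add: lin cinner_simps power2_eq_square algebra_simps)
  also have "rinner ?y (A ?y) \<le> c * (norm ?y)\<^sup>2"
    using order_trans[OF rinner_le_norm[of ?y "A ?y"] mult_left_mono[OF c(2) norm_ge_zero]]
    by (simp add: power2_eq_square algebra_simps)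
  then have "rinner x ?y - 2 * ?s * (norm ?y)\<^sup>2 + ?s\<^sup>2 * rinner ?y (A ?y)
     \<le> rinner x ?y - 2 * ?s * (norm ?y)\<^sup>2 + ?s\<^sup>2 * (c * (norm ?y)\<^sup>2)"
    by (intro add_left_mono mult_left_mono) auto
  also have "\<dots> = rinner x ?y - (norm ?y)\<^sup>2 / c" using False by (simp add: power2_eq_square field_simps)
  finally show ?thesis using False c(1) by (simp add: field_simps)
qed

lemma positive_rinner_zero:
  assumes A: "positive_op A" and "rinner x (A x) = 0" shows "A x = 0"
proof -
  obtain K where "K \<ge> 0" "\<And>x. norm (A x) \<le> K * norm x"
    using bounded_clinear_bound selfadjointD(1) positive_opD(1)[OF A] by blast
  from positive_norm_sq_le[OF A this, of x] show ?thesis using assms(2) by simp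
qed

lemma op_le_antisym: "op_le A B \<Longrightarrow> op_le B A \<Longrightarrow> A = B"
proof
  fix x assume AB: "op_le A B" "op_le B A"
  then have "rinner x (B x - A x) = 0"
    using op_leD(3)[of A B x] op_leD(3)[of B A x] by (simp add: cinner_diff_right)
  with positive_rinner_zero[OF positive_op_diff[OF AB(1)], of x] show "A x = B x" by simp
qed

lemma op_lub_eqI: "is_op_lub D s \<Longrightarrow> op_lub D = s"
  unfolding op_lub_def by (rule the_equality) (auto simp: is_op_lub_def intro: op_le_antisym)

lemma positive_compression:
  assumes "bounded_clinear A"
  shows "positive_op (adjoint A \<circ> A)"
proof (rule positive_opI)
  show "selfadjoint (adjoint A \<circ> A)"
    using assms by (simp add: selfadjoint_def bounded_clinear_compose bounded_clinear_adjoint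
        cinner_adjoint[symmetric] cinner_adjoint_left)
  show "0 \<le> rinner x ((adjoint A \<circ> A) x)" for x
    by (simp add: cinner_adjoint[OF assms, symmetric] rinner_self)
qed

lemma rinner_adjoint_self: "bounded_clinear A \<Longrightarrow> rinner x ((adjoint A \<circ> A) x) = (norm (A x))\<^sup>2"
  by (simp add: cinner_adjoint[symmetric] rinner_self)

subsection \<open>Resolvents of positive operators\<close>

text \<open>This is the inverse of \<open>1 + h\<close>. Together with its complement in the
  identity it takes the place of functional calculus: it is bounded, reverses the order, and stays
  in the von Neumann algebra.\<close>

definition resolvent :: "('a::complex_hilbert \<Rightarrow> 'a) \<Rightarrow> 'a \<Rightarrow> 'a" where
  "resolvent h x = (THE y. y + h y = x)"

lemma norm_le_id_plus:
  assumes h: "positive_op h" shows "norm x \<le> norm (x + h x)"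
proof -
  have "(norm x)\<^sup>2 \<le> rinner x (x + h x)"
    using positive_opD(2)[OF h, of x] by (simp add: cinner_add_right rinner_self)
  also have "\<dots> \<le> norm x * norm (x + h x)" by (rule rinner_le_norm)
  finally show ?thesis by (cases "x = 0") (auto simp: power2_eq_square)
qed

text \<open>Positivity bounds \<open>1 + h\<close> from below, so its range is closed. A vector
  orthogonal to the range vanishes, as seen by pairing it with its own image.\<close>

lemma id_plus_bij:
  assumes h: "positive_op h" shows "\<exists>!y. y + h y = x"
proof -
  note sa = positive_opD(1)[OF h]
  note lin = bounded_clinearD[OF selfadjointD(1)[OF sa]]
  let ?S = "\<lambda>x. x + h x"
  have low: "norm (x - y) \<le> norm (?S x - ?S y)" for x y
    using norm_le_id_plus[OF h, of "x - y"] by (simp add: lin algebra_simps)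
  have sub: "csubspace (range ?S)"
    unfolding csubspace_def
  proof (intro conjI ballI allI)
    show "0 \<in> range ?S" by (rule range_eqI[of _ _ 0]) (simp add: lin)
    show "a + b \<in> range ?S" if ab: "a \<in> range ?S" "b \<in> range ?S" for a b
    proof -
      obtain x y where "a = ?S x" "b = ?S y" using ab by blast
      then show ?thesis by (intro range_eqI[of _ _ "x + y"]) (simp add: lin)
    qed
    show "scaleC c a \<in> range ?S" if ab: "a \<in> range ?S" for a c
    proof -
      obtain x where "a = ?S x" using ab by blast
      then show ?thesis by (intro range_eqI[of _ _ "scaleC c x"]) (simp add: lin scaleC_add_right)
    qed
  qed
  have cl: "closed (range ?S)"
    unfolding closed_sequential_limits
  proof (intro allI impI)
    fix f l assume fl: "(\<forall>n. f n \<in> range ?S) \<and> f \<longlonglongrightarrow> l"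
    then have "\<forall>n. \<exists>z. f n = ?S z" by blast
    then obtain g where g: "\<And>n. f n = ?S (g n)" by metis
    have "Cauchy f" using fl LIMSEQ_imp_Cauchy by blast
    then have "Cauchy g"
      unfolding Cauchy_iff using low g by (metis order_le_less_trans)
    then obtain z where z: "g \<longlonglongrightarrow> z" using Cauchy_convergent convergent_def by blast
    have "(\<lambda>n. ?S (g n)) \<longlonglongrightarrow> ?S z"
      by (intro tendsto_intros z bounded_clinear_tendsto[OF selfadjointD(1)[OF sa]])
    then have "f \<longlonglongrightarrow> ?S z" by (simp flip: g)
    then have "l = ?S z" using fl LIMSEQ_unique by blast
    then show "l \<in> range ?S" by blast
  qed
  obtain u where u: "u \<in> range ?S" "\<And>z. z \<in> range ?S \<Longrightarrow> cinner z (x - u) = 0"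
    using orthogonal_decomposition[OF cl sub, of x] by blast
  have "cinner (?S (x - u)) (x - u) = 0" by (rule u(2)) blast
  then have "rinner (x - u) (x - u) + rinner (x - u) (h (x - u)) = 0"
    by (simp only: cinner_add_left selfadjointD(2)[OF sa] plus_complex.sel zero_complex.sel)
       (metis plus_complex.sel(1) zero_complex.sel(1))
  then have "(norm (x - u))\<^sup>2 \<le> 0"
    using positive_opD(2)[OF h, of "x - u"] by (simp only: rinner_self)
  then have "x \<in> range ?S" using u(1) by simp
  then obtain y where y: "y + h y = x" by auto
  show ?thesis
  proof (rule ex1I[of _ y])
    fix y' assume "y' + h y' = x"
    then show "y' = y" using low[of y' y] y by simp
  qed (rule y)
qed

lemma resolvent:
  assumes "positive_op h"
  shows resolvent_right: "resolvent h x + h (resolvent h x) = x"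
    and resolvent_eqI: "y + h y = x \<Longrightarrow> resolvent h x = y"
  unfolding resolvent_def
  using theI'[OF id_plus_bij[OF assms, of x]] the1_equality[OF id_plus_bij[OF assms, of x]] by blast+

lemma norm_resolvent_le:
  assumes "positive_op h" shows "norm (resolvent h x) \<le> norm x"
  using norm_le_id_plus[OF assms, of "resolvent h x"] resolvent_right[OF assms, of x] by simp

lemma resolvent_positive:
  assumes h: "positive_op h" shows "positive_op (resolvent h)"
proof -
  note sa = positive_opD(1)[OF h]
  note lin = bounded_clinearD[OF selfadjointD(1)[OF sa]]
  note res = resolvent_right[OF h]
  have "bounded_clinear (resolvent h)"
  proof (rule bounded_clinearI[of _ 1])
    fix x y c
    have "(resolvent h x + resolvent h y) + h (resolvent h x + resolvent h y) =
      (resolvent h x + h (resolvent h x)) + (resolvent h y + h (resolvent h y))"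
      by (simp add: lin algebra_simps)
    then show "resolvent h (x + y) = resolvent h x + resolvent h y"
      by (intro resolvent_eqI[OF h]) (simp add: res)
    have "scaleC c (resolvent h x) + h (scaleC c (resolvent h x)) =
       scaleC c (resolvent h x + h (resolvent h x))"
      by (simp add: lin scaleC_add_right)
    then show "resolvent h (scaleC c x) = scaleC c (resolvent h x)"
      by (intro resolvent_eqI[OF h]) (simp add: res)
  qed (use norm_resolvent_le[OF h] in simp)
  moreover have "cinner (resolvent h x) y = cinner x (resolvent h y)" for x y
  proof -
    let ?u = "resolvent h x" and ?v = "resolvent h y"
    have "cinner ?u y = cinner ?u (?v + h ?v)" by (simp add: res)
    also have "\<dots> = cinner (?u + h ?u) ?v"
      by (simp only: cinner_add_left cinner_add_right selfadjointD(2)[OF sa])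
    finally show ?thesis by (simp add: res)
  qed
  ultimately have "selfadjoint (resolvent h)" by (simp add: selfadjoint_def)
  moreover have "0 \<le> rinner x (resolvent h x)" for x
  proof -
    let ?u = "resolvent h x"
    have "rinner x ?u = rinner (?u + h ?u) ?u" by (simp add: res)
    also have "\<dots> = (norm ?u)\<^sup>2 + rinner ?u (h ?u)"
      by (simp add: cinner_add_left selfadjointD(2)[OF sa] rinner_self)
    finally show ?thesis using positive_opD(2)[OF h, of ?u] by simp
  qed
  ultimately show ?thesis by (rule positive_opI)
qed

text \<open>The left side is a concave quadratic in \<open>y\<close> with maximum at
  \<open>resolvent h x\<close>; the gap is the form of \<open>1 + h\<close> at
  \<open>y - resolvent h x\<close>. Writing the resolvent as a maximum makes its antitonicity
  immediate, since \<open>h\<close> enters with a minus sign.\<close>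

lemma resolvent_variational:
  assumes h: "positive_op h"
  shows "2 * rinner x y - rinner y (y + h y) \<le> rinner x (resolvent h x)"
proof -
  note sa = positive_opD(1)[OF h]
  note lin = bounded_clinearD[OF selfadjointD(1)[OF sa]]
  let ?z = "resolvent h x"
  have "0 \<le> rinner (y - ?z) ((y - ?z) + h (y - ?z))"
    using positive_opD(2)[OF h, of "y - ?z"] by (simp only: cinner_add_right plus_complex.sel) (simp add: rinner_self)
  also have "(y - ?z) + h (y - ?z) = (y + h y) - (?z + h ?z)" by (simp add: lin algebra_simps)
  also have "\<dots> = (y + h y) - x" by (simp only: resolvent_right[OF h])
  also have "rinner (y - ?z) ((y + h y) - x) = rinner y (y + h y) - rinner y x - rinner (?z + h ?z) y + rinner ?z x"
    by (simp add: cinner_simps selfadjointD(2)[OF sa])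
  also have "?z + h ?z = x" by (rule resolvent_right[OF h])
  finally show ?thesis using rinner_commute[of x y] rinner_commute[of x ?z] by simp
qed

lemma resolvent_antimono:
  assumes "positive_op s" "positive_op t" "op_le s t"
  shows "op_le (resolvent t) (resolvent s)"
  unfolding op_le_def
proof (intro conjI allI)
  fix x
  let ?z = "resolvent t x"
  have "rinner x ?z = 2 * rinner x ?z - rinner ?z (?z + t ?z)"
    by (simp add: resolvent_right[OF assms(2)] rinner_commute)
  also have "\<dots> \<le> 2 * rinner x ?z - rinner ?z (?z + s ?z)"
    using op_leD(3)[OF assms(3), of ?z] by (simp add: cinner_add_right)
  also have "\<dots> \<le> rinner x (resolvent s x)" by (rule resolvent_variational[OF assms(1)])
  finally show "rinner x (resolvent t x) \<le> rinner x (resolvent s x)" .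
qed (use assms resolvent_positive positive_opD(1) in blast)+

lemma resolvent_lower:
  assumes "positive_op h"
  shows "(norm x)\<^sup>2 - rinner x (h x) \<le> rinner x (resolvent h x)"
  using resolvent_variational[OF assms, of x x] by (simp add: cinner_add_right rinner_self)

lemma resolvent_le_id:
  assumes "positive_op h" shows "op_le (resolvent h) id"
proof -
  have "rinner x (resolvent h x) \<le> (norm x)\<^sup>2" for x
    using rinner_le_norm[of x "resolvent h x"] mult_left_mono[OF norm_resolvent_le[OF assms, of x], of "norm x"]
    by (simp add: power2_eq_square)
  then show ?thesis
    using positive_opD(1)[OF resolvent_positive[OF assms]] by (simp add: op_le_def selfadjoint_id rinner_self)
qed

text \<open>Operator version of \<open>t \<le> (1 + B) * (t / (1 + t))\<close> for
  \<open>0 \<le> t \<le> B\<close>. It recovers an operator from its bounded substitute up to a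
  constant.\<close>

lemma resolvent_complement_lower:
  assumes a: "positive_op a" and B: "B \<ge> 0" "\<And>x. norm (a x) \<le> B * norm x"
  shows "rinner x (a x) \<le> (1 + B) * rinner x (x - resolvent a x)"
proof -
  note sa = positive_opD(1)[OF a]
  note lin = bounded_clinearD[OF selfadjointD(1)[OF sa]]
  let ?y = "resolvent a x"
  have x: "x = ?y + a ?y" by (rule resolvent_right[OF a, symmetric])
  have d: "x - ?y = a ?y" using x by (metis add_diff_cancel_left')
  have 1: "rinner x (a x) = rinner ?y (a ?y) + 2 * (norm (a ?y))\<^sup>2 + rinner (a ?y) (a (a ?y))"
    using selfadjointD(2)[OF sa, of ?y "a ?y"]
    by (subst (1 2) x) (simp add: lin cinner_simps rinner_self[symmetric])
  have 2: "rinner x (x - ?y) = rinner ?y (a ?y) + (norm (a ?y))\<^sup>2"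
    unfolding d by (subst x) (simp add: cinner_simps rinner_self)
  have 3: "rinner (a ?y) (a (a ?y)) \<le> B * (norm (a ?y))\<^sup>2"
    using order_trans[OF rinner_le_norm[of "a ?y" "a (a ?y)"] mult_left_mono[OF B(2) norm_ge_zero]]
    by (simp add: power2_eq_square algebra_simps)
  have 4: "(norm (a ?y))\<^sup>2 \<le> B * rinner ?y (a ?y)" by (rule positive_norm_sq_le[OF a B])
  show ?thesis using 3 4 unfolding 1 2 by (simp add: algebra_simps)
qed

subsection \<open>Suprema of bounded directed sets of operators\<close>

lemma op_le_trans: "op_le A B \<Longrightarrow> op_le B C \<Longrightarrow> op_le A C"
  unfolding op_le_def using order_trans by blast

lemma op_le_refl: "selfadjoint A \<Longrightarrow> op_le A A"
  by (simp add: op_le_def)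

text \<open>These are the families for which \<open>normal_map\<close> makes an assertion. The sign
  of \<open>C\<close> is left open, hence the absolute values below.\<close>

locale directed_operators =
  fixes D :: "('a::complex_hilbert \<Rightarrow> 'a) set" and C :: real
  assumes nonempty: "D \<noteq> {}"
    and pos: "a \<in> D \<Longrightarrow> positive_op a"
    and directed: "a \<in> D \<Longrightarrow> b \<in> D \<Longrightarrow> \<exists>c\<in>D. op_le a c \<and> op_le b c"
    and bound: "a \<in> D \<Longrightarrow> norm (a x) \<le> C * norm x"
begin

text \<open>The order filter of the net \<open>D\<close>: limits along it are limits of the
  increasing net, without choosing an index set.\<close>

definition upwards :: "('a \<Rightarrow> 'a) filter" where
  "upwards = (INF a\<in>D. principal {b\<in>D. op_le a b})"

lemma eventually_upwards:
  "eventually P upwards \<longleftrightarrow> (\<exists>a\<in>D. \<forall>b\<in>D. op_le a b \<longrightarrow> P b)"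
  unfolding upwards_def
proof (subst eventually_INF_base)
  fix a b assume "a \<in> D" "b \<in> D"
  then obtain c where "c \<in> D" "op_le a c" "op_le b c" using directed by blast
  then show "\<exists>x\<in>D. principal {b \<in> D. op_le x b}
       \<le> inf (principal {b \<in> D. op_le a b}) (principal {c \<in> D. op_le b c})"
    by (intro bexI[of _ c]) (auto intro: op_le_trans)
qed (use nonempty in \<open>auto simp: eventually_principal\<close>)

lemma upwards_not_bot: "upwards \<noteq> bot"
  unfolding trivial_limit_def eventually_upwards
  using op_le_refl pos positive_opD(1) by blast

lemma eventually_in: "eventually (\<lambda>b. b \<in> D) upwards"
  unfolding eventually_upwards using nonempty by blast

lemma eventually_above: "a \<in> D \<Longrightarrow> eventually (\<lambda>b. op_le a b) upwards"
  unfolding eventually_upwards by blast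

text \<open>For positive increments the norm is controlled by the quadratic form, so convergence of
  the forms already implies strong convergence of the net.\<close>

lemma increment_norm:
  assumes "a \<in> D" "b \<in> D" "op_le a b"
  shows "(norm (b x - a x))\<^sup>2 \<le> 2 * \<bar>C\<bar> * (rinner x (b x) - rinner x (a x))"
proof -
  have "norm (b x - a x) \<le> 2 * \<bar>C\<bar> * norm x" for x
    using norm_triangle_ineq4[of "b x" "a x"] bound[OF assms(1), of x] bound[OF assms(2), of x]
      mult_right_mono[OF abs_ge_self[of C] norm_ge_zero[of x]]
    by linarith
  from positive_norm_sq_le[OF positive_op_diff[OF assms(3)] _ this, of x] show ?thesis
    by (simp add: cinner_diff_right)
qed

lemma limit_exists: "\<exists>v. ((\<lambda>b. b x) \<longlongrightarrow> v) upwards"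
proof -
  define q where "q = (SUP a\<in>D. rinner x (a x))"
  have bdd: "bdd_above ((\<lambda>a. rinner x (a x)) ` D)"
  proof (rule bdd_aboveI2)
    fix a assume "a \<in> D"
    then show "rinner x (a x) \<le> norm x * (C * norm x)"
      using order_trans[OF rinner_le_norm[of x "a x"] mult_left_mono[OF bound[of a x] norm_ge_zero[of x]]] by blast
  qed
  have le_q: "rinner x (a x) \<le> q" if "a \<in> D" for a
    unfolding q_def using that bdd by (rule cSUP_upper)
  have "\<exists>a\<in>D. q - inverse (real (Suc n)) < rinner x (a x)" for n
  proof -
    have "q - inverse (real (Suc n)) < q" by simp
    then show ?thesis unfolding q_def using nonempty bdd by (subst (asm) less_cSUP_iff) auto
  qed
  then obtain f where f: "\<And>n. f n \<in> D" "\<And>n. q - inverse (real (Suc n)) < rinner x (f n x)"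
    by metis
  define e where "e n = sqrt (2 * \<bar>C\<bar> * inverse (real (Suc n)))" for n
  have near: "norm (b x - f n x) \<le> e n" if "b \<in> D" "op_le (f n) b" for b n
  proof -
    have "(norm (b x - f n x))\<^sup>2 \<le> 2 * \<bar>C\<bar> * (rinner x (b x) - rinner x (f n x))"
      by (rule increment_norm[OF f(1) that])
    also have "\<dots> \<le> 2 * \<bar>C\<bar> * inverse (real (Suc n))"
      using le_q[OF that(1)] f(2)[of n] by (intro mult_left_mono) auto
    finally show ?thesis unfolding e_def by (rule real_le_rsqrt)
  qed
  have e_mono: "e m \<le> e n" if "n \<le> m" for m n
    unfolding e_def using that by (intro real_sqrt_le_mono mult_left_mono) auto
  have "(\<lambda>n. sqrt (2 * \<bar>C\<bar> * inverse (real (Suc n)))) \<longlonglongrightarrow> sqrt (2 * \<bar>C\<bar> * 0)"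
    by (intro tendsto_intros LIMSEQ_inverse_real_of_nat)
  then have e0: "e \<longlonglongrightarrow> 0" by (simp add: e_def[abs_def])
  have "norm (f m x - f n x) \<le> 2 * e n" if "n \<le> m" for m n
  proof -
    \<comment> \<open>The selected sequence \<open>f\<close> need not be increasing, so two of its
      members are compared through a common upper bound in \<open>D\<close>.\<close>
    obtain c where c: "c \<in> D" "op_le (f m) c" "op_le (f n) c" using directed f(1) by blast
    show ?thesis
      using norm_triangle_ineq4[of "c x - f n x" "c x - f m x"] near[OF c(1,2)] near[OF c(1,3)]
        e_mono[OF that] by simp
  qed
  moreover have "(\<lambda>n. 2 * e n) \<longlonglongrightarrow> 0" using tendsto_mult_right_zero[OF e0] by simp
  ultimately have "Cauchy (\<lambda>n. f n x)" by (rule Cauchy_if_geometric_bound)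
  then obtain v where v: "(\<lambda>n. f n x) \<longlonglongrightarrow> v" using Cauchy_convergent convergent_def by blast
  have "((\<lambda>b. b x) \<longlongrightarrow> v) upwards"
  proof (rule tendstoI)
    fix d :: real assume "d > 0"
    have "\<forall>\<^sub>F n in sequentially. e n < d / 2 \<and> dist (f n x) v < d / 2"
      using order_tendstoD(2)[OF e0, of "d / 2"] tendstoD[OF v, of "d / 2"] \<open>d > 0\<close>
      by (intro eventually_conj) auto
    then obtain n where n: "e n < d / 2" "dist (f n x) v < d / 2"
      by (auto simp: eventually_sequentially)
    have "dist (b x) v < d" if "b \<in> D" "op_le (f n) b" for b
      using near[OF that] n dist_triangle[of "b x" v "f n x"] by (simp add: dist_norm)
    then show "\<forall>\<^sub>F b in upwards. dist (b x) v < d" unfolding eventually_upwards using f(1) by blast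
  qed
  then show ?thesis by blast
qed

lemma directed_lub:
  shows op_lub_tendsto: "((\<lambda>b. b x) \<longlongrightarrow> op_lub D x) upwards"
    and is_op_lub_op_lub: "is_op_lub D (op_lub D)"
    and positive_op_lub: "positive_op (op_lub D)"
proof -
  from limit_exists obtain s where s: "\<And>x. ((\<lambda>b. b x) \<longlongrightarrow> s x) upwards" by metis
  note uniq = tendsto_unique[OF upwards_not_bot]
  note lin = bounded_clinearD[OF selfadjointD(1)[OF positive_opD(1)[OF pos]]]
  have "bounded_clinear s"
  proof (rule bounded_clinearI[of _ C])
    fix x y c
    have "((\<lambda>b. b x + b y) \<longlongrightarrow> s (x + y)) upwards"
      by (rule Lim_transform_eventually[OF s[of "x + y"]])
         (rule eventually_mono[OF eventually_in], simp add: lin)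
    moreover have "((\<lambda>b. b x + b y) \<longlongrightarrow> s x + s y) upwards" by (intro tendsto_intros s)
    ultimately show "s (x + y) = s x + s y" by (rule uniq)
    have "((\<lambda>b. scaleC c (b x)) \<longlongrightarrow> s (scaleC c x)) upwards"
      by (rule Lim_transform_eventually[OF s[of "scaleC c x"]])
         (rule eventually_mono[OF eventually_in], simp add: lin)
    moreover have "((\<lambda>b. scaleC c (b x)) \<longlongrightarrow> scaleC c (s x)) upwards" by (intro tendsto_intros s)
    ultimately show "s (scaleC c x) = scaleC c (s x)" by (rule uniq)
    show "norm (s x) \<le> C * norm x"
      by (rule tendsto_upperbound[OF tendsto_norm[OF s] _ upwards_not_bot])
         (rule eventually_mono[OF eventually_in], erule bound)
  qed
  moreover have "cinner (s x) y = cinner x (s y)" for x y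
  proof -
    have "((\<lambda>b. cinner x (b y)) \<longlongrightarrow> cinner (s x) y) upwards"
      by (rule Lim_transform_eventually[OF tendsto_cinner[OF s[of x] tendsto_const[of y]]])
         (rule eventually_mono[OF eventually_in], erule selfadjointD(2)[OF positive_opD(1)[OF pos]])
    moreover have "((\<lambda>b. cinner x (b y)) \<longlongrightarrow> cinner x (s y)) upwards" by (intro tendsto_intros s)
    ultimately show ?thesis by (rule uniq)
  qed
  ultimately have sa: "selfadjoint s" by (simp add: selfadjoint_def)
  have lim: "((\<lambda>b. rinner x (b x)) \<longlongrightarrow> rinner x (s x)) upwards" for x
    by (intro tendsto_intros s)
  have upper: "op_le a s" if "a \<in> D" for a
    unfolding op_le_def
  proof (intro conjI allI sa)
    show "selfadjoint a" using that pos positive_opD(1) by blast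
    show "rinner x (a x) \<le> rinner x (s x)" for x
      by (rule tendsto_lowerbound[OF lim _ upwards_not_bot])
         (rule eventually_mono[OF eventually_above[OF that]], erule op_leD(3))
  qed
  have least: "op_le s u" if u: "selfadjoint u" "\<forall>a\<in>D. op_le a u" for u
    unfolding op_le_def
  proof (intro conjI allI sa u(1))
    show "rinner x (s x) \<le> rinner x (u x)" for x
      by (rule tendsto_upperbound[OF lim _ upwards_not_bot])
         (rule eventually_mono[OF eventually_in], use u(2) op_leD(3) in blast)
  qed
  have lub: "is_op_lub D s" unfolding is_op_lub_def using sa upper least by blast
  have eq: "op_lub D = s" by (rule op_lub_eqI[OF lub])
  show "is_op_lub D (op_lub D)" "((\<lambda>b. b x) \<longlongrightarrow> op_lub D x) upwards" using lub s eq by auto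
  obtain a where "a \<in> D" using nonempty by blast
  then have "0 \<le> rinner x (s x)" for x
    using positive_opD(2)[OF pos, of a x] op_leD(3)[OF upper, of a x] by linarith
  with sa show "positive_op (op_lub D)" unfolding eq by (rule positive_opI)
qed

lemma op_lub_upper: "a \<in> D \<Longrightarrow> op_le a (op_lub D)"
  using is_op_lub_op_lub by (simp add: is_op_lub_def)

lemma rinner_op_lub_le:
  assumes "\<And>a. a \<in> D \<Longrightarrow> rinner x (a x) \<le> B" shows "rinner x (op_lub D x) \<le> B"
proof -
  have "((\<lambda>b. rinner x (b x)) \<longlongrightarrow> rinner x (op_lub D x)) upwards"
    by (intro tendsto_intros op_lub_tendsto)
  then show ?thesis by (rule tendsto_upperbound[OF _ _ upwards_not_bot])
    (rule eventually_mono[OF eventually_in], erule assms)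
qed

lemma norm_op_lub_le: "norm (op_lub D x) \<le> C * norm x"
  by (rule tendsto_upperbound[OF tendsto_norm[OF op_lub_tendsto] _ upwards_not_bot])
     (rule eventually_mono[OF eventually_in], erule bound)

lemma op_lub_commutes:
  assumes "bounded_clinear T" "\<And>a x. a \<in> D \<Longrightarrow> T (a x) = a (T x)"
  shows "T (op_lub D x) = op_lub D (T x)"
proof -
  have "((\<lambda>b. b (T x)) \<longlongrightarrow> T (op_lub D x)) upwards"
    by (rule Lim_transform_eventually[OF bounded_clinear_tendsto[OF assms(1) op_lub_tendsto[of x]]])
       (rule eventually_mono[OF eventually_in], erule assms(2))
  then show ?thesis using op_lub_tendsto[of "T x"] by (rule tendsto_unique[OF upwards_not_bot])
qed

end

subsection \<open>Contractions defined on a dense subspace\<close>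

text \<open>\<open>V\<close> is a linear relation that is not assumed single-valued. The norm bound,
  applied to differences, makes both \<open>V\<close> and its closure \<open>R\<close>
  single-valued, so callers never have to check that a prescription is well defined.\<close>

lemma contraction_extension:
  fixes V :: "('a::complex_hilbert \<times> 'a) set"
  assumes add: "\<And>x y x' y'. (x, y) \<in> V \<Longrightarrow> (x', y') \<in> V \<Longrightarrow> (x + x', y + y') \<in> V"
    and scl: "\<And>c x y. (x, y) \<in> V \<Longrightarrow> (scaleC c x, scaleC c y) \<in> V"
    and contr: "\<And>x y. (x, y) \<in> V \<Longrightarrow> norm y \<le> norm x"
    and dense: "closure (fst ` V) = UNIV"
  obtains C where "bounded_clinear C" "\<And>x y. (x, y) \<in> V \<Longrightarrow> C x = y" "\<And>x. norm (C x) \<le> norm x"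
proof -
  define R where "R x y \<longleftrightarrow> (\<exists>f g. (\<forall>n::nat. (f n, g n) \<in> V) \<and> f \<longlonglongrightarrow> x \<and> g \<longlonglongrightarrow> y)" for x y
  have diff: "(x - x', y - y') \<in> V" if "(x, y) \<in> V" "(x', y') \<in> V" for x y x' y'
    using add[OF that(1) scl[OF that(2), of "-1"]] by (simp add: scaleC_minus_one)
  have Radd: "R (x + x') (y + y')" if R: "R x y" "R x' y'" for x y x' y'
  proof -
    obtain f g f' g' where "\<forall>n. (f n, g n) \<in> V" "f \<longlonglongrightarrow> x" "g \<longlonglongrightarrow> y"
      "\<forall>n. (f' n, g' n) \<in> V" "f' \<longlonglongrightarrow> x'" "g' \<longlonglongrightarrow> y'"
      using R unfolding R_def by blast
    then show ?thesis unfolding R_def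
      by (intro exI[of _ "\<lambda>n. f n + f' n"] exI[of _ "\<lambda>n. g n + g' n"]) (auto intro!: add tendsto_intros)
  qed
  have Rscl: "R (scaleC c x) (scaleC c y)" if R: "R x y" for c x y
  proof -
    obtain f g where "\<forall>n. (f n, g n) \<in> V" "f \<longlonglongrightarrow> x" "g \<longlonglongrightarrow> y" using R unfolding R_def by blast
    then show ?thesis unfolding R_def
      by (intro exI[of _ "\<lambda>n. scaleC c (f n)"] exI[of _ "\<lambda>n. scaleC c (g n)"]) (auto intro!: scl tendsto_intros)
  qed
  have Rcontr: "norm y \<le> norm x" if R: "R x y" for x y
  proof -
    obtain f g where fg: "\<forall>n. (f n, g n) \<in> V" "f \<longlonglongrightarrow> x" "g \<longlonglongrightarrow> y" using R unfolding R_def by blast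
    show ?thesis
      by (rule LIMSEQ_le[OF tendsto_norm[OF fg(3)] tendsto_norm[OF fg(2)]]) (use fg(1) contr in blast)
  qed
  have Rtot: "\<exists>y. R x y" for x
  proof -
    obtain f where f: "\<And>n. f n \<in> fst ` V" "f \<longlonglongrightarrow> x"
      using dense closure_sequential[of x "fst ` V"] by auto
    have "\<forall>n. \<exists>y. (f n, y) \<in> V" using f(1) by force
    then obtain g where g: "\<And>n. (f n, g n) \<in> V" by metis
    have "norm (g m - g n) \<le> norm (f m - f n)" for m n by (rule contr[OF diff[OF g g]])
    moreover have "Cauchy f" using f(2) LIMSEQ_imp_Cauchy by blast
    ultimately have "Cauchy g" unfolding Cauchy_iff by (metis order_le_less_trans)
    then obtain y where "g \<longlonglongrightarrow> y" using Cauchy_convergent convergent_def by blast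
    then show ?thesis using f g unfolding R_def by blast
  qed
  have Runiq: "y = y'" if "R x y" "R x y'" for x y y'
    using Rcontr[OF Radd[OF that(1) Rscl[OF that(2), of "-1"]]] by (simp add: scaleC_minus_one)
  define C where "C x = (SOME y. R x y)" for x
  have RC: "R x (C x)" for x unfolding C_def using someI_ex[OF Rtot] .
  have CI: "C x = y" if "R x y" for x y using Runiq[OF RC that] .
  show ?thesis
  proof (rule that)
    show "bounded_clinear C"
      by (rule bounded_clinearI[of _ 1]) (auto intro!: CI Radd Rscl RC simp: Rcontr[OF RC])
    show "C x = y" if "(x, y) \<in> V" for x y
      by (rule CI) (unfold R_def, rule exI[of _ "\<lambda>n. x"], rule exI[of _ "\<lambda>n. y"], use that in simp)
    show "norm (C x) \<le> norm x" for x by (rule Rcontr[OF RC])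
  qed
qed

section \<open>Von Neumann algebras\<close>

subsection \<open>Invariant subspaces of self-adjoint semigroups of operators\<close>

text \<open>Sums are supplied later by \<open>span\<close>. Closure under complex multiples turns
  the real span of an orbit into a complex subspace. The notion is used for the algebra and for its
  commutant alike.\<close>

definition star_monoid :: "('a::complex_hilbert \<Rightarrow> 'a) set \<Rightarrow> bool" where
  "star_monoid S \<longleftrightarrow> id \<in> S \<and> (\<forall>a\<in>S. bounded_clinear a \<and> adjoint a \<in> S) \<and>
     (\<forall>a\<in>S. \<forall>b\<in>S. a \<circ> b \<in> S) \<and> (\<forall>a\<in>S. \<forall>c. (\<lambda>x. scaleC c (a x)) \<in> S)"

definition orbit_span :: "('a::complex_hilbert \<Rightarrow> 'a) set \<Rightarrow> 'a set \<Rightarrow> 'a set" where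
  "orbit_span S X = closure (span {a x | a x. a \<in> S \<and> x \<in> X})"

lemma mem_commutant: "T \<in> commutant S \<longleftrightarrow> bounded_clinear T \<and> (\<forall>a\<in>S. \<forall>x. T (a x) = a (T x))"
  by (auto simp: commutant_def fun_eq_iff)

lemma orbit_span_mono: "X \<subseteq> Y \<Longrightarrow> orbit_span S X \<subseteq> orbit_span S Y"
  unfolding orbit_span_def by (intro closure_mono span_mono) auto

lemma orbit_span_gen: "a \<in> S \<Longrightarrow> x \<in> X \<Longrightarrow> a x \<in> orbit_span S X"
  unfolding orbit_span_def by (intro subsetD[OF closure_subset] span_base) blast

context
  fixes S :: "('a::complex_hilbert \<Rightarrow> 'a) set"
  assumes S: "star_monoid S"
begin

lemma orbit_span_incl: "X \<subseteq> orbit_span S X"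
proof
  fix x assume "x \<in> X"
  moreover have "id \<in> S" using S by (simp add: star_monoid_def)
  ultimately show "x \<in> orbit_span S X" using orbit_span_gen[of id S x X] by simp
qed

lemma orbit_span_csubspace: "csubspace (orbit_span S X)"
  unfolding orbit_span_def
proof (rule csubspace_closure)
  let ?G = "{a x | a x. a \<in> S \<and> x \<in> X}"
  have "scaleC c v \<in> span ?G" if "v \<in> span ?G" for c v
    using that
  proof (induction rule: span_induct_alt)
    case base show ?case by (simp add: span_zero)
  next
    case (step r v w)
    then obtain a x where v: "v = a x" "a \<in> S" "x \<in> X" by blast
    have "(\<lambda>x. scaleC c (a x)) \<in> S" using S v by (simp add: star_monoid_def)
    then have "scaleC c v \<in> ?G" using v by fastforce
    then show ?case using step by (simp add: scaleC_add_right scaleC_scaleR span_add span_scale span_base)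
  qed
  then show "csubspace (span ?G)" by (simp add: csubspace_def span_zero span_add)
qed

lemma orbit_span_closed: "closed (orbit_span S X)"
  by (simp add: orbit_span_def)

lemma orbit_span_invariant:
  assumes b: "b \<in> S" and v: "v \<in> orbit_span S X" shows "b v \<in> orbit_span S X"
proof -
  let ?G = "{a x | a x. a \<in> S \<and> x \<in> X}"
  have bb: "bounded_clinear b" using S b by (simp add: star_monoid_def)
  have inv: "b w \<in> span ?G" if "w \<in> span ?G" for w
    using that
  proof (induction rule: span_induct_alt)
    case base show ?case by (simp add: bounded_clinearD[OF bb] span_zero)
  next
    case (step r w u)
    then obtain a x where w: "w = a x" "a \<in> S" "x \<in> X" by blast
    have "b \<circ> a \<in> S" using S b w by (simp add: star_monoid_def)
    then have "(b \<circ> a) x \<in> ?G" using w(3) by blast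
    then have "b w \<in> ?G" using w(1) by simp
    then show ?case using step by (simp add: bounded_clinearD[OF bb] span_add span_scale span_base)
  qed
  obtain f where f: "\<And>n. f n \<in> span ?G" "f \<longlonglongrightarrow> v"
    using v unfolding orbit_span_def closure_sequential by blast
  have "(\<lambda>n. b (f n)) \<longlonglongrightarrow> b v" by (rule bounded_clinear_tendsto[OF bb f(2)])
  moreover have "b (f n) \<in> span ?G" for n by (rule inv[OF f(1)])
  ultimately show ?thesis unfolding orbit_span_def closure_sequential
    by (intro exI[of _ "\<lambda>n. b (f n)"]) simp
qed

lemma orbit_proj:
  shows orbit_proj_mem: "orth_proj (orbit_span S X) x \<in> orbit_span S X"
    and orbit_proj_orth: "z \<in> orbit_span S X \<Longrightarrow> cinner z (x - orth_proj (orbit_span S X) x) = 0"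
    and orbit_proj_eqI: "u \<in> orbit_span S X \<Longrightarrow> (\<And>z. z \<in> orbit_span S X \<Longrightarrow> cinner z (x - u) = 0) \<Longrightarrow>
        orth_proj (orbit_span S X) x = u"
  by (rule orth_proj[OF orbit_span_closed orbit_span_csubspace], erule orth_proj[OF orbit_span_closed orbit_span_csubspace],
      rule orth_proj_eqI[OF orbit_span_closed orbit_span_csubspace])

lemma orbit_proj_fix: "x \<in> orbit_span S X \<Longrightarrow> orth_proj (orbit_span S X) x = x"
  by (rule orbit_proj_eqI) auto

lemma orbit_proj_cinner:
  "cinner (orth_proj (orbit_span S X) x) y = cinner (orth_proj (orbit_span S X) x) (orth_proj (orbit_span S X) y)"
  using orbit_proj_orth[OF orbit_proj_mem, of X x y] by (simp add: cinner_diff_right)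

lemma orbit_proj_norm:
  "rinner x (orth_proj (orbit_span S X) x) = (norm (orth_proj (orbit_span S X) x))\<^sup>2"
  using orbit_proj_cinner[of X x x] rinner_commute[of x "orth_proj (orbit_span S X) x"]
  by (simp add: rinner_self)

lemma orbit_proj_norm_le: "norm (orth_proj (orbit_span S X) x) \<le> norm x"
proof -
  let ?p = "orth_proj (orbit_span S X) x"
  have "(norm ?p)\<^sup>2 \<le> norm x * norm ?p"
    using rinner_le_norm[of x ?p] unfolding orbit_proj_norm .
  then show ?thesis by (cases "?p = 0") (auto simp: power2_eq_square)
qed

text \<open>The subspace is invariant under each operator of \<open>S\<close> and under its adjoint;
  the latter makes the orthogonal complement invariant too, so the projection commutes with
  \<open>S\<close>.\<close>

lemma orbit_proj_commutant: "orth_proj (orbit_span S X) \<in> commutant S"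
  unfolding mem_commutant
proof (intro conjI ballI allI)
  let ?L = "orbit_span S X"
  note sub = csubspaceD[OF orbit_span_csubspace[of X]]
  show "bounded_clinear (orth_proj ?L)"
  proof (rule bounded_clinearI[of _ 1])
    fix x y c
    show "orth_proj ?L (x + y) = orth_proj ?L x + orth_proj ?L y"
    proof (rule orbit_proj_eqI)
      fix z assume z: "z \<in> ?L"
      show "cinner z (x + y - (orth_proj ?L x + orth_proj ?L y)) = 0"
        using orbit_proj_orth[OF z, of x] orbit_proj_orth[OF z, of y] by (simp add: cinner_simps)
    qed (rule sub(2)[OF orbit_proj_mem orbit_proj_mem])
    show "orth_proj ?L (scaleC c x) = scaleC c (orth_proj ?L x)"
    proof (rule orbit_proj_eqI)
      fix z assume z: "z \<in> ?L"
      show "cinner z (scaleC c x - scaleC c (orth_proj ?L x)) = 0"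
        using orbit_proj_orth[OF z, of x] by (simp add: cinner_simps)
    qed (rule sub(3)[OF orbit_proj_mem])
  qed (simp add: orbit_proj_norm_le)
  fix a x assume a: "a \<in> S"
  have a': "bounded_clinear a" "adjoint a \<in> S" using S a by (auto simp: star_monoid_def)
  show "orth_proj ?L (a x) = a (orth_proj ?L x)"
  proof (rule orbit_proj_eqI)
    show "a (orth_proj ?L x) \<in> ?L" by (rule orbit_span_invariant[OF a orbit_proj_mem])
    fix z assume z: "z \<in> ?L"
    have "cinner z (a (x - orth_proj ?L x)) = 0"
      using orbit_proj_orth[OF orbit_span_invariant[OF a'(2) z], of x]
      by (simp add: cinner_adjoint_left[OF a'(1)])
    then show "cinner z (a x - a (orth_proj ?L x)) = 0" by (simp add: bounded_clinearD[OF a'(1)])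
  qed
qed

lemma orbit_proj_selfadjoint: "selfadjoint (orth_proj (orbit_span S X))"
proof -
  have "cinner (orth_proj (orbit_span S X) x) y = cinner x (orth_proj (orbit_span S X) y)" for x y
    using orbit_proj_cinner[of X x y] orbit_proj_cinner[of X y x]
      cinner_commute[of x "orth_proj (orbit_span S X) y"]
      cinner_commute[of "orth_proj (orbit_span S X) x" "orth_proj (orbit_span S X) y"] by simp
  then show ?thesis using orbit_proj_commutant[of X] by (simp add: selfadjoint_def mem_commutant)
qed

lemma orbit_proj_positive: "positive_op (orth_proj (orbit_span S X))"
  by (rule positive_opI[OF orbit_proj_selfadjoint]) (simp add: orbit_proj_norm)

lemma orbit_proj_mono:
  assumes "X \<subseteq> Y" shows "op_le (orth_proj (orbit_span S X)) (orth_proj (orbit_span S Y))"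
  unfolding op_le_def
proof (intro conjI allI orbit_proj_selfadjoint)
  fix x
  let ?p = "orth_proj (orbit_span S X)" and ?q = "orth_proj (orbit_span S Y)"
  have "?p x \<in> orbit_span S Y" using orbit_proj_mem orbit_span_mono[OF assms] by blast
  then have "rinner (?p x) x = rinner (?p x) (?q x)"
    using orbit_proj_orth[of "?p x" Y x] by (simp add: cinner_diff_right)
  then have "(norm (?p x))\<^sup>2 = rinner (?p x) (?q x)" using rinner_commute[of x "?p x"] by (simp add: orbit_proj_norm)
  also have "\<dots> \<le> norm (?p x) * norm (?q x)" by (rule rinner_le_norm)
  finally have "norm (?p x) \<le> norm (?q x)" by (cases "?p x = 0") (auto simp: power2_eq_square)
  then show "rinner x (?p x) \<le> rinner x (?q x)" by (simp add: orbit_proj_norm power_mono)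
qed

end

subsection \<open>Closure properties of a von Neumann algebra\<close>

locale von_neumann =
  fixes M :: "('g::complex_hilbert \<Rightarrow> 'g) set"
  assumes vN: "von_neumann_algebra M"
begin

text \<open>Working form of the bicommutant identity: every closure property below, including those
  for limits, suprema and resolvents, reduces to commuting with the commutant.\<close>

lemma mem_M: "a \<in> M \<longleftrightarrow> bounded_clinear a \<and> (\<forall>T\<in>commutant M. \<forall>x. a (T x) = T (a x))"
proof -
  have "M = commutant (commutant M)" using vN unfolding von_neumann_algebra_def by blast
  then show ?thesis using mem_commutant[of a "commutant M"] by metis
qed

lemma M_bounded: "a \<in> M \<Longrightarrow> bounded_clinear a" by (simp add: mem_M)

lemmas M_lin = bounded_clinearD[OF M_bounded]

lemma M_adjoint: "a \<in> M \<Longrightarrow> adjoint a \<in> M"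
  using vN unfolding von_neumann_algebra_def by blast

lemma commutantD: "T \<in> commutant M \<Longrightarrow> bounded_clinear T" "T \<in> commutant M \<Longrightarrow> a \<in> M \<Longrightarrow> T (a x) = a (T x)"
  by (auto simp: mem_commutant)

lemma M_id: "id \<in> M" by (simp add: mem_M bounded_clinear_id)

lemma M_zero: "(\<lambda>x. 0) \<in> M"
  by (simp add: mem_M bounded_clinear_zero bounded_clinearD(5)[OF commutantD(1)])

lemma M_add: "a \<in> M \<Longrightarrow> b \<in> M \<Longrightarrow> (\<lambda>x. a x + b x) \<in> M"
  by (simp add: mem_M bounded_clinear_add bounded_clinearD(2)[OF commutantD(1)])

lemma M_scaleC: "a \<in> M \<Longrightarrow> (\<lambda>x. scaleC c (a x)) \<in> M"
  by (simp add: mem_M bounded_clinear_scaleC bounded_clinearD(3)[OF commutantD(1)])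

lemma M_compose: "a \<in> M \<Longrightarrow> b \<in> M \<Longrightarrow> a \<circ> b \<in> M"
  by (simp add: mem_M bounded_clinear_compose)

lemma M_scaleR: "a \<in> M \<Longrightarrow> (\<lambda>x. scaleR r (a x)) \<in> M"
  using M_scaleC by (simp add: scaleR_scaleC)

lemma M_diff: "a \<in> M \<Longrightarrow> b \<in> M \<Longrightarrow> (\<lambda>x. a x - b x) \<in> M"
  using M_add[OF _ M_scaleR[of b "-1"], of a] by simp

lemma M_sum: "finite I \<Longrightarrow> (\<And>i. i \<in> I \<Longrightarrow> f i \<in> M) \<Longrightarrow> (\<lambda>x. \<Sum>i\<in>I. f i x) \<in> M"
  by (induction I rule: finite_induct) (auto intro: M_zero M_add)

lemma M_resolvent:
  assumes "h \<in> M" "positive_op h" shows "resolvent h \<in> M"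
  unfolding mem_M
proof (intro conjI ballI allI)
  show "bounded_clinear (resolvent h)"
    using resolvent_positive[OF assms(2)] positive_opD(1) selfadjointD(1) by blast
  fix T x assume T: "T \<in> commutant M"
  have "T (resolvent h x) + h (T (resolvent h x)) = T (resolvent h x + h (resolvent h x))"
    using commutantD(2)[OF T assms(1)] bounded_clinearD(2)[OF commutantD(1)[OF T]] by simp
  then show "resolvent h (T x) = T (resolvent h x)"
    by (intro resolvent_eqI[OF assms(2)]) (simp add: resolvent_right[OF assms(2)])
qed

lemma M_op_lub:
  assumes "directed_operators D C" "D \<subseteq> M" shows "op_lub D \<in> M"
  unfolding mem_M
proof (intro conjI ballI allI)
  interpret directed_operators D C by fact
  show "bounded_clinear (op_lub D)" using positive_op_lub positive_opD(1) selfadjointD(1) by blast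
  fix T x assume T: "T \<in> commutant M"
  show "op_lub D (T x) = T (op_lub D x)"
    by (rule op_lub_commutes[symmetric]) (use T assms(2) commutantD in auto)
qed

lemma M_limit:
  assumes "bounded_clinear c" "\<And>n. f n \<in> M" "\<And>x. (\<lambda>n. f n x) \<longlonglongrightarrow> c x"
  shows "c \<in> M"
  unfolding mem_M
proof (intro conjI ballI allI assms(1))
  fix T x assume T: "T \<in> commutant M"
  have "(\<lambda>n. T (f n x)) \<longlonglongrightarrow> T (c x)" by (rule bounded_clinear_tendsto[OF commutantD(1)[OF T] assms(3)])
  then have "(\<lambda>n. f n (T x)) \<longlonglongrightarrow> T (c x)" using commutantD(2)[OF T assms(2)] by simp
  then show "c (T x) = T (c x)" using assms(3) LIMSEQ_unique by blast
qed

lemma M_adjoint_self: "a \<in> M \<Longrightarrow> adjoint a \<circ> a \<in> M"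
  by (intro M_compose M_adjoint)

lemma star_monoid_M: "star_monoid M"
  by (simp add: star_monoid_def M_id M_bounded M_adjoint M_compose M_scaleC)

lemma star_monoid_commutant: "star_monoid (commutant M)"
  unfolding star_monoid_def
proof (intro conjI ballI allI)
  fix T assume T: "T \<in> commutant M"
  note Tb = commutantD(1)[OF T]
  show "bounded_clinear T" by (rule Tb)
  show "adjoint T \<in> commutant M"
    unfolding mem_commutant
  proof (intro conjI ballI allI bounded_clinear_adjoint Tb cinner_eqI)
    fix a x z assume a: "a \<in> M"
    have "cinner z (adjoint T (a x)) = cinner (adjoint a (T z)) x"
      by (simp add: cinner_adjoint[OF Tb, symmetric] cinner_adjoint_left[OF M_bounded[OF a]])
    also have "\<dots> = cinner (T (adjoint a z)) x" by (simp add: commutantD(2)[OF T M_adjoint[OF a]])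
    also have "\<dots> = cinner z (a (adjoint T x))"
      by (simp add: cinner_adjoint[OF Tb] cinner_adjoint_left[OF M_bounded[OF a]])
    finally show "cinner z (adjoint T (a x)) = cinner z (a (adjoint T x))" .
  qed
  show "(\<lambda>x. scaleC c (T x)) \<in> commutant M" for c
    using T by (simp add: mem_commutant bounded_clinear_scaleC M_lin(3))
  show "T \<circ> U \<in> commutant M" if "U \<in> commutant M" for U
    using T that by (simp add: mem_commutant bounded_clinear_compose)
qed (simp add: mem_commutant bounded_clinear_id)

text \<open>The projection onto the closed span of the commutant orbits of \<open>X\<close>. Its
  range is invariant under the commutant, so it belongs to the bicommutant, that is, to
  \<open>M\<close>.\<close>

abbreviation support_proj :: "'g set \<Rightarrow> 'g \<Rightarrow> 'g" where
  "support_proj X \<equiv> orth_proj (orbit_span (commutant M) X)"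

lemma support_proj_M: "support_proj X \<in> M"
  using orbit_proj_commutant[OF star_monoid_commutant, of X] vN
  unfolding von_neumann_algebra_def by blast

end

subsection \<open>Normal endomorphisms\<close>

locale star_endo = von_neumann M for M :: "('g::complex_hilbert \<Rightarrow> 'g) set" +
  fixes \<phi> :: "('g \<Rightarrow> 'g) \<Rightarrow> ('g \<Rightarrow> 'g)"
  assumes endo: "unital_star_endo M \<phi>"
begin

lemma endo_in: "a \<in> M \<Longrightarrow> \<phi> a \<in> M"
  and endo_add: "a \<in> M \<Longrightarrow> b \<in> M \<Longrightarrow> \<phi> (\<lambda>x. a x + b x) = (\<lambda>x. \<phi> a x + \<phi> b x)"
  and endo_scaleC: "a \<in> M \<Longrightarrow> \<phi> (\<lambda>x. scaleC c (a x)) = (\<lambda>x. scaleC c (\<phi> a x))"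
  and endo_compose: "a \<in> M \<Longrightarrow> b \<in> M \<Longrightarrow> \<phi> (a \<circ> b) = \<phi> a \<circ> \<phi> b"
  and endo_adjoint: "a \<in> M \<Longrightarrow> \<phi> (adjoint a) = adjoint (\<phi> a)"
  and endo_id: "\<phi> id = id"
  using endo unfolding unital_star_endo_def by blast+

lemma endo_scaleR: "a \<in> M \<Longrightarrow> \<phi> (\<lambda>x. scaleR r (a x)) = (\<lambda>x. scaleR r (\<phi> a x))"
  by (simp add: scaleR_scaleC endo_scaleC)

lemma endo_diff:
  assumes "a \<in> M" "b \<in> M" shows "\<phi> (\<lambda>x. a x - b x) = (\<lambda>x. \<phi> a x - \<phi> b x)"
  using endo_add[OF assms(1) M_scaleR[OF assms(2), of "-1"]] endo_scaleR[OF assms(2), of "-1"] by simp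

lemma endo_zero: "\<phi> (\<lambda>x. 0) = (\<lambda>x. 0)"
  using endo_diff[OF M_id M_id] by simp

lemma endo_sum:
  assumes "finite I" "\<And>i. i \<in> I \<Longrightarrow> f i \<in> M"
  shows "\<phi> (\<lambda>x. \<Sum>i\<in>I. f i x) = (\<lambda>x. \<Sum>i\<in>I. \<phi> (f i) x)"
  using assms
proof (induction I rule: finite_induct)
  case empty then show ?case by (simp add: endo_zero)
next
  case (insert i I)
  have "\<phi> (\<lambda>x. f i x + (\<Sum>i\<in>I. f i x)) = (\<lambda>x. \<phi> (f i) x + \<phi> (\<lambda>x. \<Sum>i\<in>I. f i x) x)"
    by (rule endo_add) (use insert in \<open>auto intro: M_sum\<close>)
  with insert show ?case by simp
qed

lemma endo_selfadjoint:
  assumes "a \<in> M" "selfadjoint a" shows "selfadjoint (\<phi> a)"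
proof -
  have "adjoint (\<phi> a) = \<phi> a" using endo_adjoint[OF assms(1)] selfadjointD(3)[OF assms(2)] by metis
  then show ?thesis unfolding selfadjoint_def
    using cinner_adjoint[OF M_bounded[OF endo_in[OF assms(1)]]] M_bounded endo_in assms(1) by simp
qed

text \<open>If the bottom of the numerical range of \<open>\<phi> a\<close> were some \<open>-e < 0\<close>, then \<open>\<phi> a + e\<close> would
  not be bounded below; but its inverse is the image of the resolvent of \<open>a\<close>.\<close>

lemma endo_positive:
  assumes a: "a \<in> M" "positive_op a" shows "positive_op (\<phi> a)"
proof (rule positive_opI)
  show sa: "selfadjoint (\<phi> a)" using a endo_selfadjoint positive_opD(1) by blast
  note lin = bounded_clinearD[OF selfadjointD(1)[OF sa]]
  obtain K where K: "K \<ge> 0" "\<And>x. norm (\<phi> a x) \<le> K * norm x"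
    using bounded_clinear_bound[OF selfadjointD(1)[OF sa]] by blast
  fix x0
  show "0 \<le> rinner x0 (\<phi> a x0)"
  proof (rule ccontr)
    assume neg: "\<not> 0 \<le> rinner x0 (\<phi> a x0)"
    then have "x0 \<noteq> 0" by (auto simp: lin)
    define N where "N = (\<lambda>x. rinner x (\<phi> a x)) ` {x. norm x = 1}"
    define e where "e = - Inf N"
    let ?u = "scaleR (1 / norm x0) x0"
    have u: "norm ?u = 1" "rinner ?u (\<phi> a ?u) < 0"
      using neg \<open>x0 \<noteq> 0\<close> by (auto simp: lin mult_less_0_iff divide_less_0_iff)
    have bdd: "bdd_below N"
      unfolding N_def
    proof (rule bdd_belowI2)
      fix x :: 'g assume "x \<in> {x. norm x = 1}"
      then show "- K \<le> rinner x (\<phi> a x)"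
        using abs_rinner_le[of x "\<phi> a x"] K(2)[of x] by simp
    qed
    have ne: "N \<noteq> {}" unfolding N_def using u(1) by blast
    have low: "- e \<le> rinner x (\<phi> a x)" if "norm x = 1" for x
      unfolding e_def using bdd that by (auto simp: N_def intro: cInf_lower)
    have "e > 0" using low[OF u(1)] u(2) by linarith
    have lowg: "0 \<le> rinner x (\<phi> a x + scaleR e x)" for x
    proof (cases "x = 0")
      case False
      have "- e \<le> rinner (scaleR (1 / norm x) x) (\<phi> a (scaleR (1 / norm x) x))"
        by (rule low) (use False in simp)
      also have "\<dots> = rinner x (\<phi> a x) / (norm x)\<^sup>2" by (simp add: lin power2_eq_square)
      finally show ?thesis using False by (simp add: cinner_add_right rinner_self field_simps)
    qed simp
    define A where "A = (\<lambda>x. \<phi> a x + scaleR e x)"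
    have Apos: "positive_op A"
    proof (rule positive_opI)
      show "selfadjoint A" using sa
          bounded_clinear_add[OF selfadjointD(1)[OF sa] bounded_clinear_scaleC[OF bounded_clinear_id, of "of_real e"]]
        by (simp add: selfadjoint_def A_def cinner_add_left cinner_add_right scaleR_scaleC)
          (simp add: cinner_scaleC_left cinner_scaleC_right)
      show "0 \<le> rinner x (A x)" for x using lowg by (simp add: A_def)
    qed
    have Abd: "norm (A x) \<le> (K + e) * norm x" for x
      using norm_triangle_ineq[of "\<phi> a x" "scaleR e x"] K(2)[of x] \<open>e > 0\<close>
      by (simp add: A_def algebra_simps)
    \<comment> \<open>Scaled so that \<open>1 + h\<close> is \<open>(a + e) / e\<close>; its image
      under \<open>\<phi>\<close> is then \<open>A / e\<close>, and \<open>\<phi> ?r\<close> is a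
      bounded left inverse of it.\<close>
    define h where "h = (\<lambda>x. scaleR (1 / e) (a x))"
    have hM: "h \<in> M" unfolding h_def by (rule M_scaleR[OF a(1)])
    have hpos: "positive_op h"
    proof (rule positive_opI)
      show "selfadjoint h"
        using M_bounded[OF hM] selfadjointD(2)[OF positive_opD(1)[OF a(2)]]
        by (simp add: selfadjoint_def h_def)
      show "0 \<le> rinner x (h x)" for x using positive_opD(2)[OF a(2), of x] \<open>e > 0\<close> by (simp add: h_def)
    qed
    let ?r = "resolvent h"
    have rM: "?r \<in> M" by (rule M_resolvent[OF hM hpos])
    have "?r \<circ> (\<lambda>x. id x + h x) = id" by (auto simp: fun_eq_iff intro: resolvent_eqI[OF hpos])
    then have "\<phi> ?r \<circ> (\<lambda>x. id x + \<phi> h x) = id"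
      using endo_compose[OF rM M_add[OF M_id hM]] endo_add[OF M_id hM] endo_id by simp
    then have inv: "\<phi> ?r (x + \<phi> h x) = x" for x by (simp add: fun_eq_iff)
    obtain K' where K': "K' \<ge> 0" "\<And>x. norm (\<phi> ?r x) \<le> K' * norm x"
      using bounded_clinear_bound[OF M_bounded[OF endo_in[OF rM]]] by blast
    have below: "norm x \<le> K' / e * norm (A x)" for x
    proof -
      have "x + \<phi> h x = scaleR (1 / e) (A x)"
        unfolding h_def endo_scaleR[OF a(1)] A_def using \<open>e > 0\<close> by (simp add: scaleR_add_right)
      then show ?thesis using K'(2)[of "x + \<phi> h x"] inv[of x] \<open>e > 0\<close> by simp
    qed
    \<comment> \<open>Near the bottom of the numerical range the form of \<open>A\<close> falls
      below \<open>d\<close>. Combined with \<open>below\<close> and the norm-square bound for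
      positive operators this gives \<open>1 \<le> c * d\<close>, so any \<open>d\<close> with
      \<open>c * d < 1\<close> is contradictory.\<close>
    define c where "c = (K' / e)\<^sup>2 * (K + e)"
    define d where "d = inverse (c + 1)"
    have "0 \<le> c" using K \<open>e > 0\<close> by (simp add: c_def)
    then have d: "d > 0" "c * d < 1" unfolding d_def by (auto simp: field_simps)
    have "Inf N < - e + d" using d unfolding e_def by simp
    then obtain x where x: "norm x = 1" "rinner x (\<phi> a x) < - e + d"
      using ne bdd by (subst (asm) cInf_less_iff) (auto simp: N_def)
    then have "rinner x (A x) < d" by (simp add: A_def cinner_add_right rinner_self)
    have "1 \<le> (K' / e * norm (A x))\<^sup>2"
      using below[of x] x(1) K' \<open>e > 0\<close> by (smt (verit) one_le_power)
    also have "\<dots> = (K' / e)\<^sup>2 * (norm (A x))\<^sup>2" by (rule power_mult_distrib)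
    also have "\<dots> \<le> (K' / e)\<^sup>2 * ((K + e) * rinner x (A x))"
      using K \<open>e > 0\<close> by (intro mult_left_mono positive_norm_sq_le[OF Apos _ Abd]) auto
    also have "\<dots> \<le> (K' / e)\<^sup>2 * ((K + e) * d)"
      using K \<open>e > 0\<close> \<open>rinner x (A x) < d\<close> by (intro mult_left_mono) auto
    also have "\<dots> < 1" using d(2) by (simp add: c_def mult.assoc)
    finally show False by simp
  qed
qed

lemma endo_mono:
  assumes "a \<in> M" "b \<in> M" "op_le a b" shows "op_le (\<phi> a) (\<phi> b)"
proof -
  have "positive_op (\<phi> (\<lambda>x. b x - a x))"
    by (intro endo_positive M_diff assms positive_op_diff)
  then have "rinner x (\<phi> a x) \<le> rinner x (\<phi> b x)" for x
    using positive_opD(2)[of _ x] unfolding endo_diff[OF assms(2,1)] by (fastforce simp: cinner_diff_right)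
  then show ?thesis using assms endo_selfadjoint op_leD by (auto simp: op_le_def)
qed

text \<open>The norm bound is the order bound of \<open>adjoint a \<circ> a\<close> by a multiple of
  the identity, and a positive unital map preserves it.\<close>

lemma endo_norm_le:
  assumes a: "a \<in> M" and c: "c \<ge> 0" "\<And>x. norm (a x) \<le> c * norm x"
  shows "norm (\<phi> a x) \<le> c * norm x"
proof -
  let ?b = "\<lambda>x::'g. scaleR (c\<^sup>2) (id x)"
  have bM: "?b \<in> M" by (rule M_scaleR[OF M_id])
  have "op_le (adjoint a \<circ> a) ?b"
    unfolding op_le_def
  proof (intro conjI allI)
    show "selfadjoint (adjoint a \<circ> a)"
      using positive_compression[OF M_bounded[OF a]] positive_opD(1) by blast
    show "selfadjoint ?b" unfolding selfadjoint_def using M_bounded[OF bM] by simp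
    show "rinner x ((adjoint a \<circ> a) x) \<le> rinner x (?b x)" for x
      using power_mono[OF c(2)[of x] norm_ge_zero, of 2]
      by (simp only: rinner_adjoint_self[OF M_bounded[OF a]]) (simp add: rinner_self power_mult_distrib)
  qed
  then have "op_le (\<phi> (adjoint a \<circ> a)) (\<phi> ?b)" by (intro endo_mono M_adjoint_self a bM)
  then have "rinner x ((adjoint (\<phi> a) \<circ> \<phi> a) x) \<le> rinner x (scaleR (c\<^sup>2) x)"
    using op_leD(3)[of _ _ x] endo_compose[OF M_adjoint[OF a] a] endo_adjoint[OF a]
      endo_scaleR[OF M_id, of "c\<^sup>2"] endo_id by fastforce
  then have "(norm (\<phi> a x))\<^sup>2 \<le> (c * norm x)\<^sup>2"
    by (simp only: rinner_adjoint_self[OF M_bounded[OF endo_in[OF a]]])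
       (simp add: rinner_self power_mult_distrib)
  then show ?thesis using c(1) by (simp add: power2_le_iff_abs_le)
qed

lemma endo_directed:
  assumes "directed_operators D C" "D \<subseteq> M" "C \<ge> 0"
  shows "directed_operators (\<phi> ` D) C"
proof -
  interpret directed_operators D C by fact
  show ?thesis
  proof
    show "\<phi> ` D \<noteq> {}" using nonempty by simp
    show "positive_op a" if "a \<in> \<phi> ` D" for a using that pos assms(2) endo_positive by blast
    show "norm (a x) \<le> C * norm x" if "a \<in> \<phi> ` D" for a x
      using that bound assms endo_norm_le by blast
    show "\<exists>c\<in>\<phi> ` D. op_le a c \<and> op_le b c" if D: "a \<in> \<phi> ` D" "b \<in> \<phi> ` D" for a b
    proof -
      obtain a' b' where ab: "a = \<phi> a'" "b = \<phi> b'" "a' \<in> D" "b' \<in> D" using D by blast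
      then obtain c where "c \<in> D" "op_le a' c" "op_le b' c" using directed by blast
      then show ?thesis using ab endo_mono assms(2) by blast
    qed
  qed
qed

lemma endo_op_lub:
  assumes "normal_map M \<phi>" "directed_operators D C" "D \<subseteq> M"
  shows "\<phi> (op_lub D) = op_lub (\<phi> ` D)"
proof -
  interpret directed_operators D C by fact
  show ?thesis
    by (rule assms(1)[unfolded normal_map_def, rule_format])
       (use assms(3) nonempty pos directed bound in blast)
qed

end

lemma directed_operators_range:
  fixes g :: "nat \<Rightarrow> 'a::complex_hilbert \<Rightarrow> 'a"
  assumes "\<And>n. positive_op (g n)" "\<And>n. op_le (g n) (g (Suc n))" "\<And>n x. norm (g n x) \<le> C * norm x"
  shows "directed_operators (range g) C"
proof -
  have mono: "op_le (g m) (g n)" if "m \<le> n" for m n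
    using that
  proof (induction rule: dec_induct)
    case base show ?case using assms(1) positive_opD(1) op_le_refl by blast
  next
    case (step n) then show ?case using assms(2) op_le_trans by blast
  qed
  show ?thesis
  proof
    fix a b assume "a \<in> range g" "b \<in> range g"
    then obtain m n where "a = g m" "b = g n" by blast
    then show "\<exists>c\<in>range g. op_le a c \<and> op_le b c"
      by (intro bexI[of _ "g (max m n)"]) (auto intro: mono)
  qed (use assms in auto)
qed

section \<open>Normality along a strongly continuous semigroup\<close>

locale E0 = von_neumann M for M :: "('g::complex_hilbert \<Rightarrow> 'g) set" +
  fixes \<theta> :: "real \<Rightarrow> ('g \<Rightarrow> 'g) \<Rightarrow> ('g \<Rightarrow> 'g)"
  assumes semigroup: "E0_semigroup M \<theta>"
    and continuous: "strongly_continuous_semigroup M \<theta>"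
begin

lemma theta_endo: "t \<ge> 0 \<Longrightarrow> star_endo M (\<theta> t)"
  using semigroup vN by (simp add: E0_semigroup_def star_endo_def von_neumann_def star_endo_axioms_def)

lemma theta_normal: "t \<ge> 0 \<Longrightarrow> normal_map M (\<theta> t)"
  using semigroup by (simp add: E0_semigroup_def)

lemma theta_0: "b \<in> M \<Longrightarrow> \<theta> 0 b = b"
  and theta_add: "s \<ge> 0 \<Longrightarrow> t \<ge> 0 \<Longrightarrow> b \<in> M \<Longrightarrow> \<theta> (s + t) b = \<theta> s (\<theta> t b)"
  using semigroup by (auto simp: E0_semigroup_def)

lemma theta_cont: "b \<in> M \<Longrightarrow> continuous_on {0..} (\<lambda>t. \<theta> t b x)"
  using continuous by (simp add: strongly_continuous_semigroup_def)

lemmas theta_in = star_endo.endo_in[OF theta_endo]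
lemmas theta_norm_le = star_endo.endo_norm_le[OF theta_endo]

section \<open>Supports of a vector under the semigroup\<close>

lemma theta_fixI:
  assumes "s \<ge> 0" "a \<in> M" "op_le a id" "(norm k)\<^sup>2 \<le> rinner k (\<theta> s a k)"
  shows "\<theta> s a k = k"
proof -
  interpret star_endo M "\<theta> s" using assms(1) by (rule theta_endo)
  have le: "op_le (\<theta> s a) id" using endo_mono[OF assms(2) M_id assms(3)] endo_id by simp
  have "rinner k (id k - \<theta> s a k) = 0"
    using op_leD(3)[OF le, of k] assms(4) by (simp add: cinner_diff_right rinner_self)
  from positive_rinner_zero[OF positive_op_diff[OF le] this] show ?thesis by simp
qed

lemma support_proj_le_id: "op_le (support_proj X) id"
proof -
  note orb = star_monoid_commutant
  have "rinner x (support_proj X x) \<le> rinner x x" for x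
    unfolding orbit_proj_norm[OF orb] rinner_self
    by (intro power_mono orbit_proj_norm_le[OF orb]) simp
  then show ?thesis using orbit_proj_selfadjoint[OF orb] by (simp add: op_le_def selfadjoint_id)
qed

lemma support_fix_mono:
  assumes "s \<ge> 0" "X \<subseteq> Y" "\<theta> s (support_proj X) k = k"
  shows "\<theta> s (support_proj Y) k = k"
proof (rule theta_fixI[OF assms(1) support_proj_M support_proj_le_id])
  interpret star_endo M "\<theta> s" using assms(1) by (rule theta_endo)
  have "op_le (\<theta> s (support_proj X)) (\<theta> s (support_proj Y))"
    by (intro endo_mono support_proj_M orbit_proj_mono star_monoid_commutant assms(2))
  from op_leD(3)[OF this, of k] show "(norm k)\<^sup>2 \<le> rinner k (\<theta> s (support_proj Y) k)"
    using assms(3) by (simp add: rinner_self)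
qed

text \<open>Support projections of countable sets form a directed family with supremum
  \<open>id\<close>. Normality moves this supremum under \<open>\<theta> s\<close>, a sequence of
  countable sets exhausts the form at \<open>k\<close>, and their union is still countable.\<close>

lemma countable_support_at:
  assumes s: "s \<ge> 0"
  shows "\<exists>X. countable X \<and> \<theta> s (support_proj X) k = k"
proof -
  interpret star_endo M "\<theta> s" using s by (rule theta_endo)
  note orb = star_monoid_commutant
  define D where "D = support_proj ` {X. countable X}"
  have dir: "directed_operators D 1"
  proof
    show "D \<noteq> {}" unfolding D_def using countable_empty by blast
    show "positive_op a" if "a \<in> D" for a using that orbit_proj_positive[OF orb] by (auto simp: D_def)
    show "norm (a x) \<le> 1 * norm x" if "a \<in> D" for a x
      using that orbit_proj_norm_le[OF orb] by (auto simp: D_def)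
    fix a b assume "a \<in> D" "b \<in> D"
    then obtain X Y where XY: "countable X" "countable Y" "a = support_proj X" "b = support_proj Y"
      by (auto simp: D_def)
    then have "support_proj (X \<union> Y) \<in> D" by (auto simp: D_def)
    moreover have "op_le a (support_proj (X \<union> Y))" "op_le b (support_proj (X \<union> Y))"
      unfolding XY by (intro orbit_proj_mono[OF orb]; blast)+
    ultimately show "\<exists>c\<in>D. op_le a c \<and> op_le b c" by blast
  qed
  have DM: "D \<subseteq> M" using support_proj_M by (auto simp: D_def)
  have "is_op_lub D id"
    unfolding is_op_lub_def
  proof (intro conjI allI impI ballI selfadjoint_id)
    show "op_le a id" if "a \<in> D" for a using that support_proj_le_id by (auto simp: D_def)
    fix u assume u: "selfadjoint u \<and> (\<forall>a\<in>D. op_le a u)"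
    have "rinner x (id x) \<le> rinner x (u x)" for x
    proof -
      have "op_le (support_proj {x}) u" using u by (auto simp: D_def)
      moreover have "support_proj {x} x = x"
        using orbit_proj_fix[OF orb] orbit_span_incl[OF orb, of "{x}"] by blast
      ultimately show ?thesis using op_leD(3)[of "support_proj {x}" u x] by simp
    qed
    then show "op_le id u" using u selfadjoint_id by (auto simp: op_le_def)
  qed
  then have "op_lub (\<theta> s ` D) = id"
    using op_lub_eqI endo_op_lub[OF theta_normal[OF s] dir DM] endo_id by metis
  interpret I: directed_operators "\<theta> s ` D" 1 by (rule endo_directed[OF dir DM]) simp
  have "\<exists>X. countable X \<and> (norm k)\<^sup>2 - inverse (real (Suc n)) < rinner k (\<theta> s (support_proj X) k)" for n
  proof (rule ccontr)
    assume *: "\<not> ?thesis"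
    have "rinner k (op_lub (\<theta> s ` D) k) \<le> (norm k)\<^sup>2 - inverse (real (Suc n))"
      by (rule I.rinner_op_lub_le) (use * in \<open>force simp: D_def not_less\<close>)
    then show False using \<open>op_lub (\<theta> s ` D) = id\<close> by (simp add: rinner_self)
  qed
  then obtain X where X: "\<And>n. countable (X n)"
    "\<And>n. (norm k)\<^sup>2 - inverse (real (Suc n)) < rinner k (\<theta> s (support_proj (X n)) k)" by metis
  let ?X = "\<Union>n. X n"
  have ge: "(norm k)\<^sup>2 - inverse (real (Suc n)) \<le> rinner k (\<theta> s (support_proj ?X) k)" for n
  proof -
    have "op_le (\<theta> s (support_proj (X n))) (\<theta> s (support_proj ?X))"
      by (intro endo_mono support_proj_M orbit_proj_mono orb) blast
    from op_leD(3)[OF this, of k] show ?thesis using X(2)[of n] by linarith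
  qed
  have "(\<lambda>n. (norm k)\<^sup>2 - inverse (real (Suc n))) \<longlonglongrightarrow> (norm k)\<^sup>2 - 0"
    by (intro tendsto_intros LIMSEQ_inverse_real_of_nat)
  then have "(norm k)\<^sup>2 - 0 \<le> rinner k (\<theta> s (support_proj ?X) k)"
    by (rule LIMSEQ_le_const2) (use ge in blast)
  then have "\<theta> s (support_proj ?X) k = k"
    by (intro theta_fixI s support_proj_M support_proj_le_id) simp
  moreover have "countable ?X" using X(1) by simp
  ultimately show ?thesis by blast
qed

text \<open>One countable set has to serve all times. Rational times need only countably many sets;
  the union works there by monotonicity, and strong continuity carries the fixed-point equation to
  real times.\<close>

lemma countable_support:
  obtains x :: "nat \<Rightarrow> 'g" where "\<And>s. s \<ge> 0 \<Longrightarrow> \<theta> s (support_proj (range x)) k = k"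
proof -
  have "\<exists>X. countable X \<and> (q \<ge> 0 \<longrightarrow> \<theta> (of_rat q) (support_proj X) k = k)" for q :: rat
    using countable_support_at[of "of_rat q" k] countable_empty by (cases "q \<ge> 0") auto
  then obtain X where X: "\<And>q::rat. countable (X q)"
    "\<And>q::rat. q \<ge> 0 \<Longrightarrow> \<theta> (of_rat q) (support_proj (X q)) k = k" by metis
  \<comment> \<open>Inserting \<open>k\<close> makes \<open>Y\<close> nonempty, so that it is the
    range of a sequence.\<close>
  define Y where "Y = insert k (\<Union>q. X q)"
  have "countable Y" unfolding Y_def using X(1) by simp
  then have Y: "range (from_nat_into Y) = Y" by (intro range_from_nat_into) (auto simp: Y_def)
  have rat: "\<theta> (of_rat q) (support_proj Y) k = k" if "q \<ge> 0" for q :: rat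
    by (rule support_fix_mono[OF _ _ X(2)[OF that]]) (use that in \<open>auto simp: Y_def\<close>)
  have "\<theta> s (support_proj Y) k = k" if s: "s \<ge> 0" for s
  proof -
    have "\<exists>q::rat. s < of_rat q \<and> of_rat q < s + inverse (real (Suc n))" for n
      by (rule of_rat_dense) simp
    then obtain q :: "nat \<Rightarrow> rat" where q: "\<And>n. s < of_rat (q n)" "\<And>n. of_rat (q n) < s + inverse (real (Suc n))"
      by metis
    have "0 \<le> real_of_rat (q n)" for n using q(1)[of n] s by linarith
    then have q0: "q n \<ge> 0" for n by simp
    have "(\<lambda>n. s + inverse (real (Suc n))) \<longlonglongrightarrow> s + 0"
      by (intro tendsto_intros LIMSEQ_inverse_real_of_nat)
    then have lim: "(\<lambda>n. s + inverse (real (Suc n))) \<longlonglongrightarrow> s" by simp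
    have "(\<lambda>n. real_of_rat (q n)) \<longlonglongrightarrow> s"
      by (rule tendsto_sandwich[OF _ _ tendsto_const[of s] lim])
         (rule always_eventually, rule allI, rule less_imp_le, rule q)+
    then have "(\<lambda>n. \<theta> (real_of_rat (q n)) (support_proj Y) k) \<longlonglongrightarrow> \<theta> s (support_proj Y) k"
      by (rule continuous_on_tendsto_compose[OF theta_cont[OF support_proj_M]])
         (use q0 s in \<open>auto intro!: always_eventually\<close>)
    then show ?thesis using rat[OF q0] by (simp add: LIMSEQ_const_iff)
  qed
  then show ?thesis using that[of "from_nat_into Y"] Y by simp
qed

text \<open>Normality only speaks of monotone nets. The bounded increasing operators
  \<open>1 - (1 + \<Sum>\<^sub>j\<^sub>=\<^sub>n\<^sup>N e\<^sub>j\<^sup>* e\<^sub>j)\<^sup>-\<^sup>1\<close> dominate the \<open>e\<^sub>j\<^sup>* e\<^sub>j\<close> up to a constant, and their suprema over \<open>N\<close> decrease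
  in \<open>n\<close> to an operator that vanishes on \<open>X\<close>.\<close>

lemma normal_null_sequence:
  assumes s: "s \<ge> 0" and supp: "\<theta> s (support_proj X) k = k"
    and e: "\<And>j::nat. e j \<in> M" "c \<ge> 0" "\<And>j x. norm (e j x) \<le> c * norm x"
    and sm: "\<And>x. x \<in> X \<Longrightarrow> summable (\<lambda>j. (norm (e j x))\<^sup>2)"
  shows "(\<lambda>j. \<theta> s (e j) k) \<longlonglongrightarrow> 0"
proof -
  interpret star_endo M "\<theta> s" using s by (rule theta_endo)
  define a where "a j = adjoint (e j) \<circ> e j" for j
  have aM: "a j \<in> M" for j unfolding a_def by (rule M_adjoint_self[OF e(1)])
  have apos: "positive_op (a j)" for j unfolding a_def by (rule positive_compression[OF M_bounded[OF e(1)]])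
  have aq: "rinner x (a j x) = (norm (e j x))\<^sup>2" for j x
    unfolding a_def by (rule rinner_adjoint_self[OF M_bounded[OF e(1)]])
  have abd: "norm (a j x) \<le> c\<^sup>2 * norm x" for j x
    using order_trans[OF adjoint_norm_le[OF M_bounded[OF e(1)] e(3) e(2)] mult_left_mono[OF e(3) e(2)]]
    by (simp add: a_def power2_eq_square mult.assoc)
  define S where "S n N = (\<lambda>x. \<Sum>j\<in>{n..<n+N}. a j x)" for n N :: nat
  have SM: "S n N \<in> M" for n N unfolding S_def by (rule M_sum[OF _ aM]) simp
  have Sq: "rinner x (S n N x) = (\<Sum>j\<in>{n..<n+N}. (norm (e j x))\<^sup>2)" for n N x
    by (simp add: S_def cinner_sum_right aq)
  have Ssa: "selfadjoint (S n N)" for n N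
    using M_bounded[OF SM[of n N]] selfadjointD(2)[OF positive_opD(1)[OF apos]]
    by (simp add: selfadjoint_def S_def cinner_sum_left cinner_sum_right)
  have Spos: "positive_op (S n N)" for n N
    by (rule positive_opI[OF Ssa]) (simp add: Sq sum_nonneg)
  define f where "f n N = (\<lambda>x. id x - resolvent (S n N) x)" for n N
  have fM: "f n N \<in> M" for n N unfolding f_def by (intro M_diff M_id M_resolvent SM Spos)
  have fpos: "positive_op (f n N)" for n N
    unfolding f_def by (rule positive_op_diff[OF resolvent_le_id[OF Spos]])
  have fbd: "norm (f n N x) \<le> 2 * norm x" for n N x
    using norm_triangle_ineq4[of x "resolvent (S n N) x"] norm_resolvent_le[OF Spos, of n N x]
    by (simp add: f_def)
  have fq: "rinner x (f n N x) \<le> rinner x (S n N x)" for n N x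
    using resolvent_lower[OF Spos, of x n N] by (simp add: f_def cinner_diff_right rinner_self)
  have f_mono: "op_le (f n N) (f n' N')" if "n' \<le> n" "n + N \<le> n' + N'" for n N n' N'
  proof -
    have "rinner x (S n N x) \<le> rinner x (S n' N' x)" for x
      unfolding Sq using that by (intro sum_mono2) auto
    then have "op_le (S n N) (S n' N')" by (simp add: op_le_def Ssa)
    then have "op_le (resolvent (S n' N')) (resolvent (S n N))" by (intro resolvent_antimono Spos)
    then have "rinner x (f n N x) \<le> rinner x (f n' N' x)" for x
      using op_leD(3)[of _ _ x] by (force simp: f_def cinner_diff_right)
    then show ?thesis using positive_opD(1)[OF fpos] by (simp add: op_le_def)
  qed
  have f_le_id: "op_le (f n N) id" for n N
    using positive_opD(1)[OF fpos] positive_opD(2)[OF resolvent_positive[OF Spos]]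
    by (simp add: op_le_def f_def selfadjoint_id cinner_diff_right)
  have dir: "directed_operators (range (f n)) 2" for n
    by (rule directed_operators_range[OF fpos _ fbd]) (rule f_mono, auto)
  define F where "F n = op_lub (range (f n))" for n
  have FM: "F n \<in> M" for n unfolding F_def by (rule M_op_lub[OF dir]) (use fM in blast)
  have Fpos: "positive_op (F n)" for n unfolding F_def by (rule directed_operators.positive_op_lub[OF dir])
  have fF: "op_le (f n N) (F n)" for n N
    unfolding F_def by (rule directed_operators.op_lub_upper[OF dir]) blast
  have F_le: "rinner x (F n x) \<le> B" if "\<And>N. rinner x (f n N x) \<le> B" for n x B
    unfolding F_def by (rule directed_operators.rinner_op_lub_le[OF dir]) (use that in blast)
  have F_dec: "rinner x (F (Suc n) x) \<le> rinner x (F n x)" for n x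
  proof (rule F_le)
    fix N
    \<comment> \<open>\<open>f n N\<close> uses the \<open>N\<close> terms from index
      \<open>n\<close> on, so the \<open>N\<close> terms from \<open>Suc n\<close> on are among the
      \<open>Suc N\<close> terms from \<open>n\<close> on.\<close>
    have "op_le (f (Suc n) N) (F n)" using op_le_trans[OF f_mono fF[of n "Suc N"], of "Suc n" N] by simp
    then show "rinner x (f (Suc n) N x) \<le> rinner x (F n x)" by (rule op_leD(3))
  qed
  have F_le_id: "rinner x (F n x) \<le> rinner x x" for n x
    by (rule F_le) (use op_leD(3)[OF f_le_id] in simp)
  \<comment> \<open>Normality speaks of increasing families; passing to complements makes the
    decreasing sequence \<open>F\<close> accessible to it.\<close>
  define G where "G n = (\<lambda>x. id x - F n x)" for n
  have GM: "G n \<in> M" for n unfolding G_def by (intro M_diff M_id FM)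
  have Gpos: "positive_op (G n)" for n
    unfolding G_def
    by (rule positive_op_diff[of "F n" id]) (use F_le_id positive_opD(1)[OF Fpos] in \<open>auto simp: op_le_def selfadjoint_id\<close>)
  have Gbd: "norm (G n x) \<le> 3 * norm x" for n x
    using norm_triangle_ineq4[of x "F n x"] directed_operators.norm_op_lub_le[OF dir, of n x]
    by (simp add: G_def F_def)
  have Ginc: "op_le (G n) (G (Suc n))" for n
    using positive_opD(1)[OF Gpos] F_dec by (simp add: op_le_def G_def cinner_diff_right)
  have dirG: "directed_operators (range G) 3"
    by (rule directed_operators_range) (rule Gpos Ginc Gbd)+
  define L where "L = op_lub (range G)"
  have GsubM: "range G \<subseteq> M" using GM by blast
  have LM: "L \<in> M" unfolding L_def by (rule M_op_lub[OF dirG GsubM])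
  have G_le_id: "rinner x (G n x) \<le> rinner x x" for n x
    using positive_opD(2)[OF Fpos, of x n] by (simp add: G_def cinner_diff_right)
  have L_le_id: "op_le L id"
    using directed_operators.rinner_op_lub_le[OF dirG] G_le_id
      positive_opD(1)[OF directed_operators.positive_op_lub[OF dirG]]
    by (auto simp: op_le_def L_def selfadjoint_id)
  \<comment> \<open>On \<open>X\<close> the form of \<open>F n\<close> is at most a tail of a
    convergent series, so the supremum of the complements has the full form there; being below the
    identity, it fixes \<open>X\<close>.\<close>
  have Lx: "L x = x" if x: "x \<in> X" for x
  proof -
    have tail: "(\<lambda>n. \<Sum>j. (norm (e (j + n) x))\<^sup>2) \<longlonglongrightarrow> 0"
      by (rule suminf_exist_split2[OF sm[OF x]])
    have F_tail: "rinner x (F n x) \<le> (\<Sum>j. (norm (e (j + n) x))\<^sup>2)" for n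
    proof (rule F_le)
      fix N
      have "rinner x (f n N x) \<le> (\<Sum>j\<in>{n..<n+N}. (norm (e j x))\<^sup>2)" using fq[of x n N] by (simp add: Sq)
      also have "\<dots> = (\<Sum>j<N. (norm (e (j + n) x))\<^sup>2)"
        by (rule sum.reindex_bij_witness[of _ "\<lambda>j. j + n" "\<lambda>j. j - n"]) auto
      also have "\<dots> \<le> (\<Sum>j. (norm (e (j + n) x))\<^sup>2)"
        using summable_ignore_initial_segment[OF sm[OF x], of n] by (intro sum_le_suminf) auto
      finally show "rinner x (f n N x) \<le> (\<Sum>j. (norm (e (j + n) x))\<^sup>2)" .
    qed
    have GL: "rinner x (G n x) \<le> rinner x (L x)" for n
      unfolding L_def by (rule op_leD(3)[OF directed_operators.op_lub_upper[OF dirG]]) blast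
    have ge: "rinner x x - (\<Sum>j. (norm (e (j + n) x))\<^sup>2) \<le> rinner x (L x)" for n
      using F_tail[of n] GL[of n] by (simp add: G_def cinner_diff_right)
    have "(\<lambda>n. rinner x x - (\<Sum>j. (norm (e (j + n) x))\<^sup>2)) \<longlonglongrightarrow> rinner x x - 0"
      by (intro tendsto_intros tail)
    then have "rinner x x - 0 \<le> rinner x (L x)"
      by (rule LIMSEQ_le_const2) (use ge in blast)
    then have "rinner x (id x - L x) = 0" using op_leD(3)[OF L_le_id, of x] by (simp add: cinner_diff_right)
    from positive_rinner_zero[OF positive_op_diff[OF L_le_id] this] show ?thesis by simp
  qed
  \<comment> \<open>\<open>L\<close> lies in \<open>M\<close> and hence commutes with the commutant,
    so fixing \<open>X\<close> propagates to the closed span of the commutant orbits.\<close>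
  have Lp: "L v = v" if v: "v \<in> orbit_span (commutant M) X" for v
  proof -
    let ?Gen = "{T x | T x. T \<in> commutant M \<and> x \<in> X}"
    have sp: "L w = w" if "w \<in> span ?Gen" for w
      using that
    proof (induction rule: span_induct_alt)
      case base show ?case by (simp add: M_lin[OF LM])
    next
      case (step r w u)
      then obtain T x where "w = T x" "T \<in> commutant M" "x \<in> X" by blast
      then have "L w = w" using commutantD(2)[of T L x] LM Lx by simp
      then show ?case using step by (simp add: M_lin[OF LM])
    qed
    obtain h where h: "\<And>n. h n \<in> span ?Gen" "h \<longlonglongrightarrow> v"
      using v unfolding orbit_span_def closure_sequential by blast
    have "(\<lambda>n. L (h n)) \<longlonglongrightarrow> L v" by (rule bounded_clinear_tendsto[OF M_bounded[OF LM] h(2)])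
    then have "h \<longlonglongrightarrow> L v" by (simp add: sp[OF h(1)])
    then show ?thesis using h(2) LIMSEQ_unique by blast
  qed
  have "L \<circ> support_proj X = support_proj X"
    using Lp orbit_proj_mem[OF star_monoid_commutant] by (auto simp: fun_eq_iff)
  then have "\<theta> s L \<circ> \<theta> s (support_proj X) = \<theta> s (support_proj X)"
    using endo_compose[OF LM support_proj_M, of X] by simp
  then have Lk: "\<theta> s L k = k" using supp by (metis comp_apply)
  have thL: "\<theta> s L = op_lub (\<theta> s ` range G)"
    unfolding L_def by (rule endo_op_lub[OF theta_normal[OF s] dirG GsubM])
  have dirT: "directed_operators (\<theta> s ` range G) 3" by (rule endo_directed[OF dirG GsubM]) simp
  have thG: "rinner k (\<theta> s (G n) k) = (norm k)\<^sup>2 - rinner k (\<theta> s (F n) k)" for n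
    unfolding G_def endo_diff[OF M_id FM] endo_id by (simp add: cinner_diff_right rinner_self)
  have thF_nonneg: "0 \<le> rinner k (\<theta> s (F n) k)" for n
    by (rule positive_opD(2)[OF endo_positive[OF FM Fpos]])
  have thF_dec: "rinner k (\<theta> s (F m) k) \<le> rinner k (\<theta> s (F n) k)" if "n \<le> m" for m n
    using that
  proof (induction rule: dec_induct)
    case (step m)
    have "op_le (F (Suc m)) (F m)" using F_dec positive_opD(1)[OF Fpos] by (simp add: op_le_def)
    then have "op_le (\<theta> s (F (Suc m))) (\<theta> s (F m))" by (rule endo_mono[OF FM FM])
    from op_leD(3)[OF this, of k] step show ?case by linarith
  qed simp
  have F0: "(\<lambda>n. rinner k (\<theta> s (F n) k)) \<longlonglongrightarrow> 0"
  proof (rule LIMSEQ_I)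
    fix d :: real assume "d > 0"
    have "\<exists>n. rinner k (\<theta> s (F n) k) < d"
    proof (rule ccontr)
      assume "\<not> ?thesis"
      then have "rinner k (op_lub (\<theta> s ` range G) k) \<le> (norm k)\<^sup>2 - d"
        by (intro directed_operators.rinner_op_lub_le[OF dirT]) (auto simp: thG not_less)
      then show False using \<open>d > 0\<close> Lk by (simp add: thL[symmetric] rinner_self)
    qed
    then obtain n where "rinner k (\<theta> s (F n) k) < d" by blast
    then show "\<exists>no. \<forall>n\<ge>no. norm (rinner k (\<theta> s (F n) k) - 0) < d"
      using thF_dec thF_nonneg by (intro exI[of _ n]) (auto intro: order_le_less_trans)
  qed
  \<comment> \<open>The first of the bounded substitutes, \<open>f n 1\<close>, involves only
    \<open>a n\<close>. Since \<open>a n\<close> has norm at most \<open>c^2\<close>, it is bounded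
    by \<open>(1 + c^2)\<close> times that substitute, hence by the same multiple of
    \<open>F n\<close>.\<close>
  have est: "(norm (\<theta> s (e n) k))\<^sup>2 \<le> (1 + c\<^sup>2) * rinner k (\<theta> s (F n) k)" for n
  proof -
    let ?F = "\<lambda>x. scaleR (1 + c\<^sup>2) (F n x)"
    have S1: "S n 1 = a n" by (simp add: S_def)
    have FM': "?F \<in> M" by (rule M_scaleR[OF FM])
    have "op_le (a n) ?F"
      unfolding op_le_def
    proof (intro conjI allI)
      show "selfadjoint (a n)" by (rule positive_opD(1)[OF apos])
      show "selfadjoint ?F"
        using M_bounded[OF FM'] selfadjointD(2)[OF positive_opD(1)[OF Fpos]] by (simp add: selfadjoint_def)
      fix x
      have "rinner x (a n x) \<le> (1 + c\<^sup>2) * rinner x (x - resolvent (a n) x)"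
        by (rule resolvent_complement_lower[OF apos _ abd]) simp
      also have "x - resolvent (a n) x = f n 1 x" unfolding f_def S1 by simp
      also have "(1 + c\<^sup>2) * rinner x (f n 1 x) \<le> (1 + c\<^sup>2) * rinner x (F n x)"
        by (intro mult_left_mono op_leD(3)[OF fF]) simp
      finally show "rinner x (a n x) \<le> rinner x (?F x)" by simp
    qed
    then have "op_le (\<theta> s (a n)) (\<theta> s ?F)" by (rule endo_mono[OF aM FM'])
    then have "rinner k (\<theta> s (a n) k) \<le> rinner k (\<theta> s ?F k)" by (rule op_leD(3))
    moreover have "\<theta> s (a n) = adjoint (\<theta> s (e n)) \<circ> \<theta> s (e n)"
      unfolding a_def endo_compose[OF M_adjoint[OF e(1)] e(1)] endo_adjoint[OF e(1)] ..
    ultimately show ?thesis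
      using rinner_adjoint_self[OF M_bounded[OF endo_in[OF e(1)[of n]]], of k]
      unfolding endo_scaleR[OF FM] by simp
  qed
  have lim: "(\<lambda>n. (1 + c\<^sup>2) * rinner k (\<theta> s (F n) k)) \<longlonglongrightarrow> 0"
    by (rule tendsto_mult_right_zero[OF F0])
  have "(\<lambda>n. (norm (\<theta> s (e n) k))\<^sup>2) \<longlonglongrightarrow> 0"
    by (rule tendsto_sandwich[OF _ _ tendsto_const[of 0] lim])
       (rule always_eventually, rule allI, rule zero_le_power2 est)+
  then have "(\<lambda>n. sqrt ((norm (\<theta> s (e n) k))\<^sup>2)) \<longlonglongrightarrow> sqrt 0" by (rule tendsto_real_sqrt)
  then show ?thesis by (simp add: tendsto_norm_zero_iff)
qed

end

subsection \<open>A finite minimax theorem\<close>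

text \<open>The values \<open>(f a, g a)\<close> fill a convex subset of the plane that misses the
  open positive quadrant, so a line with nonnegative coefficients separates the two. The proof finds
  its slope by hand; \<open>S\<close> carries no linear structure beyond \<open>mix\<close>.\<close>

lemma minimax_two:
  fixes f g :: "'v \<Rightarrow> real"
  assumes mix: "\<And>l a b. 0 \<le> l \<Longrightarrow> l \<le> 1 \<Longrightarrow> a \<in> S \<Longrightarrow> b \<in> S \<Longrightarrow> mix l a b \<in> S"
    and f: "\<And>l a b. 0 \<le> l \<Longrightarrow> l \<le> 1 \<Longrightarrow> a \<in> S \<Longrightarrow> b \<in> S \<Longrightarrow> f (mix l a b) = l * f a + (1 - l) * f b"
    and g: "\<And>l a b. 0 \<le> l \<Longrightarrow> l \<le> 1 \<Longrightarrow> a \<in> S \<Longrightarrow> b \<in> S \<Longrightarrow> g (mix l a b) = l * g a + (1 - l) * g b"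
    and no: "\<And>a. a \<in> S \<Longrightarrow> f a > 0 \<Longrightarrow> g a \<le> 0"
  shows "\<exists>l. 0 \<le> l \<and> l \<le> 1 \<and> (\<forall>a\<in>S. l * f a + (1 - l) * g a \<le> 0)"
proof (cases "\<forall>a\<in>S. f a \<le> 0")
  case True then show ?thesis by (intro exI[of _ 1]) auto
next
  case False
  then obtain a0 where a0: "a0 \<in> S" "f a0 > 0" by force
  have zero: "g b \<le> 0" if b: "b \<in> S" "f b = 0" for b
  proof (rule ccontr)
    assume "\<not> ?thesis"
    then have gb: "g b > 0" by simp
    \<comment> \<open>A short move from \<open>b\<close> towards \<open>a0\<close> makes
      \<open>f\<close> positive; this length costs \<open>g\<close> at most half of
      \<open>g b\<close>, so \<open>g\<close> would stay positive.\<close>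
    define l where "l = g b / (2 * (\<bar>g a0\<bar> + g b))"
    have l: "0 < l" "l \<le> 1" "l * (\<bar>g a0\<bar> + g b) = g b / 2"
      unfolding l_def using gb by (auto simp: field_simps)
    have "f (mix l a0 b) > 0" using f[of l a0 b] l a0 b by simp
    then have "g (mix l a0 b) \<le> 0" using no mix[of l a0 b] l a0 b by simp
    moreover have "g (mix l a0 b) = l * g a0 + (1 - l) * g b" using g[of l a0 b] l a0 b by simp
    moreover have "l * g a0 \<ge> - (l * \<bar>g a0\<bar>)" using l mult_left_mono[of "- \<bar>g a0\<bar>" "g a0" l] by simp
    ultimately show False using l(3) gb by (simp add: algebra_simps)
  qed
  have cross: "(- f b) * g a + f a * g b \<le> 0" if ab: "a \<in> S" "b \<in> S" "f a > 0" "f b < 0" for a b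
  proof -
    \<comment> \<open>The point of the segment at which \<open>f\<close> vanishes, where
      \<open>zero\<close> applies.\<close>
    define l where "l = - f b / (f a - f b)"
    have l: "0 \<le> l" "l \<le> 1" using ab by (auto simp: l_def field_simps)
    have lf: "l * (f a - f b) = - f b" using ab by (simp add: l_def)
    have "f (mix l a b) = 0" using f[OF l ab(1,2)] lf by (simp add: algebra_simps)
    then have "g (mix l a b) \<le> 0" by (intro zero mix l ab)
    then have "l * g a + (1 - l) * g b \<le> 0" by (simp add: g[OF l ab(1,2)])
    then have "(l * g a + (1 - l) * g b) * (f a - f b) \<le> 0" using ab by (simp add: mult_le_0_iff)
    also have "(l * g a + (1 - l) * g b) * (f a - f b) = (l * (f a - f b)) * g a + ((f a - f b) - l * (f a - f b)) * g b"
      by (simp add: algebra_simps)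
    finally show ?thesis unfolding lf by simp
  qed
  \<comment> \<open>A slope \<open>m\<close> works if it lies above all \<open>g b / (- f b)\<close>
    with \<open>f b < 0\<close> and below all \<open>- g a / f a\<close> with
    \<open>f a > 0\<close>; \<open>cross\<close> makes these demands compatible. The inserted
    \<open>0\<close> keeps \<open>R\<close> nonempty and forces \<open>m\<close> to be
    nonnegative.\<close>
  define R where "R = insert 0 ((\<lambda>b. g b / (- f b)) ` {b\<in>S. f b < 0})"
  define m where "m = Sup R"
  have ub: "r \<le> - g a / f a" if "r \<in> R" "a \<in> S" "f a > 0" for r a
    using that no[of a] cross[of a] by (auto simp: R_def field_simps)
  have bdd: "bdd_above R" using ub[OF _ a0] by (meson bdd_aboveI)
  have m0: "0 \<le> m" unfolding m_def using bdd by (intro cSup_upper) (auto simp: R_def)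
  have "m * f a + g a \<le> 0" if a: "a \<in> S" for a
  proof -
    consider "f a > 0" | "f a = 0" | "f a < 0" by linarith
    then show ?thesis
    proof cases
      case 1
      have "m \<le> - g a / f a" unfolding m_def by (rule cSup_least) (use ub[OF _ a 1] in \<open>auto simp: R_def\<close>)
      then show ?thesis using 1 by (simp add: field_simps)
    next
      case 2 then show ?thesis using zero[OF a] by simp
    next
      case 3
      have "g a / (- f a) \<le> m" unfolding m_def using bdd by (intro cSup_upper) (use a 3 in \<open>auto simp: R_def\<close>)
      then show ?thesis using 3 by (simp add: field_simps)
    qed
  qed
  then have "m / (1 + m) * f a + (1 - m / (1 + m)) * g a \<le> 0" if "a \<in> S" for a
  proof -
    have "1 - m / (1 + m) = 1 / (1 + m)" using m0 by (simp add: field_simps)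
    then have "m / (1 + m) * f a + (1 - m / (1 + m)) * g a = (m * f a + g a) / (1 + m)"
      by (simp add: add_divide_distrib)
    then show ?thesis using \<open>\<And>a. a \<in> S \<Longrightarrow> m * f a + g a \<le> 0\<close>[OF that] m0
      by (simp add: divide_le_0_iff)
  qed
  then show ?thesis using m0 by (intro exI[of _ "m / (1 + m)"]) auto
qed

text \<open>Induction on the functions: on the part of \<open>S\<close> where \<open>f j\<close> is
  positive the others already satisfy the hypothesis and merge into one weighted sum, which leaves
  the planar case.\<close>

lemma minimax_finite:
  fixes f :: "'i \<Rightarrow> 'v \<Rightarrow> real"
  assumes "finite I" "I \<noteq> {}"
    and "\<And>l a b. 0 \<le> l \<Longrightarrow> l \<le> 1 \<Longrightarrow> a \<in> S \<Longrightarrow> b \<in> S \<Longrightarrow> mix l a b \<in> S"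
    and "\<And>i l a b. i \<in> I \<Longrightarrow> 0 \<le> l \<Longrightarrow> l \<le> 1 \<Longrightarrow> a \<in> S \<Longrightarrow> b \<in> S \<Longrightarrow>
      f i (mix l a b) = l * f i a + (1 - l) * f i b"
    and "\<And>a. a \<in> S \<Longrightarrow> \<exists>i\<in>I. f i a \<le> 0"
  shows "\<exists>w. (\<forall>i\<in>I. 0 \<le> w i) \<and> (\<Sum>i\<in>I. w i) = 1 \<and> (\<forall>a\<in>S. (\<Sum>i\<in>I. w i * f i a) \<le> 0)"
  using assms
proof (induction I arbitrary: S rule: finite_ne_induct)
  case (singleton i)
  then show ?case by (intro exI[of _ "\<lambda>_. 1"]) auto
next
  case (insert j I)
  define S' where "S' = {a\<in>S. f j a > 0}"
  have "\<exists>w. (\<forall>i\<in>I. 0 \<le> w i) \<and> (\<Sum>i\<in>I. w i) = 1 \<and> (\<forall>a\<in>S'. (\<Sum>i\<in>I. w i * f i a) \<le> 0)"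
  proof (rule insert.IH)
    fix l :: real and a b assume l: "0 \<le> l" "l \<le> 1" and ab: "a \<in> S'" "b \<in> S'"
    have "0 < l * f j a + (1 - l) * f j b"
    proof (cases "l = 0")
      case False
      then show ?thesis using l ab by (intro add_pos_nonneg) (auto simp: S'_def)
    qed (use ab in \<open>auto simp: S'_def\<close>)
    then show "mix l a b \<in> S'" using l ab insert.prems(1,2) by (auto simp: S'_def)
    show "f i (mix l a b) = l * f i a + (1 - l) * f i b" if "i \<in> I" for i
      using that l ab insert.prems(2) by (auto simp: S'_def)
  next
    fix a assume "a \<in> S'"
    then show "\<exists>i\<in>I. f i a \<le> 0" using insert.prems(3)[of a] by (auto simp: S'_def)
  qed
  then obtain w where w: "\<And>i. i \<in> I \<Longrightarrow> 0 \<le> w i" "(\<Sum>i\<in>I. w i) = 1"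
    "\<And>a. a \<in> S' \<Longrightarrow> (\<Sum>i\<in>I. w i * f i a) \<le> 0" by auto
  define g where "g a = (\<Sum>i\<in>I. w i * f i a)" for a
  have "\<exists>l. 0 \<le> l \<and> l \<le> 1 \<and> (\<forall>a\<in>S. l * f j a + (1 - l) * g a \<le> 0)"
  proof (rule minimax_two[where mix = mix])
    fix l :: real and a b assume l: "0 \<le> l" "l \<le> 1" and ab: "a \<in> S" "b \<in> S"
    show "mix l a b \<in> S" using l ab insert.prems(1) by blast
    show "f j (mix l a b) = l * f j a + (1 - l) * f j b" using l ab insert.prems(2) by blast
    have "g (mix l a b) = (\<Sum>i\<in>I. w i * (l * f i a + (1 - l) * f i b))"
      unfolding g_def using l ab insert.prems(2) by (intro sum.cong) auto
    then show "g (mix l a b) = l * g a + (1 - l) * g b"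
      by (simp add: g_def sum_distrib_left sum.distrib[symmetric] algebra_simps)
  next
    fix a assume "a \<in> S" "f j a > 0"
    then show "g a \<le> 0" using w(3)[of a] by (simp add: S'_def g_def)
  qed
  then obtain l where l: "0 \<le> l" "l \<le> 1" "\<And>a. a \<in> S \<Longrightarrow> l * f j a + (1 - l) * g a \<le> 0" by blast
  define v where "v i = (if i = j then l else (1 - l) * w i)" for i
  have vI: "(\<Sum>i\<in>I. v i * h i) = (1 - l) * (\<Sum>i\<in>I. w i * h i)" for h :: "'i \<Rightarrow> real"
    unfolding sum_distrib_left using insert.hyps by (intro sum.cong) (auto simp: v_def)
  have "(\<Sum>i\<in>insert j I. v i) = 1"
    using vI[of "\<lambda>_. 1"] w(2) insert.hyps by (simp add: v_def)
  moreover have "(\<Sum>i\<in>insert j I. v i * f i a) \<le> 0" if "a \<in> S" for a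
    using vI[of "\<lambda>i. f i a"] l(3)[OF that] insert.hyps by (simp add: v_def g_def)
  moreover have "0 \<le> v i" if "i \<in> insert j I" for i using that l w(1) by (auto simp: v_def)
  ultimately show ?case by blast
qed

section \<open>Convergent selections from decreasing convex sets in the unit ball\<close>

context von_neumann
begin

definition unit_ball :: "('g \<Rightarrow> 'g) set" where
  "unit_ball = {b\<in>M. \<forall>x. norm (b x) \<le> norm x}"

lemma unit_ballD: "b \<in> unit_ball \<Longrightarrow> b \<in> M" "b \<in> unit_ball \<Longrightarrow> norm (b x) \<le> norm x"
  by (auto simp: unit_ball_def)

lemma unit_ball_mix:
  assumes "0 \<le> l" "l \<le> 1" "a \<in> unit_ball" "b \<in> unit_ball"
  shows "(\<lambda>x. scaleR l (a x) + scaleR (1 - l) (b x)) \<in> unit_ball"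
proof -
  have "norm (scaleR l (a x) + scaleR (1 - l) (b x)) \<le> norm x" for x
  proof -
    have "norm (scaleR l (a x) + scaleR (1 - l) (b x)) \<le> l * norm (a x) + (1 - l) * norm (b x)"
      using norm_triangle_ineq[of "scaleR l (a x)" "scaleR (1 - l) (b x)"] assms(1,2) by simp
    also have "\<dots> \<le> l * norm x + (1 - l) * norm x"
      using assms unit_ballD by (intro add_mono mult_left_mono) auto
    finally show ?thesis by (simp add: algebra_simps)
  qed
  moreover have "(\<lambda>x. scaleR l (a x) + scaleR (1 - l) (b x)) \<in> M"
    by (intro M_add M_scaleR unit_ballD(1) assms)
  ultimately show ?thesis by (simp add: unit_ball_def)
qed

text \<open>Near-minimisers of the weighted quadratic form \<open>\<Sum>\<^sub>j w\<^sub>j \<parallel>c x\<^sub>j\<parallel>\<^sup>2\<close> are close to each other by the parallelogram law.\<close>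

lemma shrinking_convex_selection:
  fixes x :: "nat \<Rightarrow> 'g" and S :: "nat \<Rightarrow> ('g \<Rightarrow> 'g) set"
  assumes S: "\<And>n. S n \<subseteq> unit_ball" "\<And>n. S n \<noteq> {}" "\<And>m n. n \<le> m \<Longrightarrow> S m \<subseteq> S n"
    and mid: "\<And>n a b. a \<in> S n \<Longrightarrow> b \<in> S n \<Longrightarrow> (\<lambda>x. scaleR (1/2) (a x) + scaleR (1 - 1/2) (b x)) \<in> S n"
  shows "\<exists>c K. (\<forall>n. c n \<in> S n) \<and>
    (\<forall>j m n. n \<le> m \<longrightarrow> norm (c m (x j) - c n (x j)) \<le> K j * (1/2) ^ n)"
proof -
  define w where "w j = (1/2) ^ j / (1 + (norm (x j))\<^sup>2)" for j
  have den: "1 + (norm (x j))\<^sup>2 > 0" for j by (smt (verit) zero_le_power2)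
  have w0: "w j > 0" for j unfolding w_def using den by simp
  define Q where "Q h = (\<Sum>j. w j * (norm (h (x j)))\<^sup>2)" for h :: "'g \<Rightarrow> 'g"
  have summand: "w j * (norm (h (x j)))\<^sup>2 \<le> 4 * (1/2) ^ j" if h: "\<And>y. norm (h y) \<le> 2 * norm y" for h j
  proof -
    have "(norm (h (x j)))\<^sup>2 \<le> (2 * norm (x j))\<^sup>2" using h by (intro power_mono) auto
    also have "\<dots> \<le> 4 * (1 + (norm (x j))\<^sup>2)" by (simp add: power_mult_distrib)
    finally have "w j * (norm (h (x j)))\<^sup>2 \<le> w j * (4 * (1 + (norm (x j))\<^sup>2))"
      using w0[of j] by (intro mult_left_mono) auto
    also have "\<dots> = 4 * (w j * (1 + (norm (x j))\<^sup>2))" by (simp only: mult.left_commute)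
    also have "w j * (1 + (norm (x j))\<^sup>2) = (1/2) ^ j" unfolding w_def using den[of j] by simp
    finally show ?thesis .
  qed
  have geo: "summable (\<lambda>j. 4 * (1/2) ^ j :: real)" by (intro summable_mult summable_geometric) simp
  have sm: "summable (\<lambda>j. w j * (norm (h (x j)))\<^sup>2)" if h: "\<And>y. norm (h y) \<le> 2 * norm y" for h
    using summand[OF h] w0 by (intro summable_comparison_test'[OF geo, of 0]) (auto simp: less_imp_le)
  have Q0: "0 \<le> Q h" if h: "\<And>y. norm (h y) \<le> 2 * norm y" for h
    unfolding Q_def using sm[OF h] w0 by (intro suminf_nonneg) (auto simp: less_imp_le)
  have Qub: "Q h \<le> 8" if h: "\<And>y. norm (h y) \<le> 2 * norm y" for h
  proof -
    have "Q h \<le> (\<Sum>j. 4 * (1/2) ^ j)" unfolding Q_def by (intro suminf_le summand h sm geo)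
    also have "\<dots> = 8" by (subst suminf_mult) (auto simp: suminf_geometric)
    finally show ?thesis .
  qed
  have ball2: "norm (h y) \<le> 2 * norm y" if "h \<in> unit_ball" for h y
    using unit_ballD(2)[OF that, of y] by (smt (verit) norm_ge_zero)
  have par: "Q (\<lambda>y. a y - b y) = 2 * Q a + 2 * Q b - 4 * Q (\<lambda>y. scaleR (1/2) (a y) + scaleR (1 - 1/2) (b y))"
    if ab: "a \<in> unit_ball" "b \<in> unit_ball" for a b
  proof -
    let ?m = "\<lambda>y. scaleR (1/2) (a y) + scaleR (1 - 1/2) (b y)"
    have "norm (?m y) \<le> 2 * norm y" for y
      using ball2[OF unit_ball_mix[of "1/2" a b]] ab by simp
    note s = sm[OF ball2[OF ab(1)]] sm[OF ball2[OF ab(2)]] sm[of ?m, OF this]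
    have "w j * (norm (a (x j) - b (x j)))\<^sup>2 = 2 * (w j * (norm (a (x j)))\<^sup>2) + 2 * (w j * (norm (b (x j)))\<^sup>2)
       - 4 * (w j * (norm (?m (x j)))\<^sup>2)" for j
    proof -
      have "?m (x j) = scaleR (1/2) (a (x j) + b (x j))" by (simp add: scaleR_add_right)
      then have "(norm (?m (x j)))\<^sup>2 = (norm (a (x j) + b (x j)))\<^sup>2 / 4"
        by (simp only: norm_scaleR) (simp add: power_divide)
      moreover have "(norm (a (x j) - b (x j)))\<^sup>2 = 2 * (norm (a (x j)))\<^sup>2 + 2 * (norm (b (x j)))\<^sup>2
          - (norm (a (x j) + b (x j)))\<^sup>2" using parallelogram[of "a (x j)" "b (x j)"] by simp
      ultimately show ?thesis by (simp only: ring_distribs)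
    qed
    then have "Q (\<lambda>y. a y - b y) = (\<Sum>j. 2 * (w j * (norm (a (x j)))\<^sup>2) + 2 * (w j * (norm (b (x j)))\<^sup>2)
       - 4 * (w j * (norm (?m (x j)))\<^sup>2))" unfolding Q_def by simp
    also have "\<dots> = 2 * Q a + 2 * Q b - 4 * Q ?m"
      unfolding Q_def using s
      by (subst suminf_diff[symmetric] suminf_add[symmetric] suminf_mult[symmetric] |
          intro summable_add summable_mult summable_diff | assumption | simp only:)+
    finally show ?thesis .
  qed
  define \<alpha> where "\<alpha> n = Inf (Q ` S n)" for n
  have bddS: "bdd_below (Q ` S n)" for n
    by (rule bdd_belowI2[of _ 0]) (use Q0 ball2 S(1) in blast)
  have \<alpha>_le: "\<alpha> n \<le> Q h" if "h \<in> S n" for n h unfolding \<alpha>_def using bddS that by (rule cINF_lower)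
  have \<alpha>_mono: "\<alpha> n \<le> \<alpha> m" if "n \<le> m" for m n
    unfolding \<alpha>_def using S(2,3) that bddS by (intro cInf_superset_mono image_mono) auto
  have \<alpha>_ub: "\<alpha> n \<le> 8" for n
  proof -
    obtain h where "h \<in> S n" using S(2) by blast
    then show ?thesis using \<alpha>_le[of h n] Qub[of h] ball2 S(1) by (meson order_trans subsetD)
  qed
  define A where "A = (SUP n. \<alpha> n)"
  have bddA: "bdd_above (range \<alpha>)" using \<alpha>_ub by (intro bdd_aboveI2) auto
  have \<alpha>A: "\<alpha> n \<le> A" for n unfolding A_def using bddA by (intro cSUP_upper) auto
  \<comment> \<open>The precision is \<open>(1/4)^i\<close> because \<open>Q\<close> measures
    squares; its root is the rate \<open>(1/2)^n\<close> of the conclusion.\<close>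
  have "\<exists>h m. m \<ge> i \<and> h \<in> S m \<and> A - (1/4) ^ i < \<alpha> m \<and> Q h < \<alpha> m + (1/4) ^ i" for i :: nat
  proof -
    have "A - (1/4) ^ i < A" by simp
    then obtain m0 where m0: "A - (1/4) ^ i < \<alpha> m0" unfolding A_def using bddA by (subst (asm) less_cSUP_iff) auto
    define m where "m = max i m0"
    have "A - (1/4) ^ i < \<alpha> m" using m0 \<alpha>_mono[of m0 m] by (simp add: m_def)
    moreover have "\<alpha> m < \<alpha> m + (1/4) ^ i" by simp
    then obtain h where "h \<in> S m" "Q h < \<alpha> m + (1/4) ^ i"
      unfolding \<alpha>_def using S(2) bddS by (subst (asm) cINF_less_iff) auto
    ultimately show ?thesis by (intro exI[of _ h] exI[of _ m]) (auto simp: m_def)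
  qed
  then obtain c \<mu> where c: "\<And>i. \<mu> i \<ge> i" "\<And>i. c i \<in> S (\<mu> i)" "\<And>i. A - (1/4) ^ i < \<alpha> (\<mu> i)"
    "\<And>i::nat. Q (c i) < \<alpha> (\<mu> i) + (1/4) ^ i" by metis
  have cball: "c i \<in> unit_ball" for i using c(2) S(1) by blast
  have cS: "c i \<in> S i" for i using c(1,2) S(3) by blast
  define K where "K j = sqrt (8 / w j)" for j
  have "norm (c m (x j) - c n (x j)) \<le> K j * (1/2) ^ n" if nm: "n \<le> m" for j m n
  proof -
    have dec: "(1/4 :: real) ^ m \<le> (1/4) ^ n" using nm by (intro power_decreasing) auto
    let ?h = "\<lambda>y. scaleR (1/2) (c m y) + scaleR (1 - 1/2) (c n y)"
    \<comment> \<open>The indices \<open>\<mu>\<close> need not increase, so the two operators and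
      their midpoint are placed in the larger of the two sets.\<close>
    let ?p = "min (\<mu> n) (\<mu> m)"
    have "c m \<in> S ?p" "c n \<in> S ?p"
      using c(2)[of n] c(2)[of m] S(3)[of ?p "\<mu> n"] S(3)[of ?p "\<mu> m"] by auto
    then have "?h \<in> S ?p" by (rule mid)
    then have "\<alpha> ?p \<le> Q ?h" by (rule \<alpha>_le)
    moreover have "A - (1/4) ^ n < \<alpha> ?p" using c(3)[of n] c(3)[of m] dec by (smt (verit) min_def)
    moreover have "Q (\<lambda>y. c m y - c n y) = 2 * Q (c m) + 2 * Q (c n) - 4 * Q ?h" by (rule par[OF cball cball])
    ultimately have Qd: "Q (\<lambda>y. c m y - c n y) \<le> 8 * (1/4) ^ n"
      using c(4)[of n] c(4)[of m] \<alpha>A[of "\<mu> n"] \<alpha>A[of "\<mu> m"] dec by linarith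
    have "norm (c m y - c n y) \<le> 2 * norm y" for y
      using norm_triangle_ineq4[of "c m y" "c n y"] unit_ballD(2)[OF cball, of m y] unit_ballD(2)[OF cball, of n y] by linarith
    note s = sm[of "\<lambda>y. c m y - c n y", OF this]
    have "w j * (norm (c m (x j) - c n (x j)))\<^sup>2 \<le> Q (\<lambda>y. c m y - c n y)"
      unfolding Q_def using sum_le_suminf[OF s, of "{j}"] w0 by (auto simp: less_imp_le)
    also note Qd
    finally have "(norm (c m (x j) - c n (x j)))\<^sup>2 \<le> 8 / w j * (1/4) ^ n"
      using w0[of j] by (simp add: field_simps)
    also have "\<dots> = (K j)\<^sup>2 * ((1/2)\<^sup>2) ^ n"
      using w0[of j] by (simp add: K_def power2_eq_square)
    also have "\<dots> = (K j * (1/2) ^ n)\<^sup>2"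
      by (simp only: power_mult_distrib power_mult[symmetric] mult.commute[of n])
    finally show ?thesis
    proof (rule power2_le_imp_le)
      have "0 \<le> K j" using w0[of j] by (simp add: K_def)
      then show "0 \<le> K j * (1/2) ^ n" by simp
    qed
  qed
  with cS show ?thesis by blast
qed

end

subsection \<open>Norm continuity of orbits of vector functionals\<close>

context E0
begin

text \<open>The sequence converges strongly only on the closed span of the commutant orbits of the
  \<open>x j\<close>. Cutting down by the support projection gives a limit in \<open>M\<close>, and
  the projection disappears again at \<open>k\<close> because its image under
  \<open>\<theta> s\<close> fixes \<open>k\<close>. The geometric rate makes the squared errors
  summable, as \<open>normal_null_sequence\<close> requires.\<close>

lemma normal_limit:
  fixes x :: "nat \<Rightarrow> 'g"
  assumes supp: "\<And>s. s \<ge> 0 \<Longrightarrow> \<theta> s (support_proj (range x)) k = k"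
    and c: "\<And>n. c n \<in> unit_ball"
    and fast: "\<And>j m n. n \<le> m \<Longrightarrow> norm (c m (x j) - c n (x j)) \<le> K j * (1/2) ^ n"
  shows "\<exists>d\<in>M. \<forall>s\<ge>0. (\<lambda>n. \<theta> s (c n) k) \<longlonglongrightarrow> \<theta> s d k"
proof -
  let ?p = "support_proj (range x)"
  note cM = unit_ballD(1)[OF c] and cb = unit_ballD(2)[OF c]
  note clin = M_lin[OF cM]
  have half: "(\<lambda>n. K' * (1/2) ^ n :: real) \<longlonglongrightarrow> 0" for K'
    by (intro tendsto_mult_right_zero LIMSEQ_power_zero) simp
  have conv_x: "convergent (\<lambda>n. c n (x j))" for j
    by (intro Cauchy_convergent Cauchy_if_geometric_bound[OF fast half])
  let ?Gen = "{T v | T v. T \<in> commutant M \<and> v \<in> range x}"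
  have conv_span: "convergent (\<lambda>n. c n v)" if "v \<in> span ?Gen" for v
    using that
  proof (induction rule: span_induct_alt)
    case base show ?case by (simp add: clin convergent_const)
  next
    case (step r v u)
    then obtain T j where T: "v = T (x j)" "T \<in> commutant M" by blast
    obtain l where "(\<lambda>n. c n (x j)) \<longlonglongrightarrow> l" using conv_x convergent_def by blast
    then have "(\<lambda>n. T (c n (x j))) \<longlonglongrightarrow> T l" by (rule bounded_clinear_tendsto[OF commutantD(1)[OF T(2)]])
    then have v: "(\<lambda>n. c n v) \<longlonglongrightarrow> T l" unfolding T(1) commutantD(2)[OF T(2) cM] .
    obtain l' where "(\<lambda>n. c n u) \<longlonglongrightarrow> l'" using step(2) convergent_def by blast
    with v have "(\<lambda>n. scaleR r (c n v) + c n u) \<longlonglongrightarrow> scaleR r (T l) + l'" by (intro tendsto_intros)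
    then show ?case by (simp add: clin) (rule convergentI)
  qed
  have conv: "convergent (\<lambda>n. c n v)" if v: "v \<in> orbit_span (commutant M) (range x)" for v
  proof (intro Cauchy_convergent CauchyI)
    fix e :: real assume "e > 0"
    obtain u where u: "u \<in> span ?Gen" "dist u v < e / 4"
      using iffD1[OF closure_approachable v[unfolded orbit_span_def], rule_format, of "e / 4"] \<open>e > 0\<close> by auto
    have "Cauchy (\<lambda>n. c n u)" by (rule convergent_Cauchy[OF conv_span[OF u(1)]])
    then obtain N where N: "\<And>m n. m \<ge> N \<Longrightarrow> n \<ge> N \<Longrightarrow> norm (c m u - c n u) < e / 2"
      using CauchyD[of "\<lambda>n. c n u" "e / 2"] \<open>e > 0\<close> by auto
    have "norm (c m v - c n v) < e" if mn: "m \<ge> N" "n \<ge> N" for m n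
    proof -
      have "norm (c i v - c i u) < e / 4" for i
        using cb[of i "v - u"] u(2) by (simp add: clin dist_norm norm_minus_commute)
      from this[of m] this[of n] show ?thesis
        using N[OF mn] norm_triangle_ineq4[of "c m v - c m u" "c n v - c n u"]
          norm_triangle_ineq[of "(c m v - c m u) - (c n v - c n u)" "c m u - c n u"] by simp
    qed
    then show "\<exists>N. \<forall>m\<ge>N. \<forall>n\<ge>N. norm (c m v - c n v) < e" by blast
  qed
  have pM: "?p \<in> M" by (rule support_proj_M)
  note plin = M_lin[OF pM]
  define d where "d v = lim (\<lambda>n. c n (?p v))" for v
  have d: "(\<lambda>n. c n (?p v)) \<longlonglongrightarrow> d v" for v
    unfolding d_def convergent_LIMSEQ_iff[symmetric]
    by (rule conv[OF orbit_proj_mem[OF star_monoid_commutant]])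
  have pb: "norm (c n (?p v)) \<le> norm v" for n v
    using cb[of n "?p v"] orbit_proj_norm_le[OF star_monoid_commutant, of "range x" v] by linarith
  have db: "norm (d v) \<le> norm v" for v
    by (rule LIMSEQ_le_const2[OF tendsto_norm[OF d]]) (use pb in blast)
  have "bounded_clinear d"
  proof (rule bounded_clinearI[of _ 1])
    fix u v r
    have "(\<lambda>n. c n (?p u) + c n (?p v)) \<longlonglongrightarrow> d u + d v" by (intro tendsto_intros d)
    then show "d (u + v) = d u + d v" using d[of "u + v"] LIMSEQ_unique by (simp add: clin plin) blast
    have "(\<lambda>n. scaleC r (c n (?p u))) \<longlonglongrightarrow> scaleC r (d u)" by (intro tendsto_intros d)
    then show "d (scaleC r u) = scaleC r (d u)"
      using d[of "scaleC r u"] LIMSEQ_unique by (simp add: clin plin) blast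
  qed (simp add: db)
  then have dM: "d \<in> M"
    by (rule M_limit[of _ "\<lambda>n. c n \<circ> ?p"]) (use d M_compose cM pM in auto)
  define e where "e n = (\<lambda>v. (c n \<circ> ?p) v - d v)" for n
  have eM: "e n \<in> M" for n unfolding e_def by (intro M_diff M_compose cM pM dM)
  have eb: "norm (e n v) \<le> 2 * norm v" for n v
    unfolding e_def comp_def using norm_triangle_ineq4[of "c n (?p v)" "d v"] pb[of n v] db[of v] by linarith
  have ex: "norm (e n (x j)) \<le> K j * (1/2) ^ n" for n j
  proof -
    have px: "?p (x j) = x j"
      using orbit_proj_fix[OF star_monoid_commutant] orbit_span_incl[OF star_monoid_commutant, of "range x"] by blast
    have lim: "(\<lambda>m. c m (x j)) \<longlonglongrightarrow> d (x j)" using d[of "x j"] unfolding px .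
    have "(\<lambda>m. norm (c n (x j) - c m (x j))) \<longlonglongrightarrow> norm (c n (x j) - d (x j))"
      by (intro tendsto_intros lim)
    then have "norm (c n (x j) - d (x j)) \<le> K j * (1/2) ^ n"
    proof (rule LIMSEQ_le_const2)
      show "\<exists>N. \<forall>m\<ge>N. norm (c n (x j) - c m (x j)) \<le> K j * (1/2) ^ n"
        by (intro exI[of _ n] allI impI) (subst norm_minus_commute, erule fast)
    qed
    then show ?thesis by (simp add: e_def px)
  qed
  have "(\<lambda>n. \<theta> s (c n) k) \<longlonglongrightarrow> \<theta> s d k" if s: "s \<ge> 0" for s
  proof -
    interpret star_endo M "\<theta> s" using s by (rule theta_endo)
    have "(\<lambda>n. \<theta> s (e n) k) \<longlonglongrightarrow> 0"
    proof (rule normal_null_sequence[OF s supp[OF s] eM _ eb])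
      fix v assume "v \<in> range x"
      then obtain j where j: "v = x j" by blast
      have bd: "norm ((norm (e n v))\<^sup>2) \<le> (K j)\<^sup>2 * (1/4) ^ n" for n
      proof -
        have "(norm (e n v))\<^sup>2 \<le> (K j * (1/2) ^ n)\<^sup>2" unfolding j by (intro power_mono ex) simp
        also have "\<dots> = (K j)\<^sup>2 * ((1/2)\<^sup>2) ^ n"
          by (simp add: power_mult_distrib power_mult[symmetric] mult.commute)
        finally show ?thesis by (simp add: power2_eq_square)
      qed
      show "summable (\<lambda>n. (norm (e n v))\<^sup>2)"
        by (rule summable_comparison_test'[of "\<lambda>n. (K j)\<^sup>2 * (1/4) ^ n" 0])
           (use bd in \<open>auto intro!: summable_mult summable_geometric\<close>)
    qed simp
    moreover have "\<theta> s (e n) k = \<theta> s (c n) k - \<theta> s d k" for n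
      unfolding e_def endo_diff[OF M_compose[OF cM pM] dM] endo_compose[OF cM pM] by (simp add: supp[OF s])
    ultimately have "(\<lambda>n. \<theta> s (c n) k - \<theta> s d k) \<longlonglongrightarrow> 0" by simp
    then show ?thesis by (simp add: LIM_zero_iff)
  qed
  with dM show ?thesis by blast
qed

section \<open>Averages along orbits and norm continuity\<close>

definition orbit_avg :: "'g \<Rightarrow> real \<Rightarrow> ('g \<Rightarrow> 'g) \<Rightarrow> real" where
  "orbit_avg k h b = integral {0..h} (\<lambda>s. rinner k (\<theta> s b k)) / h"

lemma orbit_cont:
  assumes "b \<in> M" "0 \<le> u" shows "continuous_on {u..v} (\<lambda>s. rinner k (\<theta> s b k))"
  by (intro continuous_intros continuous_on_subset[OF theta_cont[OF assms(1)]]) (use assms(2) in auto)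

lemma orbit_integrable:
  assumes "b \<in> M" "0 \<le> u" shows "(\<lambda>s. rinner k (\<theta> s b k)) integrable_on {u..v}"
  by (rule integrable_continuous_interval[OF orbit_cont[OF assms]])

lemma theta_unit_ball: "s \<ge> 0 \<Longrightarrow> b \<in> unit_ball \<Longrightarrow> \<theta> s b \<in> unit_ball"
  using theta_norm_le[of s b 1] theta_in[of s b] by (simp add: unit_ball_def)

lemma orbit_bound:
  assumes "b \<in> unit_ball" "s \<ge> 0" shows "\<bar>rinner k (\<theta> s b k)\<bar> \<le> (norm k)\<^sup>2"
  using abs_rinner_le[of k "\<theta> s b k"]
    mult_left_mono[OF unit_ballD(2)[OF theta_unit_ball[OF assms(2,1)], of k] norm_ge_zero[of k]]
  by (simp add: power2_eq_square)

lemma orbit_avg_mix: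
  assumes "a \<in> M" "b \<in> M" "h \<ge> 0"
  shows "orbit_avg k h (\<lambda>x. scaleR l (a x) + scaleR m (b x)) = l * orbit_avg k h a + m * orbit_avg k h b"
proof -
  have "integral {0..h} (\<lambda>s. rinner k (\<theta> s (\<lambda>x. scaleR l (a x) + scaleR m (b x)) k)) =
    integral {0..h} (\<lambda>s. l * rinner k (\<theta> s a k) + m * rinner k (\<theta> s b k))"
  proof (rule integral_cong)
    fix s assume "s \<in> {0..h}"
    then interpret star_endo M "\<theta> s" by (intro theta_endo) auto
    show "rinner k (\<theta> s (\<lambda>x. scaleR l (a x) + scaleR m (b x)) k) =
      l * rinner k (\<theta> s a k) + m * rinner k (\<theta> s b k)"
      by (simp add: endo_add[OF M_scaleR[OF assms(1)] M_scaleR[OF assms(2)]]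
          endo_scaleR[OF assms(1)] endo_scaleR[OF assms(2)] cinner_add_right)
  qed
  also have "\<dots> = l * integral {0..h} (\<lambda>s. rinner k (\<theta> s a k)) + m * integral {0..h} (\<lambda>s. rinner k (\<theta> s b k))"
    using orbit_integrable[OF assms(1), of 0 k h] orbit_integrable[OF assms(2), of 0 k h]
    by (subst integral_add) (auto intro: integrable_on_mult_right)
  finally show ?thesis by (simp add: orbit_avg_def add_divide_distrib)
qed

text \<open>The windows \<open>{0..h}\<close> and \<open>{t..h+t}\<close> differ by two pieces of
  length \<open>t\<close>. Comparing both with \<open>{0..h+t}\<close> avoids distinguishing whether
  they overlap.\<close>

lemma orbit_avg_shift:
  assumes b: "b \<in> unit_ball" and h: "h > 0" and t: "t \<ge> 0"
  shows "\<bar>orbit_avg k h (\<theta> t b) - orbit_avg k h b\<bar> \<le> 2 * t * (norm k)\<^sup>2 / h"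
proof -
  let ?f = "\<lambda>s. rinner k (\<theta> s b k)"
  note bM = unit_ballD(1)[OF b]
  have "integral {0..h} (\<lambda>s. rinner k (\<theta> s (\<theta> t b) k)) = integral {0..h} (?f \<circ> (+) t)"
    by (rule integral_cong) (use t theta_add[OF _ t bM] in \<open>auto simp: add.commute\<close>)
  also have "\<dots> = integral {t..h+t} ?f" by (simp only: integral_shift_Icc_real add_0)
  finally have 1: "integral {0..h} (\<lambda>s. rinner k (\<theta> s (\<theta> t b) k)) = integral {t..h+t} ?f" .
  have 2: "integral {0..t} ?f + integral {t..h+t} ?f = integral {0..h+t} ?f"
    by (rule Henstock_Kurzweil_Integration.integral_combine) (use t h orbit_integrable[OF bM] in auto)
  have 3: "integral {0..h} ?f + integral {h..h+t} ?f = integral {0..h+t} ?f"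
    by (rule Henstock_Kurzweil_Integration.integral_combine) (use t h orbit_integrable[OF bM] in auto)
  have 4: "norm (integral {0..t} ?f) \<le> (norm k)\<^sup>2 * (t - 0)"
    by (rule integral_bound) (use t orbit_cont[OF bM] orbit_bound[OF b] in auto)
  have 5: "norm (integral {h..h+t} ?f) \<le> (norm k)\<^sup>2 * (h + t - h)"
    by (rule integral_bound) (use t h orbit_cont[OF bM] orbit_bound[OF b] in auto)
  have "\<bar>integral {t..h+t} ?f - integral {0..h} ?f\<bar> \<le> 2 * t * (norm k)\<^sup>2"
    using 2 3 4 5 by (simp add: abs_le_iff algebra_simps)
  then have "\<bar>integral {t..h+t} ?f - integral {0..h} ?f\<bar> / h \<le> 2 * t * (norm k)\<^sup>2 / h"
    using h by (intro divide_right_mono) auto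
  then show ?thesis unfolding orbit_avg_def 1 using h by (simp add: diff_divide_distrib[symmetric])
qed

text \<open>Otherwise the minimax theorem yields operators in the unit ball on which all averages up to order \<open>n\<close>
  stay \<open>\<epsilon>\<close> away; a strong limit of such operators contradicts continuity of the semigroup at \<open>0\<close>.\<close>

lemma convex_averages:
  assumes eps: "\<epsilon> > 0"
  obtains n w where "\<And>i. i \<in> {1..n} \<Longrightarrow> 0 \<le> w i" "(\<Sum>i\<in>{1..n::nat}. w i) = (1::real)"
    "\<And>b. b \<in> unit_ball \<Longrightarrow> \<bar>(\<Sum>i\<in>{1..n}. w i * orbit_avg k (1 / i) b) - rinner k (b k)\<bar> \<le> \<epsilon>"
proof -
  define mix where "mix l a b = (\<lambda>x. scaleR l (a x) + scaleR (1 - l) (b x))" for l and a b :: "'g \<Rightarrow> 'g"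
  define f where "f i b = orbit_avg k (1 / real i) b - rinner k (b k) - \<epsilon>" for i and b
  have f_mix: "f i (mix l a b) = l * f i a + (1 - l) * f i b" if "a \<in> M" "b \<in> M" for i l a b
    unfolding f_def mix_def
    using orbit_avg_mix[OF that, of "1 / real i" k l "1 - l"]
    by (simp add: cinner_add_right) (simp add: algebra_simps)
  have "\<exists>n. \<forall>b\<in>unit_ball. \<exists>i\<in>{1..n::nat}. f i b \<le> 0"
  proof (rule ccontr)
    assume "\<not> ?thesis"
    then have ex: "\<exists>b\<in>unit_ball. \<forall>i\<in>{1..n}. f i b > 0" for n by (meson not_le)
    \<comment> \<open>The strict inequalities are relaxed so that they survive strong limits; the
      sets decrease in \<open>n\<close>.\<close>
    define S where "S n = {b\<in>unit_ball. \<forall>i\<in>{1..n::nat}. f i b \<ge> 0}" for n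
    have SM: "S n \<subseteq> unit_ball" for n by (auto simp: S_def)
    have Sne: "S n \<noteq> {}" for n using ex[of n] by (auto simp: S_def intro: less_imp_le)
    have Sdec: "S m \<subseteq> S n" if "n \<le> m" for m n using that by (auto simp: S_def)
    have Smid: "(\<lambda>x. scaleR (1/2) (a x) + scaleR (1 - 1/2) (b x)) \<in> S n" if "a \<in> S n" "b \<in> S n" for n a b
    proof -
      have ab: "a \<in> unit_ball" "b \<in> unit_ball" "\<forall>i\<in>{1..n}. f i a \<ge> 0" "\<forall>i\<in>{1..n}. f i b \<ge> 0"
        using that by (auto simp: S_def)
      have "f i (mix (1/2) a b) \<ge> 0" if "i \<in> {1..n}" for i
        using ab that f_mix[OF unit_ballD(1)[OF ab(1)] unit_ballD(1)[OF ab(2)], of i "1/2"] by simp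
      then show ?thesis using unit_ball_mix[of "1/2" a b] ab by (simp add: S_def mix_def)
    qed
    obtain x :: "nat \<Rightarrow> 'g" where x: "\<And>s. s \<ge> 0 \<Longrightarrow> \<theta> s (support_proj (range x)) k = k"
      using countable_support by blast
    have "\<exists>c K. (\<forall>n. c n \<in> S n) \<and>
      (\<forall>j m n. n \<le> m \<longrightarrow> norm (c m (x j) - c n (x j)) \<le> K j * (1/2) ^ n)"
      by (rule shrinking_convex_selection) (fact SM Sne Sdec Smid)+
    then obtain c K where c: "\<And>n. c n \<in> S n"
      "\<And>j m n. n \<le> m \<Longrightarrow> norm (c m (x j) - c n (x j)) \<le> K j * (1/2) ^ n" by auto
    have cb: "c n \<in> unit_ball" for n using c(1) SM by blast
    have "\<exists>d\<in>M. \<forall>s\<ge>0. (\<lambda>n. \<theta> s (c n) k) \<longlonglongrightarrow> \<theta> s d k"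
      by (rule normal_limit) (fact x cb c(2))+
    then obtain d where d: "d \<in> M" "\<And>s. s \<ge> 0 \<Longrightarrow> (\<lambda>n. \<theta> s (c n) k) \<longlonglongrightarrow> \<theta> s d k" by auto
    \<comment> \<open>Condition \<open>i\<close> binds \<open>c n\<close> from \<open>n = i\<close>
      on, and it passes to the limit because the averages converge by dominated convergence. This
      needs the convergence at every time, not just at time \<open>0\<close>.\<close>
    have fd: "f i d \<ge> 0" if i: "i \<ge> 1" for i :: nat
    proof -
      have "(\<lambda>n. integral {0..1 / real i} (\<lambda>s. rinner k (\<theta> s (c n) k))) \<longlonglongrightarrow>
         integral {0..1 / real i} (\<lambda>s. rinner k (\<theta> s d k))"
      proof (rule dominated_convergence(2))
        show "(\<lambda>s. rinner k (\<theta> s (c n) k)) integrable_on {0..1 / real i}" for n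
          by (rule orbit_integrable[OF unit_ballD(1)[OF cb]]) simp
        show "(\<lambda>s. (norm k)\<^sup>2) integrable_on {0..1 / real i}" by (rule integrable_const_ivl)
        show "norm (rinner k (\<theta> s (c n) k)) \<le> (norm k)\<^sup>2" if "s \<in> {0..1 / real i}" for s n
          using orbit_bound[OF cb, of s k n] that by simp
        show "(\<lambda>n. rinner k (\<theta> s (c n) k)) \<longlonglongrightarrow> rinner k (\<theta> s d k)" if "s \<in> {0..1 / real i}" for s
          using that by (intro tendsto_intros d(2)) auto
      qed
      moreover have "(\<lambda>n. c n k) \<longlonglongrightarrow> d k"
        using d(2)[of 0] by (simp add: theta_0[OF d(1)] theta_0[OF unit_ballD(1)[OF cb]])
      ultimately have "(\<lambda>n. f i (c n)) \<longlonglongrightarrow> f i d"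
        unfolding f_def orbit_avg_def using i by (intro tendsto_intros) auto
      then show ?thesis
      proof (rule LIMSEQ_le_const)
        show "\<exists>N. \<forall>n\<ge>N. 0 \<le> f i (c n)" using c(1) i by (intro exI[of _ i]) (auto simp: S_def)
      qed
    qed
    have "continuous_on {0..} (\<lambda>s. rinner k (\<theta> s d k))" by (intro continuous_intros theta_cont[OF d(1)])
    from this[unfolded continuous_on_iff, rule_format, of 0 "\<epsilon> / 2"] eps
    obtain \<delta> where \<delta>: "\<delta> > 0"
      "\<And>s. s \<ge> 0 \<Longrightarrow> s < \<delta> \<Longrightarrow> \<bar>rinner k (\<theta> s d k) - rinner k (d k)\<bar> < \<epsilon> / 2"
      by (auto simp: dist_real_def theta_0[OF d(1)])
    obtain i :: nat where "i > 0" "inverse (real i) < \<delta>" using \<delta>(1) ex_inverse_of_nat_less by blast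
    then have i: "i \<ge> 1" "1 / real i < \<delta>" by (auto simp: inverse_eq_divide)
    let ?h = "1 / real i"
    \<comment> \<open>By continuity at \<open>0\<close> a short average of \<open>d\<close> exceeds
      its initial value by at most \<open>\<epsilon> / 2\<close>, whereas \<open>fd\<close> demands
      an excess of at least \<open>\<epsilon>\<close>.\<close>
    have "integral {0..?h} (\<lambda>s. rinner k (\<theta> s d k)) \<le> integral {0..?h} (\<lambda>s. rinner k (d k) + \<epsilon> / 2)"
    proof (rule integral_le)
      show "(\<lambda>s. rinner k (\<theta> s d k)) integrable_on {0..?h}" by (rule orbit_integrable[OF d(1)]) simp
      show "(\<lambda>s. rinner k (d k) + \<epsilon> / 2) integrable_on {0..?h}" by (rule integrable_const_ivl)
      show "rinner k (\<theta> s d k) \<le> rinner k (d k) + \<epsilon> / 2" if "s \<in> {0..?h}" for s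
        using \<delta>(2)[of s] that i by (auto simp: abs_if split: if_splits)
    qed
    also have "\<dots> = ?h * (rinner k (d k) + \<epsilon> / 2)" by simp
    finally have "orbit_avg k ?h d \<le> rinner k (d k) + \<epsilon> / 2"
      unfolding orbit_avg_def using i by (simp add: field_simps)
    then show False using fd[OF i(1)] eps by (simp add: f_def)
  qed
  then obtain n where n: "\<And>b. b \<in> unit_ball \<Longrightarrow> \<exists>i\<in>{1..n::nat}. f i b \<le> 0" by blast
  have "id \<in> unit_ball" by (simp add: unit_ball_def M_id)
  then have ne: "{1..n} \<noteq> {}" using n by blast
  have "\<exists>w. (\<forall>i\<in>{1..n}. 0 \<le> w i) \<and> (\<Sum>i\<in>{1..n}. w i) = 1 \<and> (\<forall>a\<in>unit_ball. (\<Sum>i\<in>{1..n}. w i * f i a) \<le> 0)"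
  proof (rule minimax_finite[where mix = mix])
    show "mix l a b \<in> unit_ball" if "0 \<le> l" "l \<le> 1" "a \<in> unit_ball" "b \<in> unit_ball" for l a b
      using unit_ball_mix[OF that] by (simp add: mix_def)
    show "f i (mix l a b) = l * f i a + (1 - l) * f i b" if "a \<in> unit_ball" "b \<in> unit_ball" for i l a b
      using f_mix that unit_ballD(1) by blast
  qed (use ne n in auto)
  then obtain w where w: "\<And>i. i \<in> {1..n} \<Longrightarrow> 0 \<le> w i" "(\<Sum>i\<in>{1..n}. w i) = 1"
    "\<And>a. a \<in> unit_ball \<Longrightarrow> (\<Sum>i\<in>{1..n}. w i * f i a) \<le> 0" by blast
  have upper: "(\<Sum>i\<in>{1..n}. w i * orbit_avg k (1 / i) b) - rinner k (b k) \<le> \<epsilon>" if b: "b \<in> unit_ball" for b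
  proof -
    have "(\<Sum>i\<in>{1..n}. w i * f i b) = (\<Sum>i\<in>{1..n}. w i * orbit_avg k (1 / i) b) - (\<Sum>i\<in>{1..n}. w i) * (rinner k (b k) + \<epsilon>)"
      unfolding f_def sum_distrib_right sum_subtractf[symmetric]
      by (intro sum.cong refl) (simp add: algebra_simps)
    then show ?thesis using w(3)[OF b] w(2) by simp
  qed
  have close: "\<bar>(\<Sum>i\<in>{1..n}. w i * orbit_avg k (1 / i) b) - rinner k (b k)\<bar> \<le> \<epsilon>" if b: "b \<in> unit_ball" for b
  proof -
    \<comment> \<open>The minimax theorem bounds the difference on one side only; the other side is
      the same bound for \<open>-b\<close>. The zero summand fits
      \<open>orbit_avg_mix\<close>.\<close>
    let ?b = "\<lambda>x. scaleR (-1) (b x) + scaleR 0 (b x)"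
    have "?b \<in> unit_ball" using b M_scaleR[OF unit_ballD(1)[OF b], of "-1"] by (simp add: unit_ball_def)
    from upper[OF this] have "- ((\<Sum>i\<in>{1..n}. w i * orbit_avg k (1 / i) b) - rinner k (b k)) \<le> \<epsilon>"
      using orbit_avg_mix[OF unit_ballD(1)[OF b] unit_ballD(1)[OF b], of _ k "-1" 0]
      by (simp add: sum_negf)
    with upper[OF b] show ?thesis by linarith
  qed
  show ?thesis by (rule that[of n w]) (fact w(1,2) close)+
qed

text \<open>A convex combination of averages is uniformly close to the vector functional on the unit
  ball and Lipschitz along the semigroup. Closeness is used twice, at \<open>b\<close> and at
  \<open>\<theta> t b\<close>, with \<open>\<epsilon> / 4\<close> each.\<close>

lemma norm_continuity_at_0:
  assumes eps: "\<epsilon> > 0"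
  obtains \<delta> where "\<delta> > 0"
    "\<And>t b. 0 \<le> t \<Longrightarrow> t < \<delta> \<Longrightarrow> b \<in> unit_ball \<Longrightarrow> \<bar>rinner k (\<theta> t b k) - rinner k (b k)\<bar> \<le> \<epsilon>"
proof -
  have "\<epsilon> / 4 > 0" using eps by simp
  then obtain n w where w: "\<And>i. i \<in> {1..n} \<Longrightarrow> 0 \<le> w i" "(\<Sum>i\<in>{1..n::nat}. w i) = (1::real)"
    and close: "\<And>b. b \<in> unit_ball \<Longrightarrow> \<bar>(\<Sum>i\<in>{1..n}. w i * orbit_avg k (1 / i) b) - rinner k (b k)\<bar> \<le> \<epsilon> / 4"
    using convex_averages by blast
  \<comment> \<open>Lipschitz constant of the combination: each window has length at least
    \<open>1 / n\<close>.\<close>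
  define B where "B = 2 * (norm k)\<^sup>2 * real n"
  have "B \<ge> 0" by (simp add: B_def)
  define \<delta> where "\<delta> = \<epsilon> / (2 * (B + 1))"
  have \<delta>: "\<delta> > 0" "\<delta> * B \<le> \<epsilon> / 2" using eps \<open>B \<ge> 0\<close> by (auto simp: \<delta>_def field_simps)
  have "\<bar>rinner k (\<theta> t b k) - rinner k (b k)\<bar> \<le> \<epsilon>" if t: "0 \<le> t" "t < \<delta>" and b: "b \<in> unit_ball" for t b
  proof -
    let ?\<Psi> = "\<lambda>b. \<Sum>i\<in>{1..n}. w i * orbit_avg k (1 / i) b"
    have "\<bar>?\<Psi> (\<theta> t b) - ?\<Psi> b\<bar> = \<bar>\<Sum>i\<in>{1..n}. w i * (orbit_avg k (1 / i) (\<theta> t b) - orbit_avg k (1 / i) b)\<bar>"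
      by (simp add: sum_subtractf right_diff_distrib)
    also have "\<dots> \<le> (\<Sum>i\<in>{1..n}. w i * (t * B))"
    proof (rule order_trans[OF sum_abs sum_mono])
      fix i assume i: "i \<in> {1..n}"
      have "\<bar>orbit_avg k (1 / i) (\<theta> t b) - orbit_avg k (1 / i) b\<bar> \<le> 2 * t * (norm k)\<^sup>2 / (1 / i)"
        by (rule orbit_avg_shift[OF b _ t(1)]) (use i in simp)
      also have "\<dots> = 2 * t * (norm k)\<^sup>2 * real i" by simp
      also have "\<dots> \<le> 2 * t * (norm k)\<^sup>2 * real n" using i t by (intro mult_left_mono) auto
      also have "\<dots> = t * B" by (simp add: B_def)
      finally show "\<bar>w i * (orbit_avg k (1 / i) (\<theta> t b) - orbit_avg k (1 / i) b)\<bar> \<le> w i * (t * B)"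
        using w(1)[OF i] by (simp add: abs_mult mult_left_mono)
    qed
    also have "\<dots> = t * B" using w(2) by (simp add: sum_distrib_right[symmetric])
    also have "\<dots> \<le> \<epsilon> / 2" using t \<delta> \<open>B \<ge> 0\<close> by (smt (verit) mult_right_mono)
    finally show ?thesis using close[OF b] close[OF theta_unit_ball[OF t(1) b]] by linarith
  qed
  with \<delta>(1) show ?thesis using that by blast
qed

text \<open>Of two times, the later one is reached from the earlier by a short step applied to
  another element of the unit ball. Uniformity over the ball therefore turns right continuity at
  \<open>0\<close> into two-sided continuity everywhere.\<close>

lemma norm_continuity:
  assumes eps: "\<epsilon> > 0" and t0: "t\<^sub>0 \<ge> 0"
  obtains \<delta> where "\<delta> > 0"
    "\<And>t b. 0 \<le> t \<Longrightarrow> \<bar>t - t\<^sub>0\<bar> < \<delta> \<Longrightarrow> b \<in> unit_ball \<Longrightarrow>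
       \<bar>rinner k (\<theta> t b k) - rinner k (\<theta> t\<^sub>0 b k)\<bar> \<le> \<epsilon>"
proof -
  obtain \<delta> where \<delta>: "\<delta> > 0"
    "\<And>t b. 0 \<le> t \<Longrightarrow> t < \<delta> \<Longrightarrow> b \<in> unit_ball \<Longrightarrow> \<bar>rinner k (\<theta> t b k) - rinner k (b k)\<bar> \<le> \<epsilon>"
    using norm_continuity_at_0[OF eps] by blast
  have "\<bar>rinner k (\<theta> t b k) - rinner k (\<theta> t\<^sub>0 b k)\<bar> \<le> \<epsilon>"
    if t: "0 \<le> t" "\<bar>t - t\<^sub>0\<bar> < \<delta>" and b: "b \<in> unit_ball" for t b
  proof (cases "t \<ge> t\<^sub>0")
    case True
    have "\<theta> t b = \<theta> (t - t\<^sub>0) (\<theta> t\<^sub>0 b)"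
      using theta_add[of "t - t\<^sub>0" t\<^sub>0 b] True t0 unit_ballD(1)[OF b] by simp
    then show ?thesis using \<delta>(2)[of "t - t\<^sub>0" "\<theta> t\<^sub>0 b"] True t theta_unit_ball[OF t0 b] by simp
  next
    case False
    have "\<theta> t\<^sub>0 b = \<theta> (t\<^sub>0 - t) (\<theta> t b)"
      using theta_add[of "t\<^sub>0 - t" t b] False t unit_ballD(1)[OF b] by simp
    then show ?thesis using \<delta>(2)[of "t\<^sub>0 - t" "\<theta> t b"] False t theta_unit_ball[OF t(1) b] by simp
  qed
  with \<delta>(1) show ?thesis using that by blast
qed

end

section \<open>Continuous choice of dominated vectors\<close>

text \<open>With \<open>r = resolvent h\<close> these are \<open>r h r \<le> h\<close>,
  \<open>(1 - r)^2 \<le> h\<close> and contractivity of \<open>1 - r\<close>. After substituting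
  \<open>x = y + h y\<close>, each larger side expands into the smaller one plus nonnegative
  terms.\<close>

lemma resolvent_compress:
  assumes h: "positive_op h"
  shows "rinner (resolvent h x) (h (resolvent h x)) \<le> rinner x (h x)"
    and "(norm (x - resolvent h x))\<^sup>2 \<le> rinner x (h x)"
    and "norm (x - resolvent h x) \<le> norm x"
proof -
  note sa = positive_opD(1)[OF h]
  note lin = bounded_clinearD[OF selfadjointD(1)[OF sa]]
  let ?y = "resolvent h x"
  have x: "x = ?y + h ?y" by (rule resolvent_right[OF h, symmetric])
  have d: "x - ?y = h ?y" using x by (metis add_diff_cancel_left')
  have 1: "rinner x (h x) = rinner ?y (h ?y) + 2 * (norm (h ?y))\<^sup>2 + rinner (h ?y) (h (h ?y))"
    using selfadjointD(2)[OF sa, of ?y "h ?y"]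
    by (subst (1 2) x) (simp add: lin cinner_simps rinner_self[symmetric])
  have 2: "0 \<le> rinner ?y (h ?y)" "0 \<le> rinner (h ?y) (h (h ?y))" by (rule positive_opD(2)[OF h])+
  show "rinner ?y (h ?y) \<le> rinner x (h x)" using 1 2 by simp
  show "(norm (x - ?y))\<^sup>2 \<le> rinner x (h x)" unfolding d using 1 2 by (smt (verit) zero_le_power2)
  have "(norm x)\<^sup>2 = (norm ?y)\<^sup>2 + (norm (h ?y))\<^sup>2 + 2 * rinner ?y (h ?y)"
    by (subst x) (rule norm_add_sq)
  then have "(norm (h ?y))\<^sup>2 \<le> (norm x)\<^sup>2" using 2(1) by (smt (verit) zero_le_power2)
  then show "norm (x - ?y) \<le> norm x" unfolding d by (rule power2_le_imp_le) simp
qed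

context E0
begin

text \<open>\<open>dominated W t\<close> consists of the vectors \<open>X W\<close> with \<open>X\<close> a contractive intertwiner of the identity
  and \<open>\<theta> t\<close> defined on the cyclic subspace of \<open>W\<close>; it is the polar of \<open>dual_set W t\<close>.\<close>

definition dominated :: "'g \<Rightarrow> real \<Rightarrow> 'g set" where
  "dominated W t = {k. \<forall>b\<in>M. norm (\<theta> t b k) \<le> norm (b W)}"

definition dual_set :: "'g \<Rightarrow> real \<Rightarrow> 'g set" where
  "dual_set W t = {\<theta> t (adjoint b) z | b z. b \<in> M \<and> norm (b W) \<le> 1 \<and> norm z \<le> 1}"

lemma cinner_theta_adjoint:
  assumes "t \<ge> 0" "b \<in> M"
  shows "cinner (\<theta> t (adjoint b) z) k = cinner z (\<theta> t b k)"
  using assms star_endo.endo_adjoint[OF theta_endo, of t b] cinner_adjoint_left[OF M_bounded[OF theta_in]]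
  by simp

lemma dominated_norm_le: "t \<ge> 0 \<Longrightarrow> k \<in> dominated W t \<Longrightarrow> norm k \<le> norm W"
  using M_id star_endo.endo_id[OF theta_endo, of t] by (force simp: dominated_def)

lemma dominatedD: "k \<in> dominated W t \<Longrightarrow> b \<in> M \<Longrightarrow> norm (\<theta> t b k) \<le> norm (b W)"
  by (simp add: dominated_def)

lemma zero_dominated: "t \<ge> 0 \<Longrightarrow> 0 \<in> dominated W t"
  by (simp add: dominated_def M_lin(5)[OF theta_in])

lemma closed_dominated:
  assumes "t \<ge> 0" shows "closed (dominated W t)"
proof -
  have "dominated W t = (\<Inter>b\<in>M. {k. norm (\<theta> t b k) \<le> norm (b W)})" by (auto simp: dominated_def)
  moreover have "closed {k. norm (\<theta> t b k) \<le> norm (b W)}" if "b \<in> M" for b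
    by (intro closed_Collect_le continuous_intros
        linear_continuous_on[OF M_lin(1)[OF theta_in[OF assms that]]])
  ultimately show ?thesis by (simp add: closed_INT)
qed

lemma convex_dominated:
  assumes t: "t \<ge> 0" shows "convex (dominated W t)"
  unfolding convex_def
proof (intro ballI allI impI)
  fix x y and u v :: real assume xy: "x \<in> dominated W t" "y \<in> dominated W t" and uv: "0 \<le> u" "0 \<le> v" "u + v = 1"
  have "norm (\<theta> t b (scaleR u x + scaleR v y)) \<le> norm (b W)" if b: "b \<in> M" for b
  proof -
    have "norm (\<theta> t b (scaleR u x + scaleR v y)) \<le> u * norm (\<theta> t b x) + v * norm (\<theta> t b y)"
      using norm_triangle_ineq[of "scaleR u (\<theta> t b x)" "scaleR v (\<theta> t b y)"] uv
      by (simp add: M_lin[OF theta_in[OF t b]])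
    also have "\<dots> \<le> u * norm (b W) + v * norm (b W)"
      using xy uv b by (intro add_mono mult_left_mono) (auto simp: dominated_def)
    finally show ?thesis using uv by (simp add: distrib_right[symmetric])
  qed
  then show "scaleR u x + scaleR v y \<in> dominated W t" by (simp add: dominated_def)
qed

lemma dominated_dual:
  assumes t: "t \<ge> 0" and k: "k \<in> dominated W t" and e: "e \<in> convex hull (dual_set W t)"
  shows "rinner e k \<le> 1"
proof -
  have "dual_set W t \<subseteq> {e. rinner e k \<le> 1}"
  proof
    fix e assume "e \<in> dual_set W t"
    then obtain b z where bz: "e = \<theta> t (adjoint b) z" "b \<in> M" "norm (b W) \<le> 1" "norm z \<le> 1"
      by (auto simp: dual_set_def)
    have "rinner e k = rinner z (\<theta> t b k)" by (simp add: bz(1) cinner_theta_adjoint[OF t bz(2)])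
    also have "\<dots> \<le> norm z * norm (\<theta> t b k)" by (rule rinner_le_norm)
    also have "\<dots> \<le> 1 * 1" using bz k by (intro mult_mono) (auto simp: dominated_def intro: order_trans)
    finally show "e \<in> {e. rinner e k \<le> 1}" by simp
  qed
  moreover have "convex {e. rinner e k \<le> 1}"
    unfolding convex_def
    by (auto simp: cinner_add_left intro: convex_bound_le)
  ultimately show ?thesis using e hull_minimal[of "dual_set W t" "{e. rinner e k \<le> 1}" convex] by blast
qed

lemma dominatedI:
  assumes t: "t \<ge> 0" and k: "\<And>e. e \<in> dual_set W t \<Longrightarrow> rinner e k \<le> 1"
  shows "k \<in> dominated W t"
  unfolding dominated_def
proof (intro CollectI ballI)
  fix b assume b: "b \<in> M"
  let ?v = "\<theta> t b k"
  show "norm ?v \<le> norm (b W)"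
  proof (rule field_le_epsilon)
    fix d :: real assume d: "d > 0"
    \<comment> \<open>The added \<open>d\<close> avoids dividing by \<open>norm (b W)\<close>, which
      may be zero.\<close>
    define s where "s = norm (b W) + d"
    have s: "s > 0" using d by (simp add: s_def add_nonneg_pos)
    show "norm ?v \<le> norm (b W) + d"
    proof (cases "?v = 0")
      case False
      let ?b = "\<lambda>x. scaleR (1 / s) (b x)" and ?z = "scaleR (1 / norm ?v) ?v"
      have bM: "?b \<in> M" by (rule M_scaleR[OF b])
      have "\<theta> t (adjoint ?b) ?z \<in> dual_set W t"
        unfolding dual_set_def using bM s d False
        by (intro CollectI exI[of _ ?b] exI[of _ ?z]) (auto simp: s_def divide_le_eq)
      then have "rinner (\<theta> t (adjoint ?b) ?z) k \<le> 1" by (rule k)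
      then have "rinner ?z (scaleR (1 / s) ?v) \<le> 1"
        using cinner_theta_adjoint[OF t bM, of ?z k] star_endo.endo_scaleR[OF theta_endo[OF t] b, of "1 / s"]
        by simp
      also have "rinner ?z (scaleR (1 / s) ?v) = norm ?v / s"
        using False by (simp add: rinner_self power2_eq_square)
      finally show ?thesis using s by (simp add: s_def divide_le_eq)
    qed (use d in simp)
  qed
qed

text \<open>An instance of the bipolar theorem.\<close>

lemma nearest_dual_approx:
  assumes t: "t \<ge> 0" and k': "k' \<in> dominated W t"
    "\<And>z. z \<in> dominated W t \<Longrightarrow> norm (k - k') \<le> norm (k - z)" and eta: "\<eta> > 0"
  shows "0 \<le> rinner (k - k') k'"
    and "\<exists>e \<in> convex hull (dual_set W t).
      norm ((k - k') - scaleR (rinner (k - k') k' + \<eta>) e) \<le> \<eta>"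
proof -
  define y where "y = k - k'"
  define \<mu> where "\<mu> = rinner y k'"
  have var: "rinner y (z - k') \<le> 0" if "z \<in> dominated W t" for z
    unfolding y_def by (rule nearest_point_rinner[OF convex_dominated[OF t] k' that])
  have \<mu>: "0 \<le> \<mu>" using var[OF zero_dominated[OF t]] by (simp add: \<mu>_def)
  then show "0 \<le> rinner (k - k') k'" by (simp add: \<mu>_def y_def)
  let ?C = "closure (convex hull (dual_set W t))"
  \<comment> \<open>The addend \<open>\<eta>\<close> keeps the scale positive when
    \<open>\<mu> = 0\<close>.\<close>
  let ?s = "\<mu> + \<eta>"
  have s: "?s > 0" using \<mu> eta by simp
  let ?x = "scaleR (1 / ?s) y"
  have zero: "0 \<in> dual_set W t"
    unfolding dual_set_def using M_zero
    by (intro CollectI exI[of _ "\<lambda>x. 0"] exI[of _ 0])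
       (auto simp: M_lin(5)[OF theta_in[OF t M_adjoint]])
  have "?x \<in> ?C"
  proof (rule ccontr)
    assume "?x \<notin> ?C"
    have C: "closed ?C" "convex ?C" "?C \<noteq> {}" using zero by (auto simp: convex_closure)
    obtain w where w: "w \<in> ?C" "\<And>z. z \<in> ?C \<Longrightarrow> norm (?x - w) \<le> norm (?x - z)"
      using nearest_point_exists[OF C, of ?x] by blast
    define v where "v = ?x - w"
    have "v \<noteq> 0" using w(1) \<open>?x \<notin> ?C\<close> by (auto simp: v_def)
    have sep: "rinner v z \<le> rinner v w" if "z \<in> ?C" for z
      using nearest_point_rinner[OF C(2) w that] by (simp add: v_def cinner_diff_right)
    have "0 \<in> ?C" using zero by (meson closure_subset hull_subset subsetD)
    then have "0 \<le> rinner v w" using sep by fastforce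
    have "rinner v ?x = rinner v v + rinner v w" by (simp add: v_def cinner_diff_right)
    then have gap: "rinner v w < rinner v ?x" using \<open>v \<noteq> 0\<close> by (simp add: rinner_self)
    define g where "g = rinner v ?x"
    \<comment> \<open>Strictly between the supremum of \<open>v\<close> over the dual hull and its
      value at the point outside. Then \<open>v / \<sigma>\<close> is dominated, so \<open>y\<close>
      is at most \<open>\<mu>\<close> there, whereas the gap makes it larger than
      \<open>\<mu> + \<eta>\<close>.\<close>
    define \<sigma> where "\<sigma> = (rinner v w + g) / 2"
    have \<sigma>: "\<sigma> > 0" "rinner v w < \<sigma>" "\<sigma> < g"
      using gap \<open>0 \<le> rinner v w\<close> unfolding \<sigma>_def g_def[symmetric] by auto
    have "scaleR (1 / \<sigma>) v \<in> dominated W t"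
    proof (rule dominatedI[OF t])
      fix e assume "e \<in> dual_set W t"
      then have "e \<in> ?C" by (meson closure_subset hull_subset subsetD)
      then have "rinner v e \<le> \<sigma>" using sep[of e] \<sigma> by linarith
      then show "rinner e (scaleR (1 / \<sigma>) v) \<le> 1" using \<sigma>(1) rinner_commute[of e v] by (simp add: divide_le_eq)
    qed
    from var[OF this] have "rinner y (scaleR (1 / \<sigma>) v) \<le> \<mu>" by (simp add: cinner_diff_right \<mu>_def)
    then have "rinner v y \<le> \<mu> * \<sigma>" using \<sigma>(1) rinner_commute[of y v] by (simp add: divide_le_eq)
    moreover have "\<sigma> * ?s < rinner v y" using \<sigma>(3) s by (simp add: g_def field_simps)
    ultimately show False using \<sigma>(1) eta by (simp add: algebra_simps) (smt (verit) mult_pos_pos)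
  qed
  then obtain e where e: "e \<in> convex hull (dual_set W t)" "dist e ?x < \<eta> / ?s"
    using closure_approachable[of ?x "convex hull (dual_set W t)"] s eta by (meson divide_pos_pos)
  have "y - scaleR ?s e = scaleR ?s (?x - e)" using s by (simp add: scaleR_diff_right)
  then have "norm (y - scaleR ?s e) = ?s * dist e ?x" using s by (simp add: dist_norm norm_minus_commute)
  also have "\<dots> \<le> \<eta>" using e(2) s by (simp add: pos_less_divide_eq mult.commute less_imp_le)
  finally show "\<exists>e \<in> convex hull (dual_set W t). norm ((k - k') - scaleR (rinner (k - k') k' + \<eta>) e) \<le> \<eta>"
    using e(1) unfolding y_def \<mu>_def by blast
qed

lemma convex_hull_dual_set:
  assumes "e \<in> convex hull (dual_set W t)"
  obtains n :: nat and u b z where "\<And>i. i \<in> {1..n} \<Longrightarrow> 0 \<le> u i" "(\<Sum>i=1..n. u i) = 1"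
    "\<And>i. i \<in> {1..n} \<Longrightarrow> b i \<in> M" "\<And>i. i \<in> {1..n} \<Longrightarrow> norm (b i W) \<le> 1" "\<And>i. i \<in> {1..n} \<Longrightarrow> norm (z i) \<le> 1"
    "e = (\<Sum>i=1..n. scaleR (u i) (\<theta> t (adjoint (b i)) (z i)))"
proof -
  obtain n :: nat and u x where 1: "\<And>i. i \<in> {1..n} \<Longrightarrow> 0 \<le> u i \<and> x i \<in> dual_set W t"
    "(\<Sum>i=1..n. u i) = 1" "(\<Sum>i=1..n. scaleR (u i) (x i)) = e"
    using assms unfolding convex_hull_indexed by blast
  have "\<exists>p. x i = \<theta> t (adjoint (fst p)) (snd p) \<and> fst p \<in> M \<and> norm (fst p W) \<le> 1 \<and> norm (snd p) \<le> 1"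
    if "i \<in> {1..n}" for i
    using 1(1)[OF that] unfolding dual_set_def by auto
  then obtain p where p: "\<And>i. i \<in> {1..n} \<Longrightarrow> x i = \<theta> t (adjoint (fst (p i))) (snd (p i)) \<and>
      fst (p i) \<in> M \<and> norm (fst (p i) W) \<le> 1 \<and> norm (snd (p i)) \<le> 1" by metis
  have "e = (\<Sum>i=1..n. scaleR (u i) (\<theta> t (adjoint (fst (p i))) (snd (p i))))"
    unfolding 1(3)[symmetric] by (intro sum.cong refl) (use p in simp)
  then show ?thesis using that[of n u "\<lambda>i. fst (p i)" "\<lambda>i. snd (p i)"] 1 p by blast
qed

text \<open>The decomposition \<open>1 = r + (1 - r)\<close> with \<open>r = (1 + \<tau> \<Sum> u\<^sub>i b\<^sub>i\<^sup>* b\<^sub>i)\<^sup>-\<^sup>1\<close> replaces the possibly large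
  coefficients \<open>b\<^sub>i\<close> of a dual vector by bounded ones, so that norm closeness of the functionals applies.\<close>

lemma dual_estimate:
  assumes t: "t \<ge> 0" "t0 \<ge> 0" and k: "k \<in> dominated W t0"
    and close: "\<And>b. b \<in> unit_ball \<Longrightarrow> \<bar>rinner k (\<theta> t b k) - rinner k (\<theta> t0 b k)\<bar> \<le> \<epsilon>"
    and tau: "\<tau> > 0" and e: "e \<in> convex hull (dual_set W t)"
  shows "rinner e k \<le> 1 + \<epsilon> / (2 * \<tau>) + norm e * sqrt (\<tau> + \<epsilon>)"
proof -
  interpret T: star_endo M "\<theta> t" by (rule theta_endo[OF t(1)])
  interpret T0: star_endo M "\<theta> t0" by (rule theta_endo[OF t(2)])
  obtain n :: nat and u b z where u: "\<And>i. i \<in> {1..n} \<Longrightarrow> 0 \<le> u i" "(\<Sum>i=1..n. u i) = 1"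
    and b: "\<And>i. i \<in> {1..n} \<Longrightarrow> b i \<in> M" "\<And>i. i \<in> {1..n} \<Longrightarrow> norm (b i W) \<le> 1"
    and z: "\<And>i. i \<in> {1..n} \<Longrightarrow> norm (z i) \<le> 1"
    and e_eq: "e = (\<Sum>i=1..n. scaleR (u i) (\<theta> t (adjoint (b i)) (z i)))"
    by (rule convex_hull_dual_set[OF e]) blast
  define h where "h = (\<lambda>x. \<Sum>i=1..n. scaleR (\<tau> * u i) ((adjoint (b i) \<circ> b i) x))"
  have hM: "h \<in> M" unfolding h_def by (intro M_sum M_scaleR M_adjoint_self b) auto
  have hq: "rinner x (h x) = (\<Sum>i=1..n. \<tau> * u i * (norm (b i x))\<^sup>2)" for x
    unfolding h_def cinner_sum_right Re_sum
    by (intro sum.cong refl) (simp only: rinner_scaleR_right rinner_adjoint_self[OF M_bounded[OF b(1)]])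
  have hsa: "selfadjoint h"
    unfolding selfadjoint_def
  proof (intro conjI allI M_bounded[OF hM])
    show "cinner (h x) y = cinner x (h y)" for x y
      unfolding h_def cinner_sum_left cinner_sum_right
      by (intro sum.cong refl)
         (simp add: cinner_adjoint_left[OF M_bounded[OF b(1)]] cinner_adjoint[OF M_bounded[OF b(1)], symmetric])
  qed
  have hpos: "positive_op h"
    by (rule positive_opI[OF hsa]) (use tau u in \<open>auto simp: hq intro!: sum_nonneg\<close>)
  have hW: "rinner W (h W) \<le> \<tau>"
  proof -
    have "rinner W (h W) \<le> (\<Sum>i=1..n. \<tau> * u i * 1)"
      unfolding hq using tau u b by (intro sum_mono mult_left_mono) (auto simp: power_le_one)
    also have "\<dots> = \<tau>" using u(2) by (simp add: sum_distrib_left[symmetric])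
    finally show ?thesis .
  qed
  define r where "r = resolvent h"
  have rM: "r \<in> M" unfolding r_def by (rule M_resolvent[OF hM hpos])
  have rsa: "selfadjoint r" unfolding r_def by (rule positive_opD(1)[OF resolvent_positive[OF hpos]])
  define q where "q = (\<lambda>x. id x - r x)"
  have qM: "q \<in> M" unfolding q_def by (rule M_diff[OF M_id rM])
  have qsa: "selfadjoint q" unfolding q_def by (rule selfadjoint_diff[OF selfadjoint_id rsa])
  have hr: "h (r x) = q x" for x
    using resolvent_right[OF hpos, of x] by (simp add: r_def q_def eq_diff_eq add.commute)
  have q1: "norm (q x) \<le> norm x" for x
    using resolvent_compress(3)[OF hpos, of x] by (simp add: q_def r_def)
  have r1: "norm (r x) \<le> norm x" for x unfolding r_def by (rule norm_resolvent_le[OF hpos])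
  \<comment> \<open>The functional is tested only on \<open>a\<close> and
    \<open>q \<circ> q\<close>. Although \<open>h\<close> may be large, \<open>h r = 1 - r\<close>
    makes \<open>a\<close> a contraction, and its form collects the weighted squares of all
    \<open>b i\<close> after damping by \<open>r\<close>.\<close>
  define a where "a = r \<circ> (h \<circ> r)"
  have aM: "a \<in> M" unfolding a_def by (intro M_compose rM hM)
  have ab: "a \<in> unit_ball"
    using aM order_trans[OF r1 q1] by (simp add: unit_ball_def a_def hr)
  have qb: "q \<circ> q \<in> unit_ball"
    using M_compose[OF qM qM] order_trans[OF q1 q1] by (simp add: unit_ball_def)
  have aq: "rinner x (\<phi> a x) = (\<Sum>i=1..n. \<tau> * u i * (norm (\<phi> (b i) (\<phi> r x)))\<^sup>2)"
    if "star_endo M \<phi>" for \<phi> x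
  proof -
    interpret star_endo M \<phi> by fact
    have gM: "(\<lambda>x. scaleR (\<tau> * u i) ((adjoint (b i) \<circ> b i) x)) \<in> M" if "i \<in> {1..n}" for i
      by (intro M_scaleR M_adjoint_self b that)
    have "\<phi> h = (\<lambda>x. \<Sum>i=1..n. \<phi> (\<lambda>x. scaleR (\<tau> * u i) ((adjoint (b i) \<circ> b i) x)) x)"
      unfolding h_def by (rule endo_sum[OF _ gM]) auto
    moreover have "rinner y (\<phi> (\<lambda>x. scaleR (\<tau> * u i) ((adjoint (b i) \<circ> b i) x)) y) =
        \<tau> * u i * (norm (\<phi> (b i) y))\<^sup>2" if i: "i \<in> {1..n}" for i y
      unfolding endo_scaleR[OF M_adjoint_self[OF b(1)[OF i]]] endo_compose[OF M_adjoint[OF b(1)[OF i]] b(1)[OF i]]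
        endo_adjoint[OF b(1)[OF i]]
      by (simp only: rinner_scaleR_right rinner_adjoint_self[OF M_bounded[OF endo_in[OF b(1)[OF i]]]])
    ultimately have "rinner y (\<phi> h y) = (\<Sum>i=1..n. \<tau> * u i * (norm (\<phi> (b i) y))\<^sup>2)" for y
      by (simp add: cinner_sum_right)
    moreover have "rinner x (\<phi> a x) = rinner (\<phi> r x) (\<phi> h (\<phi> r x))"
      unfolding a_def endo_compose[OF rM M_compose[OF hM rM]] endo_compose[OF hM rM]
      using selfadjointD(2)[OF endo_selfadjoint[OF rM rsa]] by simp
    ultimately show ?thesis by simp
  qed
  have small: "rinner k (\<theta> t0 a k) \<le> \<tau>"
  proof -
    have "rinner k (\<theta> t0 a k) = (\<Sum>i=1..n. \<tau> * u i * (norm (\<theta> t0 (b i) (\<theta> t0 r k)))\<^sup>2)"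
      by (rule aq[OF theta_endo[OF t(2)]])
    also have "\<dots> \<le> (\<Sum>i=1..n. \<tau> * u i * (norm (b i (r W)))\<^sup>2)"
    proof (intro sum_mono mult_left_mono power_mono norm_ge_zero)
      fix i assume i: "i \<in> {1..n}"
      have "norm (\<theta> t0 (b i \<circ> r) k) \<le> norm ((b i \<circ> r) W)"
        by (rule dominatedD[OF k M_compose[OF b(1)[OF i] rM]])
      then show "norm (\<theta> t0 (b i) (\<theta> t0 r k)) \<le> norm (b i (r W))"
        by (simp add: T0.endo_compose[OF b(1)[OF i] rM])
      show "0 \<le> \<tau> * u i" using tau u(1)[OF i] by simp
    qed
    also have "\<dots> = rinner (r W) (h (r W))" by (simp add: hq)
    also have "\<dots> \<le> rinner W (h W)" unfolding r_def by (rule resolvent_compress(1)[OF hpos])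
    finally show ?thesis using hW by linarith
  qed
  have eps: "\<epsilon> \<ge> 0" using close[OF ab] by linarith
  have part1: "rinner e (\<theta> t r k) \<le> 1 + \<epsilon> / (2 * \<tau>)"
  proof -
    have "rinner e (\<theta> t r k) = (\<Sum>i=1..n. u i * rinner (z i) (\<theta> t (b i) (\<theta> t r k)))"
      unfolding e_eq cinner_sum_left Re_sum
      by (intro sum.cong refl) (simp add: cinner_theta_adjoint[OF t(1) b(1)])
    also have "\<dots> \<le> (\<Sum>i=1..n. u i * (1/2 + (norm (\<theta> t (b i) (\<theta> t r k)))\<^sup>2 / 2))"
    proof (intro sum_mono mult_left_mono)
      fix i assume i: "i \<in> {1..n}"
      let ?N = "norm (\<theta> t (b i) (\<theta> t r k))"
      have "rinner (z i) (\<theta> t (b i) (\<theta> t r k)) \<le> norm (z i) * ?N" by (rule rinner_le_norm)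
      also have "\<dots> \<le> 1 * ?N" by (rule mult_right_mono[OF z[OF i] norm_ge_zero])
      \<comment> \<open>Passing to squares exposes the form of \<open>a\<close>. The weights
        \<open>u i\<close> sum to one, so the constant halves combine with
        \<open>(\<tau> + \<epsilon>) / (2 * \<tau>)\<close> to give the bound of
        \<open>part1\<close>.\<close>
      also have "\<dots> \<le> 1/2 + ?N\<^sup>2 / 2" using zero_le_power2[of "?N - 1"] by (simp add: power2_diff)
      finally show "rinner (z i) (\<theta> t (b i) (\<theta> t r k)) \<le> 1/2 + ?N\<^sup>2 / 2" .
    qed (use u in auto)
    also have "\<dots> = (\<Sum>i=1..n. u i) / 2 + (\<Sum>i=1..n. \<tau> * u i * (norm (\<theta> t (b i) (\<theta> t r k)))\<^sup>2) / (2 * \<tau>)"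
      unfolding sum_divide_distrib sum.distrib[symmetric] using tau
      by (intro sum.cong refl) (simp add: field_simps)
    also have "\<dots> = 1 / 2 + rinner k (\<theta> t a k) / (2 * \<tau>)"
      by (simp only: u(2) aq[OF theta_endo[OF t(1)]])
    also have "\<dots> \<le> 1 / 2 + (\<tau> + \<epsilon>) / (2 * \<tau>)"
      using close[OF ab] small tau by (intro add_left_mono divide_right_mono) auto
    also have "\<dots> = 1 + \<epsilon> / (2 * \<tau>)" using tau by (simp add: add_divide_distrib)
    finally show ?thesis .
  qed
  have qq: "rinner k (\<phi> (q \<circ> q) k) = (norm (\<phi> q k))\<^sup>2" if "star_endo M \<phi>" for \<phi>
  proof -
    interpret star_endo M \<phi> by fact
    show ?thesis
      using selfadjointD(2)[OF endo_selfadjoint[OF qM qsa], of k "\<phi> q k"]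
      by (simp add: endo_compose[OF qM qM] rinner_self[symmetric])
  qed
  have part2: "norm (\<theta> t q k) \<le> sqrt (\<tau> + \<epsilon>)"
  proof (rule real_le_rsqrt)
    have "norm (\<theta> t0 q k) \<le> norm (q W)" using k qM by (simp add: dominated_def)
    then have "(norm (\<theta> t0 q k))\<^sup>2 \<le> (norm (q W))\<^sup>2" by (rule power_mono) simp
    also have "\<dots> \<le> rinner W (h W)" using resolvent_compress(2)[OF hpos, of W] by (simp add: q_def r_def)
    finally have "(norm (\<theta> t0 q k))\<^sup>2 \<le> \<tau>" using hW by linarith
    then show "(norm (\<theta> t q k))\<^sup>2 \<le> \<tau> + \<epsilon>"
      using close[OF qb] qq[OF theta_endo[OF t(1)]] qq[OF theta_endo[OF t(2)]] by linarith
  qed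
  have "\<theta> t q k = k - \<theta> t r k" unfolding q_def T.endo_diff[OF M_id rM] T.endo_id by simp
  then have "rinner e k = rinner e (\<theta> t r k) + rinner e (\<theta> t q k)" by (simp add: cinner_diff_right)
  moreover have "rinner e (\<theta> t q k) \<le> norm e * sqrt (\<tau> + \<epsilon>)"
    by (rule order_trans[OF rinner_le_norm mult_left_mono[OF part2 norm_ge_zero]])
  ultimately show ?thesis using part1 by linarith
qed

text \<open>\<open>k - k'\<close> is almost a multiple of a dual vector at time \<open>t\<close>,
  and on \<open>k\<close> such a vector exceeds \<open>1\<close> only slightly by
  \<open>dual_estimate\<close>. Thus \<open>rinner (k - k') k\<close> is hardly larger than
  \<open>\<mu>\<close>, while it equals \<open>\<mu>\<close> plus the squared distance; since
  \<open>\<mu>\<close> itself is at most the distance times \<open>norm W\<close>, one factor of the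
  distance cancels.\<close>

lemma nearest_dominated_close:
  assumes t: "t \<ge> 0" "t0 \<ge> 0" and k: "k \<in> dominated W t0"
    and close: "\<And>b. b \<in> unit_ball \<Longrightarrow> \<bar>rinner k (\<theta> t b k) - rinner k (\<theta> t0 b k)\<bar> \<le> \<epsilon>"
    and tau: "\<tau> > 0"
    and k': "k' \<in> dominated W t" "\<And>z. z \<in> dominated W t \<Longrightarrow> norm (k - k') \<le> norm (k - z)"
  shows "norm (k - k') \<le> norm W * (\<epsilon> / (2 * \<tau>)) + sqrt (\<tau> + \<epsilon>)"
proof -
  define y where "y = k - k'"
  define \<mu> where "\<mu> = rinner y k'"
  define A where "A = 1 + \<epsilon> / (2 * \<tau>)"
  define s where "s = sqrt (\<tau> + \<epsilon>)"
  have "id \<in> unit_ball" by (simp add: unit_ball_def M_id)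
  from close[OF this] have eps: "\<epsilon> \<ge> 0" by linarith
  have A: "A \<ge> 1" using eps tau by (simp add: A_def)
  have s: "s \<ge> 0" using eps tau by (simp add: s_def)
  have \<mu>: "0 \<le> \<mu>" using nearest_dual_approx(1)[OF t(1) k', of 1] by (simp add: \<mu>_def y_def)
  have step: "rinner y k \<le> \<mu> * A + norm y * s + \<eta> * (A + s + norm W)" if eta: "\<eta> > 0" for \<eta>
  proof -
    obtain e where e: "e \<in> convex hull (dual_set W t)" "norm (y - scaleR (\<mu> + \<eta>) e) \<le> \<eta>"
      using nearest_dual_approx(2)[OF t(1) k' eta] unfolding y_def[symmetric] \<mu>_def[symmetric] by blast
    let ?e = "scaleR (\<mu> + \<eta>) e"
    have "rinner y k = rinner ?e k + rinner (y - ?e) k" by (simp add: cinner_diff_left)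
    also have "rinner (y - ?e) k \<le> \<eta> * norm W"
      by (rule order_trans[OF rinner_le_norm mult_mono[OF e(2) dominated_norm_le[OF t(2) k]]])
         (use eta in auto)
    also have "rinner ?e k = (\<mu> + \<eta>) * rinner e k" by simp
    also have "\<dots> \<le> (\<mu> + \<eta>) * (A + norm e * s)"
      unfolding A_def s_def using dual_estimate[OF t k close tau e(1)] \<mu> eta by (intro mult_left_mono) auto
    also have "\<dots> = (\<mu> + \<eta>) * A + norm ?e * s" unfolding norm_scaleR using \<mu> eta by (simp add: distrib_left)
    also have "norm ?e \<le> norm y + \<eta>" using norm_triangle_ineq3[of y ?e] e(2) by linarith
    then have "norm ?e * s \<le> (norm y + \<eta>) * s" using s by (rule mult_right_mono)
    finally show ?thesis by (simp add: algebra_simps)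
  qed
  have "rinner y k \<le> \<mu> * A + norm y * s"
  proof (rule field_le_epsilon)
    fix d :: real assume d: "d > 0"
    have C: "A + s + norm W > 0" using A s by (smt (verit) norm_ge_zero)
    show "rinner y k \<le> \<mu> * A + norm y * s + d"
      using step[of "d / (A + s + norm W)"] d C by simp
  qed
  moreover have "rinner y k = (norm y)\<^sup>2 + \<mu>"
    by (simp add: \<mu>_def y_def cinner_diff_right flip: rinner_self)
  moreover have "\<mu> * A = \<mu> + \<mu> * (\<epsilon> / (2 * \<tau>))" by (simp add: A_def distrib_left)
  moreover have "\<mu> \<le> norm y * norm W"
    unfolding \<mu>_def
    by (rule order_trans[OF rinner_le_norm mult_left_mono[OF dominated_norm_le[OF t(1) k'(1)] norm_ge_zero]])
  then have "\<mu> * (\<epsilon> / (2 * \<tau>)) \<le> norm y * norm W * (\<epsilon> / (2 * \<tau>))"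
    using eps tau by (intro mult_right_mono) auto
  ultimately have "norm y * norm y \<le> norm y * (norm W * (\<epsilon> / (2 * \<tau>)) + s)"
    by (simp add: power2_eq_square distrib_left mult.assoc)
  moreover have "0 \<le> norm W * (\<epsilon> / (2 * \<tau>)) + s" using eps tau s by simp
  ultimately show ?thesis unfolding y_def[symmetric] s_def[symmetric]
    by (cases "y = 0") auto
qed

section \<open>Semicontinuity of the dominated sets\<close>

lemma dominated_lower_semicontinuous:
  assumes t0: "t0 \<ge> 0" and k: "k \<in> dominated W t0" and eta: "\<eta> > 0"
  obtains \<delta> where "\<delta> > 0"
    "\<And>t. t \<ge> 0 \<Longrightarrow> \<bar>t - t0\<bar> < \<delta> \<Longrightarrow> \<exists>k'\<in>dominated W t. norm (k - k') \<le> \<eta>"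
proof -
  \<comment> \<open>As \<open>\<epsilon> \<le> \<tau>\<close>, the root of
    \<open>\<tau> + \<epsilon>\<close> is at most that of \<open>2 * \<tau>\<close>, which is
    \<open>\<eta> / 2\<close>. The second entry of the minimum below gives the other half, and the
    added 1 there guards against \<open>W = 0\<close>.\<close>
  define \<tau> where "\<tau> = \<eta>\<^sup>2 / 8"
  have tau: "\<tau> > 0" using eta by (simp add: \<tau>_def)
  define \<epsilon> where "\<epsilon> = min \<tau> (\<tau> * \<eta> / (norm W + 1))"
  have W1: "norm W + 1 > 0" by (simp add: add_nonneg_pos)
  have eps: "\<epsilon> > 0" "\<epsilon> \<le> \<tau>" using tau eta W1 by (auto simp: \<epsilon>_def)
  obtain \<delta> where \<delta>: "\<delta> > 0" and close: "\<And>t b. 0 \<le> t \<Longrightarrow> \<bar>t - t0\<bar> < \<delta> \<Longrightarrow> b \<in> unit_ball \<Longrightarrow>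
       \<bar>rinner k (\<theta> t b k) - rinner k (\<theta> t0 b k)\<bar> \<le> \<epsilon>"
    by (rule norm_continuity[OF eps(1) t0]) blast
  have "\<exists>k'\<in>dominated W t. norm (k - k') \<le> \<eta>" if t: "t \<ge> 0" "\<bar>t - t0\<bar> < \<delta>" for t
  proof -
    obtain k' where k': "k' \<in> dominated W t" "\<And>z. z \<in> dominated W t \<Longrightarrow> norm (k - k') \<le> norm (k - z)"
      using nearest_point_exists[OF closed_dominated[OF t(1)] convex_dominated[OF t(1)]] zero_dominated[OF t(1)]
      by blast
    have "norm (k - k') \<le> norm W * (\<epsilon> / (2 * \<tau>)) + sqrt (\<tau> + \<epsilon>)"
      by (rule nearest_dominated_close[OF t(1) t0 k close[OF t] tau k'])
    also have "norm W * (\<epsilon> / (2 * \<tau>)) \<le> \<eta> / 2"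
    proof -
      have "\<epsilon> \<le> \<tau> * \<eta> / (norm W + 1)" by (simp add: \<epsilon>_def)
      then have "\<epsilon> * (norm W + 1) \<le> \<tau> * \<eta>" using W1 by (simp only: pos_le_divide_eq)
      then have "norm W * \<epsilon> \<le> \<tau> * \<eta>" using eps by (simp add: algebra_simps)
      then show ?thesis using tau by (simp add: field_simps)
    qed
    also have "sqrt (\<tau> + \<epsilon>) \<le> \<eta> / 2"
      by (rule real_le_lsqrt) (use eps eta in \<open>auto simp: \<tau>_def power2_eq_square\<close>)
    finally show ?thesis using k'(1) by force
  qed
  with \<delta> show ?thesis using that by blast
qed

text \<open>The outer normal \<open>W - k\<close> is approximated by a multiple of one finite convex
  combination of dual vectors. Replacing \<open>t0\<close> by \<open>t\<close> in that combination
  keeps it in the dual hull at time \<open>t\<close> and moves it continuously, so the supporting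
  half-space persists up to a small error.\<close>

lemma dominated_upper_semicontinuous:
  assumes t0: "t0 \<ge> 0" and k: "k \<in> dominated W t0"
    "\<And>z. z \<in> dominated W t0 \<Longrightarrow> norm (W - k) \<le> norm (W - z)" and eta: "\<eta> > 0"
  obtains \<delta> where "\<delta> > 0"
    "\<And>t z. t \<ge> 0 \<Longrightarrow> \<bar>t - t0\<bar> < \<delta> \<Longrightarrow> z \<in> dominated W t \<Longrightarrow> rinner (W - k) z \<le> rinner (W - k) k + \<eta>"
proof -
  define y where "y = W - k"
  define \<mu> where "\<mu> = rinner y k"
  define c where "c = norm W + 1"
  have c: "c > 0" by (simp add: c_def add_nonneg_pos)
  \<comment> \<open>Three errors occur: \<open>\<eta>1\<close> in the scale,
    \<open>\<eta>1 * norm W\<close> from approximating \<open>y\<close>, and, as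
    \<open>\<eta>2\<close> is chosen to match, another \<open>\<eta>1 * norm W\<close> from moving
    the combination. Together they stay below \<open>\<eta>\<close>.\<close>
  define \<eta>1 where "\<eta>1 = \<eta> / (2 * c)"
  have \<eta>1: "\<eta>1 > 0" using eta c by (simp add: \<eta>1_def)
  have \<mu>: "0 \<le> \<mu>" using nearest_dual_approx(1)[OF t0 k \<eta>1] by (simp add: \<mu>_def y_def)
  obtain e where e: "e \<in> convex hull (dual_set W t0)" "norm (y - scaleR (\<mu> + \<eta>1) e) \<le> \<eta>1"
    using nearest_dual_approx(2)[OF t0 k \<eta>1] unfolding y_def[symmetric] \<mu>_def[symmetric] by blast
  obtain n :: nat and u b z where u: "\<And>i. i \<in> {1..n} \<Longrightarrow> 0 \<le> u i" "(\<Sum>i=1..n. u i) = 1"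
    and b: "\<And>i. i \<in> {1..n} \<Longrightarrow> b i \<in> M" "\<And>i. i \<in> {1..n} \<Longrightarrow> norm (b i W) \<le> 1"
    and z: "\<And>i. i \<in> {1..n} \<Longrightarrow> norm (z i) \<le> 1"
    and e_eq: "e = (\<Sum>i=1..n. scaleR (u i) (\<theta> t0 (adjoint (b i)) (z i)))"
    by (rule convex_hull_dual_set[OF e(1)]) blast
  define E where "E t = (\<Sum>i=1..n. scaleR (u i) (\<theta> t (adjoint (b i)) (z i)))" for t
  have E_hull: "E t \<in> convex hull (dual_set W t)" for t
    unfolding E_def
    by (intro convex_sum convex_convex_hull hull_inc)
       (use u b z in \<open>simp_all add: dual_set_def, blast\<close>)
  have E_cont: "continuous_on {0..} E"
    unfolding E_def[abs_def] by (intro continuous_intros theta_cont M_adjoint b)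
  define \<eta>2 where "\<eta>2 = \<eta> / (2 * c * (\<mu> + \<eta>1))"
  have \<eta>2: "\<eta>2 > 0" using eta c \<mu> \<eta>1 by (simp add: \<eta>2_def)
  from E_cont[unfolded continuous_on_iff, rule_format, of t0 \<eta>2] t0 \<eta>2
  obtain \<delta> where \<delta>: "\<delta> > 0" "\<And>t. t \<ge> 0 \<Longrightarrow> \<bar>t - t0\<bar> < \<delta> \<Longrightarrow> norm (E t - E t0) < \<eta>2"
    by (auto simp: dist_norm)
  have bound: "rinner y x \<le> \<mu> + \<eta>" if t: "t \<ge> 0" "\<bar>t - t0\<bar> < \<delta>" and x: "x \<in> dominated W t" for t x
  proof -
    let ?s = "\<mu> + \<eta>1"
    have s: "?s > 0" using \<mu> \<eta>1 by simp
    have "y = scaleR ?s (E t) + ((y - scaleR ?s e) - scaleR ?s (E t - E t0))"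
      by (simp add: E_def e_eq scaleR_diff_right)
    then have "rinner y x = ?s * rinner (E t) x + rinner ((y - scaleR ?s e) - scaleR ?s (E t - E t0)) x"
      by (metis cinner_add_left plus_complex.sel(1) rinner_commute rinner_scaleR_right)
    also have "?s * rinner (E t) x \<le> ?s * 1"
      by (rule mult_left_mono[OF dominated_dual[OF t(1) x E_hull]]) (use s in simp)
    also have "rinner ((y - scaleR ?s e) - scaleR ?s (E t - E t0)) x \<le> (\<eta>1 + ?s * \<eta>2) * norm W"
    proof (rule order_trans[OF rinner_le_norm mult_mono])
      have "norm (scaleR ?s (E t - E t0)) \<le> ?s * \<eta>2" using \<delta>(2)[OF t] s by simp
      then show "norm ((y - scaleR ?s e) - scaleR ?s (E t - E t0)) \<le> \<eta>1 + ?s * \<eta>2"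
        using norm_triangle_ineq4[of "y - scaleR ?s e" "scaleR ?s (E t - E t0)"] e(2) by linarith
      show "norm x \<le> norm W" by (rule dominated_norm_le[OF t(1) x])
    qed (use s \<eta>1 \<eta>2 in auto)
    also have "?s * \<eta>2 = \<eta> / (2 * c)" using s c by (simp add: \<eta>2_def)
    also have "?s * 1 + (\<eta>1 + \<eta> / (2 * c)) * norm W \<le> \<mu> + \<eta>"
    proof -
      have "\<eta>1 * c = \<eta> / 2" using c by (simp add: \<eta>1_def)
      then have "\<eta>1 + \<eta>1 * norm W = \<eta> / 2" by (simp add: c_def algebra_simps)
      moreover have "\<eta> / (2 * c) = \<eta>1" by (simp add: \<eta>1_def)
      ultimately show ?thesis using \<eta>1 by (simp add: algebra_simps)
    qed
    finally show ?thesis by simp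
  qed
  show ?thesis by (rule that[OF \<delta>(1)]) (rule bound[unfolded \<mu>_def y_def])
qed

section \<open>The nearest dominated vector\<close>

definition nearest_dominated :: "'g \<Rightarrow> real \<Rightarrow> 'g" where
  "nearest_dominated W t = (SOME k. k \<in> dominated W t \<and> (\<forall>z\<in>dominated W t. norm (W - k) \<le> norm (W - z)))"

lemma nearest_dominated:
  assumes "t \<ge> 0"
  shows nearest_dominated_in: "nearest_dominated W t \<in> dominated W t"
    and nearest_dominated_le: "z \<in> dominated W t \<Longrightarrow> norm (W - nearest_dominated W t) \<le> norm (W - z)"
proof -
  have "dominated W t \<noteq> {}" using zero_dominated[OF assms] by blast
  then obtain k where "k \<in> dominated W t" "\<And>z. z \<in> dominated W t \<Longrightarrow> norm (W - k) \<le> norm (W - z)"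
    using nearest_point_exists[OF closed_dominated[OF assms] convex_dominated[OF assms], of W]
    by blast
  then have "\<exists>k. k \<in> dominated W t \<and> (\<forall>z\<in>dominated W t. norm (W - k) \<le> norm (W - z))" by blast
  from someI_ex[OF this] show "nearest_dominated W t \<in> dominated W t"
    "z \<in> dominated W t \<Longrightarrow> norm (W - nearest_dominated W t) \<le> norm (W - z)"
    unfolding nearest_dominated_def by blast+
qed

lemma nearest_dominated_0: "nearest_dominated W 0 = W"
proof -
  have "W \<in> dominated W 0" by (simp add: dominated_def theta_0)
  from nearest_dominated_le[OF _ this] show ?thesis by simp
qed

text \<open>Lower semicontinuity bounds the distance of \<open>W\<close> from the set at time
  \<open>t\<close> from above; upper semicontinuity confines that set to almost the same half-space.
  Both bounds enter the expansion of the squared distance between the two nearest points.\<close>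

lemma nearest_dominated_continuous: "continuous_on {0..} (nearest_dominated W)"
  unfolding continuous_on_iff
proof (intro ballI allI impI)
  fix t0 e :: real assume "t0 \<in> {0..}" and e: "e > 0"
  then have t0: "t0 \<ge> 0" by simp
  let ?k = "nearest_dominated W"
  define y where "y = W - ?k t0"
  define \<mu> where "\<mu> = rinner y (?k t0)"
  \<comment> \<open>The collected error is \<open>\<eta> * (2 * norm y + 3)\<close>, where
    \<open>\<eta> \<le> 1\<close> has been used to replace the square of \<open>\<eta>\<close> by
    \<open>\<eta>\<close>.\<close>
  define \<eta> where "\<eta> = min 1 (e\<^sup>2 / (2 * (2 * norm y + 3)))"
  have y3: "2 * norm y + 3 > 0" by (simp add: add_nonneg_pos)
  have eta: "\<eta> > 0" "\<eta> \<le> 1" using e y3 by (auto simp: \<eta>_def)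
  have "\<eta> \<le> e\<^sup>2 / (2 * (2 * norm y + 3))" by (simp add: \<eta>_def)
  then have "\<eta> * (2 * (2 * norm y + 3)) \<le> e\<^sup>2" using y3 by (subst (asm) pos_le_divide_eq) simp_all
  moreover have "\<eta> * (2 * norm y + 3) > 0" using eta y3 by simp
  ultimately have eta3: "\<eta> * (2 * norm y + 3) < e\<^sup>2" by (simp only: mult.left_commute[of \<eta> 2])
  note near = nearest_dominated_in[OF t0, of W] nearest_dominated_le[OF t0, of _ W]
  obtain \<delta>1 where \<delta>1: "\<delta>1 > 0"
    "\<And>t. t \<ge> 0 \<Longrightarrow> \<bar>t - t0\<bar> < \<delta>1 \<Longrightarrow> \<exists>k'\<in>dominated W t. norm (?k t0 - k') \<le> \<eta>"
    using dominated_lower_semicontinuous[OF t0 near(1) eta(1)] by blast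
  obtain \<delta>2 where \<delta>2: "\<delta>2 > 0"
    "\<And>t z. t \<ge> 0 \<Longrightarrow> \<bar>t - t0\<bar> < \<delta>2 \<Longrightarrow> z \<in> dominated W t \<Longrightarrow> rinner y z \<le> \<mu> + \<eta>"
    unfolding y_def \<mu>_def using dominated_upper_semicontinuous[OF t0 near eta(1)] by blast
  have "dist (?k t) (?k t0) < e" if t: "t \<in> {0..}" "dist t t0 < min \<delta>1 \<delta>2" for t
  proof -
    have t': "t \<ge> 0" "\<bar>t - t0\<bar> < \<delta>1" "\<bar>t - t0\<bar> < \<delta>2" using t by (auto simp: dist_real_def)
    obtain k' where k': "k' \<in> dominated W t" "norm (?k t0 - k') \<le> \<eta>" using \<delta>1(2)[OF t'(1,2)] by blast
    have "norm (W - ?k t) \<le> norm (W - k')" by (rule nearest_dominated_le[OF t'(1) k'(1)])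
    also have "\<dots> \<le> norm y + \<eta>"
      using norm_triangle_ineq[of "W - ?k t0" "?k t0 - k'"] k'(2) by (simp add: y_def)
    finally have "(norm (W - ?k t))\<^sup>2 \<le> (norm y + \<eta>)\<^sup>2" by (rule power_mono) simp
    also have "\<dots> = (norm y)\<^sup>2 + 2 * norm y * \<eta> + \<eta>\<^sup>2" by (simp add: power2_sum)
    also have "\<eta>\<^sup>2 \<le> \<eta>" using eta by (simp add: power2_eq_square mult_left_le)
    finally have 1: "(norm (W - ?k t))\<^sup>2 \<le> (norm y)\<^sup>2 + 2 * norm y * \<eta> + \<eta>" by simp
    have "rinner y (?k t) \<le> \<mu> + \<eta>" by (rule \<delta>2(2)[OF t'(1,3) nearest_dominated_in[OF t'(1)]])
    moreover have "rinner y W = (norm y)\<^sup>2 + \<mu>"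
      by (simp add: \<mu>_def y_def cinner_diff_right flip: rinner_self)
    ultimately have 2: "(norm y)\<^sup>2 - \<eta> \<le> rinner y (W - ?k t)" by (simp add: cinner_diff_right)
    have "(norm (?k t - ?k t0))\<^sup>2 = (norm (y - (W - ?k t)))\<^sup>2" by (simp add: y_def)
    also have "\<dots> = (norm y)\<^sup>2 + (norm (W - ?k t))\<^sup>2 - 2 * rinner y (W - ?k t)" by (rule norm_diff_sq)
    also have "\<dots> \<le> \<eta> * (2 * norm y + 3)" using 1 2 by (simp add: algebra_simps)
    also note eta3
    finally have "norm (?k t - ?k t0) < e" using e by (simp add: power2_less_imp_less)
    then show ?thesis by (simp add: dist_norm)
  qed
  then show "\<exists>d>0. \<forall>t\<in>{0..}. dist t t0 < d \<longrightarrow> dist (?k t) (?k t0) < e"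
    using \<delta>1(1) \<delta>2(1) by (intro exI[of _ "min \<delta>1 \<delta>2"]) auto
qed

text \<open>The projection onto the cyclic subspace commutes with \<open>M\<close> and fixes
  \<open>W\<close>. It therefore preserves domination and does not increase the distance from
  \<open>W\<close>, which forces it to fix the nearest point. Images of different orthogonal cyclic
  subspaces thus stay orthogonal.\<close>

lemma nearest_dominated_cyclic:
  assumes t: "t \<ge> 0" shows "nearest_dominated W t \<in> orbit_span M {W}"
proof -
  let ?k = "nearest_dominated W t" and ?p = "orth_proj (orbit_span M {W})"
  note orb = star_monoid_M
  have p: "?p \<in> commutant M" by (rule orbit_proj_commutant[OF orb])
  note plin = bounded_clinearD[OF commutantD(1)[OF p]]
  have "?p ?k \<in> dominated W t"
    unfolding dominated_def
  proof (intro CollectI ballI)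
    fix b assume b: "b \<in> M"
    have "norm (\<theta> t b (?p ?k)) = norm (?p (\<theta> t b ?k))" by (simp add: commutantD(2)[OF p theta_in[OF t b]])
    also have "\<dots> \<le> norm (\<theta> t b ?k)" by (rule orbit_proj_norm_le[OF orb])
    also have "\<dots> \<le> norm (b W)" by (rule dominatedD[OF nearest_dominated_in[OF t] b])
    finally show "norm (\<theta> t b (?p ?k)) \<le> norm (b W)" .
  qed
  then have "norm (W - ?k) \<le> norm (W - ?p ?k)" by (rule nearest_dominated_le[OF t])
  moreover have "?p W = W" using orbit_proj_fix[OF orb] orbit_span_incl[OF orb, of "{W}"] by blast
  then have "W - ?p ?k = ?p (W - ?k)" by (simp add: plin)
  ultimately have "(norm (W - ?k))\<^sup>2 \<le> (norm (?p (W - ?k)))\<^sup>2" by (simp add: power_mono)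
  then have "(norm ((W - ?k) - ?p (W - ?k)))\<^sup>2 \<le> 0"
    unfolding norm_diff_sq[of "W - ?k"] orbit_proj_norm[OF orb] by simp
  then have "W - ?k = ?p (W - ?k)" by simp
  then have "?k = ?p ?k" using \<open>?p W = W\<close> by (simp add: plin)
  then show ?thesis using orbit_proj_mem[OF orb, of "{W}" ?k] by simp
qed

end

section \<open>Contractive intertwiners near the identity\<close>

lemma cinner_closed_span_zero:
  assumes "\<And>g. g \<in> G \<Longrightarrow> cinner g y = 0" "x \<in> closure (span G)"
  shows "cinner x y = 0"
proof -
  have sp: "cinner v y = 0" if "v \<in> span G" for v
    using that by (induction rule: span_induct_alt) (auto simp: cinner_add_left assms(1))
  obtain f where f: "\<And>n. f n \<in> span G" "f \<longlonglongrightarrow> x" using assms(2) unfolding closure_sequential by blast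
  have "(\<lambda>n. cinner (f n) y) \<longlonglongrightarrow> cinner x y" by (intro tendsto_intros f)
  then show ?thesis using sp[OF f(1)] by (simp add: LIMSEQ_const_iff)
qed

lemma norm_sum_orthogonal:
  assumes "finite F" "\<And>v w. v \<in> F \<Longrightarrow> w \<in> F \<Longrightarrow> v \<noteq> w \<Longrightarrow> cinner (f v) (f w) = 0"
  shows "(norm (\<Sum>v\<in>F. f v))\<^sup>2 = (\<Sum>v\<in>F. (norm (f v))\<^sup>2)"
  using assms
proof (induction F rule: finite_induct)
  case (insert v F)
  have "cinner (f v) (\<Sum>w\<in>F. f w) = 0"
    unfolding cinner_sum_right using insert by (intro sum.neutral) auto
  then show ?case using insert by (simp add: norm_add_sq)
qed simp

lemma bounded_clinear_eqI_total:
  assumes "bounded_clinear A" "bounded_clinear B" "closure (span G) = UNIV" "\<And>g. g \<in> G \<Longrightarrow> A g = B g"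
  shows "A x = B x"
proof (rule bounded_clinear_eqI_dense[OF assms(1-3)])
  fix x assume "x \<in> span G"
  then show "A x = B x"
    by (induction rule: span_induct_alt)
       (auto simp: bounded_clinearD[OF assms(1)] bounded_clinearD[OF assms(2)] assms(4))
qed

lemma contraction_family_continuous:
  fixes C :: "real \<Rightarrow> 'g::complex_hilbert \<Rightarrow> 'g"
  assumes C: "\<And>t. t \<in> T \<Longrightarrow> bounded_clinear (C t)" "\<And>t x. t \<in> T \<Longrightarrow> norm (C t x) \<le> norm x"
    and tot: "closure (span G) = UNIV" and gen: "\<And>g. g \<in> G \<Longrightarrow> continuous_on T (\<lambda>t. C t g)"
  shows "continuous_on T (\<lambda>t. C t x)"
proof -
  have sp: "continuous_on T (\<lambda>t. C t v)" if "v \<in> span G" for v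
    using that
  proof (induction rule: span_induct_alt)
    case base
    have "continuous_on T (\<lambda>t. 0::'g)" by simp
    then show ?case by (rule continuous_on_eq) (simp add: bounded_clinearD(5)[OF C(1)])
  next
    case (step r v u)
    have "continuous_on T (\<lambda>t. scaleR r (C t v) + C t u)"
      by (intro continuous_intros step(2) gen step(1))
    then show ?case
      by (rule continuous_on_eq) (simp add: bounded_clinearD(2)[OF C(1)] bounded_clinearD(4)[OF C(1)])
  qed
  obtain f where f: "\<And>n. f n \<in> span G" "f \<longlonglongrightarrow> x" using tot closure_sequential[of x "span G"] by auto
  show ?thesis
  proof (rule uniform_limit_theorem[where F = sequentially and f = "\<lambda>n t. C t (f n)"])
    show "\<forall>\<^sub>F n in sequentially. continuous_on T (\<lambda>t. C t (f n))" using sp[OF f(1)] by simp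
    show "uniform_limit T (\<lambda>n t. C t (f n)) (\<lambda>t. C t x) sequentially"
    proof (rule uniform_limitI)
      fix e :: real assume "e > 0"
      then have "\<forall>\<^sub>F n in sequentially. dist (f n) x < e" by (rule tendstoD[OF f(2)])
      then show "\<forall>\<^sub>F n in sequentially. \<forall>t\<in>T. dist (C t (f n)) (C t x) < e"
      proof (rule eventually_mono)
        fix n assume n: "dist (f n) x < e"
        have "norm (C t (f n) - C t x) \<le> norm (f n - x)" if "t \<in> T" for t
          using C(2)[OF that, of "f n - x"] by (simp add: bounded_clinearD(6)[OF C(1)[OF that]])
        then show "\<forall>t\<in>T. dist (C t (f n)) (C t x) < e" using n by (force simp: dist_norm)
      qed
    qed
  qed simp
qed

context von_neumann
begin

text \<open>In a maximal family nothing is missing: the component of a vector orthogonal to the span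
  could be added. Orthogonality to \<open>M\<close>-orbits must hold in both orders, and the second
  follows by moving \<open>b\<close> across as an adjoint.\<close>

lemma orthogonal_cyclic_family:
  obtains B where "\<And>v w b. v \<in> B \<Longrightarrow> w \<in> B \<Longrightarrow> v \<noteq> w \<Longrightarrow> b \<in> M \<Longrightarrow> cinner v (b w) = 0"
    "orbit_span M B = UNIV"
proof -
  define \<A> where "\<A> = {B. 0 \<notin> B \<and> (\<forall>v\<in>B. \<forall>w\<in>B. v \<noteq> w \<longrightarrow> (\<forall>b\<in>M. cinner v (b w) = 0))}"
  have "\<exists>B\<in>\<A>. \<forall>X\<in>\<A>. B \<subseteq> X \<longrightarrow> X = B"
  proof (rule subset_Zorn_nonempty)
    show "\<A> \<noteq> {}" by (auto simp: \<A>_def)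
    fix \<C> assume ne: "\<C> \<noteq> {}" and ch: "subset.chain \<A> \<C>"
    have sub: "\<C> \<subseteq> \<A>" and lin: "\<And>X Y. X \<in> \<C> \<Longrightarrow> Y \<in> \<C> \<Longrightarrow> X \<subseteq> Y \<or> Y \<subseteq> X"
      using ch by (auto simp: subset.chain_def)
    show "\<Union>\<C> \<in> \<A>"
      unfolding \<A>_def
    proof (intro CollectI conjI ballI impI)
      show "0 \<notin> \<Union>\<C>" using sub by (auto simp: \<A>_def)
      fix v w b assume vw: "v \<in> \<Union>\<C>" "w \<in> \<Union>\<C>" "v \<noteq> w" "b \<in> M"
      then obtain X Y where "X \<in> \<C>" "Y \<in> \<C>" "v \<in> X" "w \<in> Y" by blast
      then obtain Z where "Z \<in> \<C>" "v \<in> Z" "w \<in> Z" using lin by blast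
      then have "Z \<in> \<A>" using sub by blast
      then show "cinner v (b w) = 0" using \<open>v \<in> Z\<close> \<open>w \<in> Z\<close> vw(3,4) unfolding \<A>_def by blast
    qed
  qed
  then obtain B where B: "B \<in> \<A>" "\<And>X. X \<in> \<A> \<Longrightarrow> B \<subseteq> X \<Longrightarrow> X = B" by blast
  have B_orth: "cinner v (b w) = 0" if "v \<in> B" "w \<in> B" "v \<noteq> w" "b \<in> M" for v w b
    using B(1) that unfolding \<A>_def by blast
  have "x \<in> orbit_span M B" for x
  proof (rule ccontr)
    assume x: "x \<notin> orbit_span M B"
    note orb = star_monoid_M
    define v where "v = x - orth_proj (orbit_span M B) x"
    have v0: "v \<noteq> 0" using x orbit_proj_mem[OF orb, of B x] by (auto simp: v_def)
    have perp: "cinner y v = 0" if "y \<in> orbit_span M B" for y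
      unfolding v_def by (rule orbit_proj_orth[OF orb that])
    have perp': "cinner v y = 0" if "y \<in> orbit_span M B" for y
      using perp[OF that] cinner_commute[of v y] by simp
    have "v \<notin> B"
    proof
      assume "v \<in> B"
      then have "cinner v v = 0" using perp orbit_span_incl[OF orb, of B] by blast
      then show False using v0 by (simp add: cinner_self)
    qed
    have 1: "cinner v (b w) = 0" if "w \<in> B" "b \<in> M" for w b
      by (rule perp'[OF orbit_span_gen[OF that(2,1)]])
    have 2: "cinner w (b v) = 0" if "w \<in> B" "b \<in> M" for w b
      using perp[OF orbit_span_gen[OF M_adjoint[OF that(2)] that(1)]]
      by (simp add: cinner_adjoint_left[OF M_bounded[OF that(2)]])
    have "insert v B \<in> \<A>"
      using B(1) v0 1 2 unfolding \<A>_def by simp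
    then have "insert v B = B" by (rule B(2)) blast
    then show False using \<open>v \<notin> B\<close> by blast
  qed
  then show ?thesis using that[of B] B_orth by blast
qed

lemma orbit_spans_orthogonal:
  assumes "\<And>b. b \<in> M \<Longrightarrow> cinner v (b w) = 0" "x \<in> orbit_span M {v}" "y \<in> orbit_span M {w}"
  shows "cinner x y = 0"
proof (rule cinner_closed_span_zero[OF _ assms(2)[unfolded orbit_span_def]])
  fix g assume "g \<in> {a x |a x. a \<in> M \<and> x \<in> {v}}"
  then obtain a where a: "g = a v" "a \<in> M" by blast
  have "cinner y g = 0"
  proof (rule cinner_closed_span_zero[OF _ assms(3)[unfolded orbit_span_def]])
    fix h assume "h \<in> {a x |a x. a \<in> M \<and> x \<in> {w}}"
    then obtain b where b: "h = b w" "b \<in> M" by blast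
    have "cinner g h = cinner v ((adjoint a \<circ> b) w)" by (simp add: a(1) b(1) cinner_adjoint[OF M_bounded[OF a(2)]])
    also have "\<dots> = 0" by (rule assms(1)[OF M_compose[OF M_adjoint[OF a(2)] b(2)]])
    finally show "cinner h g = 0" using cinner_commute[of h g] by simp
  qed
  then show "cinner g y = 0" using cinner_commute[of g y] by simp
qed

end

context E0
begin

text \<open>The prescription lives on finite sums whose coefficients are not determined by the sum.
  Pythagoras on both sides, one cyclic subspace at a time, yields the norm bound from which the
  extension lemma deduces that it is well defined.\<close>

lemma contractive_intertwiner:
  assumes orth: "\<And>v w b. v \<in> B \<Longrightarrow> w \<in> B \<Longrightarrow> v \<noteq> w \<Longrightarrow> b \<in> M \<Longrightarrow> cinner v (b w) = 0"
    and tot: "orbit_span M B = UNIV" and t: "t \<ge> 0"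
  shows "\<exists>C. bounded_clinear C \<and> (\<forall>x. norm (C x) \<le> norm x) \<and>
    (\<forall>b\<in>M. \<forall>w\<in>B. C (b w) = \<theta> t b (nearest_dominated w t))"
proof -
  interpret star_endo M "\<theta> t" using t by (rule theta_endo)
  let ?k = "\<lambda>w. nearest_dominated w t"
  \<comment> \<open>Coefficients are members of \<open>M\<close> everywhere and zero off
    \<open>F\<close>, so families with different supports can be added over the union.\<close>
  define P where "P F b \<longleftrightarrow> finite F \<and> F \<subseteq> B \<and> (\<forall>w. b w \<in> M) \<and> (\<forall>w. w \<notin> F \<longrightarrow> b w = (\<lambda>x. 0))"
    for F and b :: "'g \<Rightarrow> 'g \<Rightarrow> 'g"
  define V where "V = {(\<Sum>w\<in>F. b w w, \<Sum>w\<in>F. \<theta> t (b w) (?k w)) | F b. P F b}"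
  have VI: "(x, y) \<in> V" if "P F b" "x = (\<Sum>w\<in>F. b w w)" "y = (\<Sum>w\<in>F. \<theta> t (b w) (?k w))" for F b x y
    unfolding V_def using that by blast
  have add: "(x + x', y + y') \<in> V" if xy: "(x, y) \<in> V" "(x', y') \<in> V" for x y x' y'
  proof -
    obtain F b F' b' where 1: "x = (\<Sum>w\<in>F. b w w)" "y = (\<Sum>w\<in>F. \<theta> t (b w) (?k w))" "P F b"
      "x' = (\<Sum>w\<in>F'. b' w w)" "y' = (\<Sum>w\<in>F'. \<theta> t (b' w) (?k w))" "P F' b'"
      using xy unfolding V_def by blast
    let ?c = "\<lambda>w v. b w v + b' w v"
    have fin: "finite F" "finite F'" using 1 by (auto simp: P_def)
    have bM: "b w \<in> M" "b' w \<in> M" for w using 1 by (auto simp: P_def)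
    have out: "w \<notin> F \<Longrightarrow> b w = (\<lambda>x. 0)" "w \<notin> F' \<Longrightarrow> b' w = (\<lambda>x. 0)" for w using 1 by (auto simp: P_def)
    have "(\<Sum>w\<in>F. b w w) = (\<Sum>w\<in>F \<union> F'. b w w)" "(\<Sum>w\<in>F'. b' w w) = (\<Sum>w\<in>F \<union> F'. b' w w)"
      "(\<Sum>w\<in>F. \<theta> t (b w) (?k w)) = (\<Sum>w\<in>F \<union> F'. \<theta> t (b w) (?k w))"
      "(\<Sum>w\<in>F'. \<theta> t (b' w) (?k w)) = (\<Sum>w\<in>F \<union> F'. \<theta> t (b' w) (?k w))"
      using fin out by (auto intro!: sum.mono_neutral_left simp: endo_zero)
    then have "x + x' = (\<Sum>w\<in>F \<union> F'. ?c w w)" "y + y' = (\<Sum>w\<in>F \<union> F'. \<theta> t (?c w) (?k w))"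
      unfolding 1 by (simp_all add: sum.distrib endo_add[OF bM])
    moreover have "P (F \<union> F') ?c" using 1 M_add[OF bM] by (auto simp: P_def)
    ultimately show ?thesis by (intro VI[of "F \<union> F'" ?c])
  qed
  have scl: "(scaleC c x, scaleC c y) \<in> V" if xy: "(x, y) \<in> V" for c x y
  proof -
    obtain F b where 1: "x = (\<Sum>w\<in>F. b w w)" "y = (\<Sum>w\<in>F. \<theta> t (b w) (?k w))" "P F b"
      using xy unfolding V_def by blast
    let ?c = "\<lambda>w v. scaleC c (b w v)"
    have bM: "b w \<in> M" for w using 1 by (auto simp: P_def)
    have "scaleC c x = (\<Sum>w\<in>F. ?c w w)" "scaleC c y = (\<Sum>w\<in>F. \<theta> t (?c w) (?k w))"
      unfolding 1 by (simp_all add: scaleC_sum_right endo_scaleC[OF bM])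
    moreover have "P F ?c" using 1 M_scaleC[OF bM] by (auto simp: P_def)
    ultimately show ?thesis by (intro VI[of F ?c])
  qed
  have contr: "norm y \<le> norm x" if xy: "(x, y) \<in> V" for x y
  proof -
    obtain F b where 1: "x = (\<Sum>w\<in>F. b w w)" "y = (\<Sum>w\<in>F. \<theta> t (b w) (?k w))" "P F b"
      using xy unfolding V_def by blast
    have bM: "b w \<in> M" for w using 1 by (auto simp: P_def)
    have fin: "finite F" and FB: "F \<subseteq> B" using 1 by (auto simp: P_def)
    have o: "cinner p q = 0" if "v \<in> F" "w \<in> F" "v \<noteq> w" "p \<in> orbit_span M {v}" "q \<in> orbit_span M {w}" for v w p q
      by (rule orbit_spans_orthogonal[OF _ that(4,5)], rule orth) (use that FB in auto)
    have cyc: "\<theta> t (b w) (?k w) \<in> orbit_span M {w}" for w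
      by (rule orbit_span_invariant[OF star_monoid_M endo_in[OF bM] nearest_dominated_cyclic[OF t]])
    have cyc': "b w w \<in> orbit_span M {w}" for w by (rule orbit_span_gen[OF bM]) simp
    have "(norm y)\<^sup>2 = (\<Sum>w\<in>F. (norm (\<theta> t (b w) (?k w)))\<^sup>2)"
      unfolding 1(2) by (rule norm_sum_orthogonal[OF fin]) (rule o[OF _ _ _ cyc cyc])
    also have "\<dots> \<le> (\<Sum>w\<in>F. (norm (b w w))\<^sup>2)"
      by (intro sum_mono power_mono dominatedD[OF nearest_dominated_in[OF t]] bM norm_ge_zero)
    also have "\<dots> = (norm x)\<^sup>2"
      unfolding 1(1) by (rule norm_sum_orthogonal[OF fin, symmetric]) (rule o[OF _ _ _ cyc' cyc'])
    finally show ?thesis by (rule power2_le_imp_le) simp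
  qed
  have gen: "(b w, \<theta> t b (?k w)) \<in> V" if "b \<in> M" "w \<in> B" for b w
  proof -
    let ?b = "\<lambda>v. if v = w then b else (\<lambda>x. 0)"
    have "P {w} ?b" using that M_zero by (auto simp: P_def)
    then show ?thesis by (rule VI) simp_all
  qed
  let ?G = "{a x |a x. a \<in> M \<and> x \<in> B}"
  have "(0, 0) \<in> V" by (rule VI[of "{}" "\<lambda>w x. 0"]) (simp_all add: P_def M_zero)
  then have zero: "0 \<in> fst ` V" by force
  have "v \<in> fst ` V" if "v \<in> span ?G" for v
    using that
  proof (induction rule: span_induct_alt)
    case base show ?case by (rule zero)
  next
    case (step r v u)
    then obtain a x where "v = a x" "a \<in> M" "x \<in> B" by blast
    then have "(scaleR r v, scaleR r (\<theta> t a (?k x))) \<in> V" using scl[OF gen[of a x], of "of_real r"] by (simp add: scaleR_scaleC)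
    moreover obtain u' where "(u, u') \<in> V" using step by force
    ultimately have "(scaleR r v + u, scaleR r (\<theta> t a (?k x)) + u') \<in> V" by (rule add)
    then show ?case by force
  qed
  then have "closure (span ?G) \<subseteq> closure (fst ` V)" by (intro closure_mono) blast
  then have dense: "closure (fst ` V) = UNIV" using tot by (auto simp: orbit_span_def)
  obtain C where "bounded_clinear C" "\<And>x y. (x, y) \<in> V \<Longrightarrow> C x = y" "\<And>x. norm (C x) \<le> norm x"
    using contraction_extension[OF add scl contr dense] by blast
  then show ?thesis using gen by (intro exI[of _ C]) blast
qed

text \<open>Strong continuity holds for fixed vectors; the bound on \<open>\<theta> t b\<close>,
  uniform in \<open>t\<close>, lets the vector move as well.\<close>

lemma theta_continuous_compose:
  assumes b: "b \<in> M" and f: "continuous_on {0..} f"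
  shows "continuous_on {0..} (\<lambda>t. \<theta> t b (f t))"
  unfolding continuous_on_def
proof
  fix t0 :: real assume t0: "t0 \<in> {0..}"
  obtain K where K: "K \<ge> 0" "\<And>x. norm (b x) \<le> K * norm x" using bounded_clinear_bound[OF M_bounded[OF b]] by blast
  have f0: "((\<lambda>t. f t - f t0) \<longlongrightarrow> 0) (at t0 within {0..})"
    using f t0 by (intro LIM_zero) (simp add: continuous_on_def)
  have "((\<lambda>t. \<theta> t b (f t - f t0)) \<longlongrightarrow> 0) (at t0 within {0..})"
  proof (rule Lim_null_comparison)
    show "\<forall>\<^sub>F t in at t0 within {0..}. norm (\<theta> t b (f t - f t0)) \<le> K * norm (f t - f t0)"
      unfolding eventually_at_filter
      by (rule always_eventually) (use theta_norm_le[OF _ b K] in auto)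
    show "((\<lambda>t. K * norm (f t - f t0)) \<longlongrightarrow> 0) (at t0 within {0..})"
      by (intro tendsto_mult_right_zero tendsto_norm_zero f0)
  qed
  moreover have "((\<lambda>t. \<theta> t b (f t0)) \<longlongrightarrow> \<theta> t0 b (f t0)) (at t0 within {0..})"
    using theta_cont[OF b, of "f t0"] t0 by (simp add: continuous_on_def)
  ultimately have "((\<lambda>t. \<theta> t b (f t - f t0) + \<theta> t b (f t0)) \<longlongrightarrow> 0 + \<theta> t0 b (f t0)) (at t0 within {0..})"
    by (rule tendsto_add)
  then have "((\<lambda>t. \<theta> t b (f t - f t0) + \<theta> t b (f t0)) \<longlongrightarrow> \<theta> t0 b (f t0)) (at t0 within {0..})" by simp
  then show "((\<lambda>t. \<theta> t b (f t)) \<longlongrightarrow> \<theta> t0 b (f t0)) (at t0 within {0..})"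
  proof (rule Lim_transform_eventually)
    show "\<forall>\<^sub>F t in at t0 within {0..}. \<theta> t b (f t - f t0) + \<theta> t b (f t0) = \<theta> t b (f t)"
      unfolding eventually_at_filter
      by (rule always_eventually) (auto simp: M_lin(6)[OF theta_in[OF _ b]])
  qed
qed

lemma continuous_intertwiners:
  obtains C where "\<And>t. t \<ge> 0 \<Longrightarrow> C t \<in> intertwiners M \<theta> t"
    "\<And>t x. t \<ge> 0 \<Longrightarrow> norm (C t x) \<le> norm x" "C 0 = id"
    "\<And>x. continuous_on {0..} (\<lambda>t. C t x)"
proof -
  obtain B where orth: "\<And>v w b. v \<in> B \<Longrightarrow> w \<in> B \<Longrightarrow> v \<noteq> w \<Longrightarrow> b \<in> M \<Longrightarrow> cinner v (b w) = 0"
    and tot: "orbit_span M B = UNIV" by (rule orthogonal_cyclic_family) blast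
  let ?G = "{a x |a x. a \<in> M \<and> x \<in> B}"
  have tot': "closure (span ?G) = UNIV" using tot by (simp add: orbit_span_def)
  have "\<exists>C. bounded_clinear C \<and> (\<forall>x. norm (C x) \<le> norm x) \<and>
    (\<forall>b\<in>M. \<forall>w\<in>B. C (b w) = \<theta> t b (nearest_dominated w t))" if "t \<ge> 0" for t
    by (rule contractive_intertwiner[OF _ tot that]) (rule orth)
  then have "\<forall>t. \<exists>C. t \<ge> 0 \<longrightarrow> bounded_clinear C \<and> (\<forall>x. norm (C x) \<le> norm x) \<and>
    (\<forall>b\<in>M. \<forall>w\<in>B. C (b w) = \<theta> t b (nearest_dominated w t))" by blast
  then obtain C where C: "\<And>t. t \<ge> 0 \<Longrightarrow> bounded_clinear (C t)" "\<And>t x. t \<ge> 0 \<Longrightarrow> norm (C t x) \<le> norm x"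
    "\<And>t b w. t \<ge> 0 \<Longrightarrow> b \<in> M \<Longrightarrow> w \<in> B \<Longrightarrow> C t (b w) = \<theta> t b (nearest_dominated w t)"
    by metis
  have "C t \<in> intertwiners M \<theta> t" if t: "t \<ge> 0" for t
  proof -
    interpret star_endo M "\<theta> t" using t by (rule theta_endo)
    have "(\<theta> t a \<circ> C t) x = (C t \<circ> a) x" if a: "a \<in> M" for a x
    proof (rule bounded_clinear_eqI_total[where A = "\<theta> t a \<circ> C t" and B = "C t \<circ> a", OF _ _ tot'])
      show "bounded_clinear (\<theta> t a \<circ> C t)" "bounded_clinear (C t \<circ> a)"
        by (intro bounded_clinear_compose M_bounded endo_in a C(1) t)+
      fix g assume "g \<in> ?G"
      then obtain b w where g: "g = b w" "b \<in> M" "w \<in> B" by blast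
      show "(\<theta> t a \<circ> C t) g = (C t \<circ> a) g"
        using C(3)[OF t M_compose[OF a g(2)] g(3)] C(3)[OF t g(2,3)] by (simp add: g(1) endo_compose[OF a g(2)])
    qed
    then show ?thesis using C(1)[OF t] by (auto simp: intertwiners_def)
  qed
  moreover have "C 0 = id"
  proof
    fix x show "C 0 x = id x"
    proof (rule bounded_clinear_eqI_total[where A = "C 0" and B = id, OF C(1) bounded_clinear_id tot'])
      fix g assume "g \<in> ?G"
      then show "C 0 g = id g" using C(3)[of 0] by (auto simp: nearest_dominated_0 theta_0)
    qed simp
  qed
  moreover have "continuous_on {0..} (\<lambda>t. C t x)" for x
  proof (rule contraction_family_continuous[OF _ _ tot'])
    fix g assume "g \<in> ?G"
    then obtain b w where g: "g = b w" "b \<in> M" "w \<in> B" by blast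
    have "continuous_on {0..} (\<lambda>t. \<theta> t b (nearest_dominated w t))"
      by (rule theta_continuous_compose[OF g(2) nearest_dominated_continuous])
    then show "continuous_on {0..} (\<lambda>t. C t g)"
      by (rule continuous_on_eq) (simp add: g C(3))
  qed (use C in auto)
  ultimately show ?thesis using that[of C] C(2) by blast
qed

section \<open>Products, adjoints and combinations of intertwiners\<close>

lemma intertwiner_compose:
  assumes "r \<ge> 0" "t \<ge> 0" "C \<in> intertwiners M \<theta> r" "x \<in> intertwiners M \<theta> t"
  shows "C \<circ> x \<in> intertwiners M \<theta> (r + t)"
proof -
  have C: "bounded_clinear C" "\<And>b v. b \<in> M \<Longrightarrow> \<theta> r b (C v) = C (b v)"
    and x: "bounded_clinear x" "\<And>b v. b \<in> M \<Longrightarrow> \<theta> t b (x v) = x (b v)"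
    using assms(3,4) by (auto simp: intertwiners_def fun_eq_iff)
  show ?thesis using C x theta_add[OF assms(1,2)] theta_in[OF assms(2)] bounded_clinear_compose[OF C(1) x(1)]
    by (auto simp: intertwiners_def fun_eq_iff)
qed

text \<open>The adjoint of \<open>C\<close> satisfies the reversed intertwining relation and so
  strips the factor \<open>\<theta> r\<close> off \<open>\<theta> (r + t)\<close>. This is the only
  way backwards in time.\<close>

lemma intertwiner_adjoint_compose:
  assumes rt: "r \<ge> 0" "t \<ge> 0" and C: "C \<in> intertwiners M \<theta> r" and x: "x \<in> intertwiners M \<theta> (r + t)"
  shows "adjoint C \<circ> x \<in> intertwiners M \<theta> t"
proof -
  have C: "bounded_clinear C" "\<And>b v. b \<in> M \<Longrightarrow> \<theta> r b (C v) = C (b v)"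
    and x: "bounded_clinear x" "\<And>b v. b \<in> M \<Longrightarrow> \<theta> (r + t) b (x v) = x (b v)"
    using C x by (auto simp: intertwiners_def fun_eq_iff)
  have "\<theta> t b (adjoint C v) = adjoint C (\<theta> (r + t) b v)" if b: "b \<in> M" for b v
  proof (rule cinner_eqI)
    fix z
    have "cinner z (\<theta> t b (adjoint C v)) = cinner (C (\<theta> t (adjoint b) z)) v"
      using rt b C by (simp add: cinner_theta_adjoint[symmetric] cinner_adjoint)
    also have "C (\<theta> t (adjoint b) z) = \<theta> (r + t) (adjoint b) (C z)"
      using C(2)[OF theta_in[OF rt(2) M_adjoint[OF b]]] theta_add[OF rt M_adjoint[OF b]] by simp
    also have "cinner \<dots> v = cinner z (adjoint C (\<theta> (r + t) b v))"
      using rt b C by (simp add: cinner_theta_adjoint cinner_adjoint)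
    finally show "cinner z (\<theta> t b (adjoint C v)) = cinner z (adjoint C (\<theta> (r + t) b v))" .
  qed
  then show ?thesis using C x bounded_clinear_compose[OF bounded_clinear_adjoint[OF C(1)] x(1)]
    by (auto simp: intertwiners_def fun_eq_iff)
qed

text \<open>Membership is asked only where the coefficient is nonzero, because a hat function
  vanishes at the times at which its operator is not an intertwiner.\<close>

lemma intertwiner_combination:
  assumes "t \<ge> 0" "finite I" "\<And>i. i \<in> I \<Longrightarrow> c i \<noteq> 0 \<Longrightarrow> x i \<in> intertwiners M \<theta> t"
  shows "(\<lambda>v. \<Sum>i\<in>I. scaleR (c i) (x i v)) \<in> intertwiners M \<theta> t"
  using assms(2,3)
proof (induction I rule: finite_induct)
  case empty
  show ?case using assms(1) by (auto simp: intertwiners_def bounded_clinear_zero fun_eq_iff M_lin(5)[OF theta_in])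
next
  case (insert i I)
  let ?s = "\<lambda>v. \<Sum>i\<in>I. scaleR (c i) (x i v)"
  have s: "bounded_clinear ?s" "\<And>b v. b \<in> M \<Longrightarrow> \<theta> t b (?s v) = ?s (b v)"
    using insert by (auto simp: intertwiners_def fun_eq_iff)
  show ?case
  proof (cases "c i = 0")
    case True
    then show ?thesis using insert by simp
  next
    case False
    then have x: "bounded_clinear (x i)" "\<And>b v. b \<in> M \<Longrightarrow> \<theta> t b (x i v) = x i (b v)"
      using insert.prems by (auto simp: intertwiners_def fun_eq_iff)
    have "bounded_clinear (\<lambda>v. scaleR (c i) (x i v) + ?s v)"
      using bounded_clinear_add[OF bounded_clinear_scaleC[OF x(1), of "of_real (c i)"] s(1)]
      by (simp add: scaleR_scaleC)
    then show ?thesis using insert.hyps s x assms(1)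
      by (auto simp: intertwiners_def fun_eq_iff M_lin[OF theta_in])
  qed
qed

end

section \<open>Sections through a given intertwiner\<close>

text \<open>Among contractions, strong closeness to the identity passes to adjoints: both defects
  are governed by \<open>(norm v)^2 - rinner v (A v)\<close>.\<close>

lemma adjoint_contraction_defect:
  assumes "bounded_clinear A" "\<And>x. norm (A x) \<le> norm x"
  shows "(norm (adjoint A v - v))\<^sup>2 \<le> 2 * norm v * norm (A v - v)"
proof -
  have "norm (adjoint A v) \<le> norm v" using adjoint_norm_le[OF assms(1), of 1 v] assms(2) by simp
  then have "(norm (adjoint A v))\<^sup>2 \<le> (norm v)\<^sup>2" by (simp add: power_mono)
  then have "(norm (adjoint A v - v))\<^sup>2 \<le> 2 * ((norm v)\<^sup>2 - rinner v (A v))"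
    unfolding norm_diff_sq cinner_adjoint_left[OF assms(1)] by simp
  also have "(norm v)\<^sup>2 - rinner v (A v) = rinner v (v - A v)" by (simp add: cinner_diff_right rinner_self)
  also have "\<dots> \<le> norm v * norm (A v - v)" using rinner_le_norm[of v "v - A v"] by (simp add: norm_minus_commute)
  finally show ?thesis by simp
qed

context E0
begin

text \<open>To the left of \<open>s\<close>, intertwiners are propagated backwards from \<open>s\<close> to the times \<open>s - 1/n\<close> by adjoints,
  whose strong continuity is only known at \<open>0\<close>, and then forwards; the pieces are interpolated by
  hat functions in the variable \<open>1 / (s - t)\<close>.\<close>

lemma left_section:
  assumes C: "\<And>t. t \<ge> 0 \<Longrightarrow> C t \<in> intertwiners M \<theta> t"
    "\<And>t x. t \<ge> 0 \<Longrightarrow> norm (C t x) \<le> norm x" "C 0 = id"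
    "\<And>x. continuous_on {0..} (\<lambda>t. C t x)"
    and s: "s > 0" and x': "x' \<in> intertwiners M \<theta> s"
  shows "\<exists>X. (\<forall>t\<ge>0. t < s \<longrightarrow> X t \<in> intertwiners M \<theta> t) \<and>
    (\<forall>g. continuous_on {0..<s} (\<lambda>t. X t g) \<and> ((\<lambda>t. X t g) \<longlongrightarrow> x' g) (at_left s))"
proof -
  have Cb: "bounded_clinear (C t)" if "t \<ge> 0" for t using C(1)[OF that] by (simp add: intertwiners_def)
  obtain N0 :: nat where N0: "N0 > 0" "inverse (real N0) < s" using s ex_inverse_of_nat_less by blast
  define u where "u n = s - 1 / real n" for n :: nat
  define Y where "Y n = adjoint (C (1 / real n)) \<circ> x'" for n :: nat
  \<comment> \<open>A ramp rising from 0 to 1 while \<open>1 / (s - t)\<close> runs from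
    \<open>n\<close> to \<open>n + 1\<close>. Differences of consecutive ramps are hats on
    \<open>(n, n + 2)\<close>, and they telescope to 1 once \<open>1 / (s - t)\<close> exceeds
    \<open>N0 + 1\<close>.\<close>
  define \<rho> where "\<rho> n t = max 0 (min 1 (1 / (s - t) - real n))" for n and t :: real
  define w where "w n t = \<rho> n t - \<rho> (Suc n) t" for n and t :: real
  \<comment> \<open>The cut-off at 0 only keeps \<open>Z\<close> defined and continuous before time
    \<open>u n\<close>; the weight vanishes there.\<close>
  define Z where "Z n t = C (max 0 (t - u n)) \<circ> Y n" for n t
  \<comment> \<open>No weight is active for \<open>n \<ge> 1 / (s - t)\<close>, so truncation loses
    nothing. Far from \<open>s\<close> no weight from \<open>N0\<close> on is active and
    \<open>X t\<close> is zero, which is an intertwiner as well.\<close>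
  define X where "X t = (\<lambda>g. \<Sum>n\<in>{N0..nat \<lceil>1 / (s - t)\<rceil>}. scaleR (w n t) (Z n t g))" for t
  have u0: "0 \<le> u n" if "n \<ge> N0" for n
  proof -
    have "1 / real n \<le> 1 / real N0" using that N0 by (intro divide_left_mono) auto
    then show ?thesis using N0 by (simp add: u_def inverse_eq_divide)
  qed
  have w_nonneg: "0 \<le> w n t" for n t by (simp add: w_def \<rho>_def)
  have w_supp: "real n < 1 / (s - t) \<and> 1 / (s - t) < real n + 2" if "w n t \<noteq> 0" for n t
    using that by (auto simp: w_def \<rho>_def max_def min_def split: if_splits)
  have w_sum: "(\<Sum>n\<in>{N0..N}. w n t) = \<rho> N0 t - \<rho> (Suc N) t" if "N0 \<le> N" for N t
    using that
  proof (induction rule: dec_induct)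
    case base show ?case by (simp add: w_def)
  next
    case (step N) then show ?case by (simp add: w_def)
  qed
  have X_sum: "X t g = (\<Sum>n\<in>{N0..N}. scaleR (w n t) (Z n t g))" if "nat \<lceil>1 / (s - t)\<rceil> \<le> N" for t g N
    unfolding X_def
  proof (rule sum.mono_neutral_left)
    show "\<forall>n\<in>{N0..N} - {N0..nat \<lceil>1 / (s - t)\<rceil>}. scaleR (w n t) (Z n t g) = 0"
    proof
      fix n assume "n \<in> {N0..N} - {N0..nat \<lceil>1 / (s - t)\<rceil>}"
      then have "nat \<lceil>1 / (s - t)\<rceil> < n" by auto
      then have "1 / (s - t) \<le> real n" using real_nat_ceiling_ge[of "1 / (s - t)"] by linarith
      then have "w n t = 0" using w_supp[of n t] by fastforce
      then show "scaleR (w n t) (Z n t g) = 0" by simp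
    qed
  qed (use that in auto)
  have time: "u n < t \<and> t - u n < 1 / real n" if "n \<ge> N0" "t < s" "w n t \<noteq> 0" for n t
  proof -
    have "real n < 1 / (s - t)" using w_supp[OF that(3)] by blast
    moreover have "real n > 0" using that(1) N0 by simp
    ultimately have "s - t < 1 / real n" using that(2) by (simp add: field_simps)
    then show ?thesis using that(2) by (simp add: u_def)
  qed
  have Y_mem: "Y n \<in> intertwiners M \<theta> (u n)" if "n \<ge> N0" for n
    unfolding Y_def by (rule intertwiner_adjoint_compose[OF _ u0[OF that] C(1)]) (use x' in \<open>simp_all add: u_def\<close>)
  have X_mem: "X t \<in> intertwiners M \<theta> t" if t: "0 \<le> t" "t < s" for t
    unfolding X_def
  proof (rule intertwiner_combination[OF t(1)])
    fix n assume n: "n \<in> {N0..nat \<lceil>1 / (s - t)\<rceil>}" and wn: "w n t \<noteq> 0"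
    then have "u n < t" "n \<ge> N0" using time[of n t] t by auto
    then show "Z n t \<in> intertwiners M \<theta> t"
      using intertwiner_compose[OF _ u0 C(1) Y_mem, of "t - u n" n] by (simp add: Z_def max_def)
  qed simp
  have X_cont: "continuous_on {0..<s} (\<lambda>t. X t g)" for g
    unfolding continuous_on_eq_continuous_within
  proof
    fix t1 assume "t1 \<in> {0..<s}"
    then have t1: "0 \<le> t1" "t1 < s" by auto
    \<comment> \<open>On \<open>{0..<t2}\<close> a single finite index range serves all times, so
      continuity reduces to that of the terms.\<close>
    define t2 where "t2 = (t1 + s) / 2"
    have t2: "t1 < t2" "t2 < s" using t1 by (auto simp: t2_def)
    define N where "N = nat \<lceil>1 / (s - t2)\<rceil>"
    have term_cont: "continuous_on {0..<t2} (\<lambda>t. scaleR (w n t) (Z n t g))" for n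
    proof -
      have "continuous_on {0..<t2} (\<lambda>t. C (max 0 (t - u n)) (Y n g))"
        by (rule continuous_on_compose2[OF C(4)]) (auto intro!: continuous_intros)
      moreover have "continuous_on {0..<t2} (\<lambda>t. w n t)"
        unfolding w_def \<rho>_def using t2 by (intro continuous_intros) auto
      ultimately show ?thesis unfolding Z_def comp_def by (intro continuous_intros)
    qed
    have "continuous_on {0..<t2} (\<lambda>t. \<Sum>n\<in>{N0..N}. scaleR (w n t) (Z n t g))"
      by (intro continuous_on_sum term_cont)
    then have "continuous_on {0..<t2} (\<lambda>t. X t g)"
    proof (rule continuous_on_eq)
      fix t assume t: "t \<in> {0..<t2}"
      have "1 / (s - t) \<le> 1 / (s - t2)" using t t2 by (intro divide_left_mono) auto
      then have "nat \<lceil>1 / (s - t)\<rceil> \<le> N" unfolding N_def by (intro nat_mono ceiling_mono)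
      then show "(\<Sum>n\<in>{N0..N}. scaleR (w n t) (Z n t g)) = X t g" by (rule X_sum[symmetric])
    qed
    then have "continuous (at t1 within {0..<t2}) (\<lambda>t. X t g)"
      using t1 t2 by (simp add: continuous_on_eq_continuous_within)
    moreover have "at t1 within {0..<s} = at t1 within {0..<t2}"
      by (rule at_within_nhd[of _ "{..<t2}"]) (use t1 t2 in auto)
    ultimately show "continuous (at t1 within {0..<s}) (\<lambda>t. X t g)" by simp
  qed
  have X_lim: "((\<lambda>t. X t g) \<longlongrightarrow> x' g) (at_left s)" for g
  proof (rule tendstoI)
    fix e :: real assume e: "e > 0"
    define v where "v = x' g"
    \<comment> \<open>The first entry serves \<open>C r\<close> itself, the second its adjoint,
      whose defect is only controlled after squaring.\<close>
    define e1 where "e1 = min (e / 4) ((e / 4)\<^sup>2 / (2 * norm v + 1))"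
    have nv: "2 * norm v + 1 > 0" by (simp add: add_nonneg_pos)
    have e1: "e1 > 0" using e nv by (simp add: e1_def)
    from C(4)[of v, unfolded continuous_on_iff, rule_format, of 0 e1] e1
    obtain \<delta> where \<delta>: "\<delta> > 0" "\<And>r. r \<ge> 0 \<Longrightarrow> r < \<delta> \<Longrightarrow> norm (C r v - v) < e1"
      by (auto simp: dist_norm C(3))
    have near1: "norm (C r v - v) \<le> e / 4" if "r \<ge> 0" "r < \<delta>" for r
      using \<delta>(2)[OF that] by (simp add: e1_def)
    have near2: "norm (adjoint (C r) v - v) \<le> e / 4" if r: "r \<ge> 0" "r < \<delta>" for r
    proof (rule power2_le_imp_le)
      have "(norm (adjoint (C r) v - v))\<^sup>2 \<le> 2 * norm v * norm (C r v - v)"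
        by (rule adjoint_contraction_defect[OF Cb[OF r(1)] C(2)[OF r(1)]])
      also have "\<dots> \<le> (2 * norm v + 1) * e1"
        using \<delta>(2)[OF r] e1 by (intro mult_mono) auto
      also have "\<dots> \<le> (e / 4)\<^sup>2"
      proof -
        have "e1 \<le> (e / 4)\<^sup>2 / (2 * norm v + 1)" by (simp add: e1_def)
        then show ?thesis using nv by (simp only: pos_le_divide_eq mult.commute)
      qed
      finally show "(norm (adjoint (C r) v - v))\<^sup>2 \<le> (e / 4)\<^sup>2" .
    qed (use e in simp)
    \<comment> \<open>The first bound makes the weights sum to 1. By the second, an active index,
      which lies within 2 below \<open>1 / (s - t)\<close>, exceeds \<open>1 / \<delta>\<close>, so
      both the backward step \<open>1 / n\<close> and the shorter forward step are below
      \<open>\<delta>\<close>.\<close>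
    define d where "d = min (1 / (real N0 + 1)) (1 / (2 + 1 / \<delta>))"
    have d: "d > 0" using \<delta>(1) by (auto simp: d_def add_pos_pos)
    have close: "dist (X t g) (x' g) < e" if t: "s - d < t" "t < s" for t
    proof -
      let ?l = "1 / (s - t)"
      define N where "N = max N0 (nat \<lceil>?l\<rceil>)"
      have st: "0 < s - t" "s - t < 1 / (real N0 + 1)" "s - t < 1 / (2 + 1 / \<delta>)"
        using t by (auto simp: d_def)
      have l1: "?l > real N0 + 1" using st(1,2) by (simp add: field_simps)
      have "0 < 2 + 1 / \<delta>" using \<delta>(1) by (simp add: add_pos_pos)
      then have l2: "?l > 2 + 1 / \<delta>" using st(1,3) by (simp add: pos_less_divide_eq mult.commute)
      have lN: "?l \<le> real N"
        unfolding N_def using real_nat_ceiling_ge[of ?l] by (simp add: le_max_iff_disj)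
      have sum1: "(\<Sum>n\<in>{N0..N}. w n t) = 1"
        using w_sum[of N t] l1 lN by (simp add: N_def \<rho>_def)
      have Zn: "norm (Z n t g - v) \<le> e / 2" if n: "n \<in> {N0..N}" and wn: "w n t \<noteq> 0" for n
      proof -
        have un: "u n < t" "t - u n < 1 / real n" using time[of n t] n wn t by auto
        have "1 / \<delta> < real n" using w_supp[OF wn] l2 by linarith
        then have n\<delta>: "1 / real n < \<delta>" using \<delta>(1) n N0(1) by (simp add: field_simps)
        let ?r = "t - u n"
        have r: "?r \<ge> 0" "?r < \<delta>" using un n\<delta> by auto
        have "Z n t g - v = C ?r (adjoint (C (1 / real n)) v - v) + (C ?r v - v)"
          using un by (simp add: Z_def Y_def v_def max_def bounded_clinearD(6)[OF Cb[OF r(1)]])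
        then have "norm (Z n t g - v) \<le> norm (C ?r (adjoint (C (1 / real n)) v - v)) + norm (C ?r v - v)"
          by (simp only: norm_triangle_ineq)
        also have "\<dots> \<le> e / 4 + e / 4"
          by (intro add_mono near1 r order_trans[OF C(2)[OF r(1)] near2[OF _ n\<delta>]]) simp
        finally show ?thesis by simp
      qed
      have "X t g - v = (\<Sum>n\<in>{N0..N}. scaleR (w n t) (Z n t g)) - scaleR (\<Sum>n\<in>{N0..N}. w n t) v"
        using X_sum[of t N g] sum1 by (simp add: N_def)
      also have "\<dots> = (\<Sum>n\<in>{N0..N}. scaleR (w n t) (Z n t g - v))"
        by (simp add: scaleR_sum_left scaleR_diff_right sum_subtractf)
      finally have "norm (X t g - v) \<le> (\<Sum>n\<in>{N0..N}. norm (scaleR (w n t) (Z n t g - v)))"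
        by (simp only: norm_sum)
      also have "\<dots> \<le> (\<Sum>n\<in>{N0..N}. w n t * (e / 2))"
      proof (rule sum_mono)
        fix n assume "n \<in> {N0..N}"
        then show "norm (scaleR (w n t) (Z n t g - v)) \<le> w n t * (e / 2)"
          using Zn[of n] w_nonneg[of n t] by (cases "w n t = 0") (auto intro: mult_left_mono)
      qed
      also have "\<dots> = e / 2" by (simp only: sum_distrib_right[symmetric] sum1 mult_1)
      finally show ?thesis using e by (simp add: dist_norm v_def)
    qed
    show "\<forall>\<^sub>F t in at_left s. dist (X t g) (x' g) < e"
      unfolding eventually_at_left_field using d close by (intro exI[of _ "s - d"]) auto
  qed
  show ?thesis using X_mem X_cont X_lim by (intro exI[of _ X]) simp
qed

lemma strongly_continuous_section:
  assumes s: "s \<ge> 0" and x': "x' \<in> intertwiners M \<theta> s"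
  shows "\<exists>X. (\<forall>t\<ge>0. X t \<in> intertwiners M \<theta> t) \<and> X s = x' \<and> (\<forall>g. continuous_on {0..} (\<lambda>t. X t g))"
proof -
  obtain C where C: "\<And>t. t \<ge> 0 \<Longrightarrow> C t \<in> intertwiners M \<theta> t"
    "\<And>t x. t \<ge> 0 \<Longrightarrow> norm (C t x) \<le> norm x" "C 0 = id"
    "\<And>x. continuous_on {0..} (\<lambda>t. C t x)"
    by (rule continuous_intertwiners) blast
  have right: "C (t - s) \<circ> x' \<in> intertwiners M \<theta> t" if "t \<ge> s" for t
    using intertwiner_compose[OF _ s C(1) x', of "t - s"] that by simp
  have right_cont: "continuous_on {s..} (\<lambda>t. C (t - s) (x' g))" for g
    by (rule continuous_on_compose2[OF C(4)]) (auto intro!: continuous_intros)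
  show ?thesis
  proof (cases "s = 0")
    case True
    then show ?thesis using right right_cont C(3)
      by (intro exI[of _ "\<lambda>t. C (t - s) \<circ> x'"]) auto
  next
    case False
    then have s0: "s > 0" using s by simp
    have "\<exists>X. (\<forall>t\<ge>0. t < s \<longrightarrow> X t \<in> intertwiners M \<theta> t) \<and>
      (\<forall>g. continuous_on {0..<s} (\<lambda>t. X t g) \<and> ((\<lambda>t. X t g) \<longlongrightarrow> x' g) (at_left s))"
      by (rule left_section) (fact C s0 x')+
    then obtain L where L: "\<And>t. 0 \<le> t \<Longrightarrow> t < s \<Longrightarrow> L t \<in> intertwiners M \<theta> t"
      "\<And>g. continuous_on {0..<s} (\<lambda>t. L t g)" "\<And>g. ((\<lambda>t. L t g) \<longlongrightarrow> x' g) (at_left s)"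
      by auto
    define X where "X t = (if t < s then L t else C (t - s) \<circ> x')" for t
    have "continuous_on {0..} (\<lambda>t. X t g)" for g
    proof -
      have "continuous_on {0..s} (\<lambda>t. X t g)"
        unfolding continuous_on_eq_continuous_within
      proof
        fix t1 assume t1: "t1 \<in> {0..s}"
        show "continuous (at t1 within {0..s}) (\<lambda>t. X t g)"
        proof (cases "t1 = s")
          case True
          have "((\<lambda>t. X t g) \<longlongrightarrow> x' g) (at_left s)"
            by (rule Lim_transform_eventually[OF L(3)]) (simp add: eventually_at_filter X_def)
          then show ?thesis
            using True s0 by (simp add: continuous_within at_within_Icc_at_left X_def C(3))
        next
          case False
          have "continuous_on {0..<s} (\<lambda>t. X t g)"
            by (rule continuous_on_eq[OF L(2)]) (simp add: X_def)
          then have "continuous (at t1 within {0..<s}) (\<lambda>t. X t g)"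
            using t1 False by (simp add: continuous_on_eq_continuous_within)
          moreover have "at t1 within {0..s} = at t1 within {0..<s}"
            by (rule at_within_nhd[of _ "{..<s}"]) (use t1 False in auto)
          ultimately show ?thesis by simp
        qed
      qed
      moreover have "continuous_on {s..} (\<lambda>t. X t g)"
        by (rule continuous_on_eq[OF right_cont]) (simp add: X_def)
      ultimately have "continuous_on ({0..s} \<union> {s..}) (\<lambda>t. X t g)"
        by (intro continuous_on_closed_Un) auto
      moreover have "{0..s} \<union> {s..} = {0..}" using s by auto
      ultimately show ?thesis by simp
    qed
    moreover have "X t \<in> intertwiners M \<theta> t" if "t \<ge> 0" for t
      using that L(1) right by (simp add: X_def)
    moreover have "X s = x'" by (simp add: X_def C(3))
    ultimately show ?thesis by blast
  qed
qed

end

theorem theorem1p3: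
  fixes M :: "('g::complex_hilbert \<Rightarrow> 'g) set"
    and \<theta> :: "real \<Rightarrow> ('g \<Rightarrow> 'g) \<Rightarrow> ('g \<Rightarrow> 'g)"
  assumes "von_neumann_algebra M"
    and "E0_semigroup M \<theta>"
    and "faithful_semigroup M \<theta>"
    and "strongly_continuous_semigroup M \<theta>"
  shows "\<forall>s\<ge>0. \<forall>x'\<in>intertwiners M \<theta> s.
           \<exists>X :: real \<Rightarrow> ('g \<Rightarrow> 'g).
             (\<forall>t\<ge>0. X t \<in> intertwiners M \<theta> t) \<and> X s = x' \<and>
             (\<forall>g. continuous_on {0..} (\<lambda>t. X t g))"
proof -
  interpret E0 M \<theta> using assms(1,2,4) by unfold_locales
  show ?thesis using strongly_continuous_section by blast
qed

end
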